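(* Let $M^{2n+s}(f,Q,\xi_i,\eta^i,g)$ be a weak $\beta f$-Kenmotsu manifold with $\beta=\mathrm{const}\ne0$, and suppose that $(g,V)$ represents a $\ast$-$\eta$-Ricci soliton with constants $\lambda,\mu\in\mathbb{R}$, that is, $V$ is a vector field on $M$ and $$\tfrac12\,\pounds_V g+\mathrm{Ric}^\ast=\lambda\Big\{g-\sum_i\eta^i\otimes\eta^i\Big\}+(\lambda+\mu)\,\bar\eta\otimes\bar\eta .$$ If $V$ is orthogonal to $\mathcal{D}$, i.e. $V=\sum_i\delta^i\xi_i\ne0$ for some smooth functions $\delta^i$ on $M$, then $X(\delta^i)=0$ for all $i$ and all $X\in\mathcal{D}$; moreover, $(M,g)$ is an $\eta$-Einstein manifold, $$\mathrm{Ric}=a\,g-a\sum_i\eta^i\otimes\eta^i+(a+b)\,\bar\eta\otimes\bar\eta ,$$ with $a=-2sn\beta^2$ and $b=2(s-1)n\beta^2$, of constant scalar curvature $r=-2sn(2n+1)\beta^2$.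
   Context: A weak metric $f$-structure on a smooth manifold $M^{2n+s}$ ($n>0$, $s>1$) is a set $(f,Q,\xi_i,\eta^i,g)$, where $f$ is a skew-symmetric $(1,1)$-tensor of rank $2n$, $Q$ is a self-adjoint nonsingular $(1,1)$-tensor, $\xi_i$ ($1\le i\le s$) are orthonormal vector fields, $\eta^i$ are dual 1-forms, and $g$ is a Riemannian metric, such that $f^2=-Q+\sum_i\eta^i\otimes\xi_i$, $\eta^i(\xi_j)=\delta^i_j$, $Q\xi_i=\xi_i$, and $g(fX,fY)=g(X,QY)-\sum_i\eta^i(X)\eta^i(Y)$ for all vector fields $X,Y$. Put $\bar\xi=\sum_i\xi_i$, $\bar\eta=\sum_i\eta^i$, and $\mathcal{D}=\bigcap_{i=1}^s\ker\eta^i$. The structure is normal if $[f,f](X,Y)+2\sum_i d\eta^i(X,Y)\,\xi_i=0$ for all $X,Y$, where $[f,f](X,Y)=f^2[X,Y]+[fX,fY]-f[fX,Y]-f[X,fY]$ and $d\omega(X,Y)=\tfrac12\{X(\omega(Y))-Y(\omega(X))-\omega([X,Y])\}$. A weak $\beta f$-Kenmotsu manifold is a weak metric $f$-manifold, normal (i.e. $[f,f](X,Y)+2\sum_i d\eta^i(X,Y)\,\xi_i=0$ for all vector fields $X,Y$), satisfying $(\nabla_Xf)Y=\beta\{g(fX,Y)\,\bar\xi-\bar\eta(Y)fX\}$ for all $X,Y$, where $\nabla$ is the Levi-Civita connection of $g$. Conventions: $R_{X,Y}=[\nabla_X,\nabla_Y]-\nabla_{[X,Y]}$; $\mathrm{Ric}(X,Y)=\mathrm{trace}(Z\mapsto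 R_{Z,X}Y)$; $r=\mathrm{trace}_g\,\mathrm{Ric}$; the $\ast$-Ricci tensor is $\mathrm{Ric}^\ast(X,Y)=\tfrac12\,\mathrm{trace}\{Z\mapsto R_{X,fY}fZ\}$; $\pounds$ is the Lie derivative. *)

theory Defs
  imports "HOL-Analysis.Analysis" "HOL-Library.Function_Algebras"
begin

text \<open>
  A manifold is carried by a whole type of class \<open>t2_space\<close> and \<open>second_countable_topology\<close>;
  the smooth structure is given by a (not necessarily maximal) smooth atlas.  A chart is an open
  set together with a coordinate map, whose values outside the chart domain are irrelevant.
\<close>

primrec Ck_on :: "nat \<Rightarrow> 'e::euclidean_space set \<Rightarrow> ('e \<Rightarrow> 'b::real_normed_vector) \<Rightarrow> bool" where
  "Ck_on 0 S f \<longleftrightarrow> continuous_on S f"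
| "Ck_on (Suc k) S f \<longleftrightarrow>
     (\<forall>x\<in>S. f differentiable (at x)) \<and> (\<forall>v. Ck_on k S (\<lambda>x. frechet_derivative f (at x) v))"

text \<open>Intended for open \<open>S\<close> only.\<close>

definition smooth_on :: "'e::euclidean_space set \<Rightarrow> ('e \<Rightarrow> 'b::real_normed_vector) \<Rightarrow> bool" where
  "smooth_on S f \<longleftrightarrow> (\<forall>k. Ck_on k S f)"

type_synonym ('a, 'e) atlas = "('a set \<times> ('a \<Rightarrow> 'e)) set"

locale smooth_manifold =
  fixes A :: "('a::{t2_space, second_countable_topology}, 'e::euclidean_space) atlas"
  assumes chart_open: "(U, \<phi>) \<in> A \<Longrightarrow> open U \<and> open (\<phi> ` U)"
    and chart_homeo: "(U, \<phi>) \<in> A \<Longrightarrow> homeomorphism U (\<phi> ` U) \<phi> (inv_into U \<phi>)"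
    and chart_cover: "(\<Union>(U, \<phi>)\<in>A. U) = UNIV"
    and chart_compatible: "(U, \<phi>) \<in> A \<Longrightarrow> (W, \<psi>) \<in> A \<Longrightarrow>
           smooth_on (\<phi> ` (U \<inter> W)) (\<psi> \<circ> inv_into U \<phi>)"

definition smooth_fun :: "('a, 'e::euclidean_space) atlas \<Rightarrow> ('a \<Rightarrow> real) \<Rightarrow> bool" where
  "smooth_fun A h \<longleftrightarrow> (\<forall>(U, \<phi>)\<in>A. smooth_on (\<phi> ` U) (h \<circ> inv_into U \<phi>))"

text \<open>
  Vector fields are the derivations of the algebra of smooth functions.  They are set to \<open>0\<close> on
  nonsmooth functions, so that two vector fields are equal iff they agree on smooth functions.
  Sums, differences and \<open>0\<close> of functions and of vector fields are the pointwise ones of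
  \<^theory>\<open>HOL-Library.Function_Algebras\<close>.
\<close>

type_synonym 'a vfield = "('a \<Rightarrow> real) \<Rightarrow> 'a \<Rightarrow> real"

definition vector_field :: "('a, 'e::euclidean_space) atlas \<Rightarrow> 'a vfield \<Rightarrow> bool" where
  "vector_field A X \<longleftrightarrow>
     (\<forall>h. smooth_fun A h \<longrightarrow> smooth_fun A (X h)) \<and>
     (\<forall>h k. smooth_fun A h \<longrightarrow> smooth_fun A k \<longrightarrow> X (h + k) = X h + X k) \<and>
     (\<forall>c h. smooth_fun A h \<longrightarrow> X (\<lambda>p. c * h p) = (\<lambda>p. c * X h p)) \<and>
     (\<forall>h k. smooth_fun A h \<longrightarrow> smooth_fun A k \<longrightarrow> X (h * k) = X h * k + h * X k) \<and>
     (\<forall>h. \<not> smooth_fun A h \<longrightarrow> X h = 0)"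

definition fmult :: "('a \<Rightarrow> real) \<Rightarrow> 'a vfield \<Rightarrow> 'a vfield"  (infixr "\<odot>" 75) where
  "h \<odot> X = (\<lambda>k p. h p * X k p)"

definition bracket :: "'a vfield \<Rightarrow> 'a vfield \<Rightarrow> 'a vfield" where
  "bracket X Y = (\<lambda>h. X (Y h) - Y (X h))"

definition value_at :: "'a vfield \<Rightarrow> 'a \<Rightarrow> ('a \<Rightarrow> real) \<Rightarrow> real" where
  "value_at X p = (\<lambda>h. X h p)"

text \<open>
  Every tangent vector at \<open>p\<close> extends to a global vector field, so the tangent space at \<open>p\<close> is
  the set of values at \<open>p\<close> of the global vector fields.
\<close>

definition tangent_space :: "('a, 'e::euclidean_space) atlas \<Rightarrow> 'a \<Rightarrow> (('a \<Rightarrow> real) \<Rightarrow> real) set" where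
  "tangent_space A p = {value_at X p | X. vector_field A X}"

definition fscale :: "real \<Rightarrow> ('x \<Rightarrow> real) \<Rightarrow> 'x \<Rightarrow> real" where
  "fscale c v = (\<lambda>x. c * v x)"

interpretation fvs: vector_space fscale
  by unfold_locales (auto simp: fscale_def algebra_simps fun_eq_iff)

definition lin_trace :: "('x \<Rightarrow> real) set \<Rightarrow> (('x \<Rightarrow> real) \<Rightarrow> ('x \<Rightarrow> real)) \<Rightarrow> real" where
  "lin_trace T L =
     (let B = (SOME B. fvs.independent B \<and> fvs.span B = T)
      in \<Sum>b\<in>B. fvs.representation B (L b) b)"

text \<open>
  A function-linear map \<open>F\<close> on vector fields induces a linear map on each tangent space, because
  the value of \<open>F X\<close> at \<open>p\<close> depends only on the value of \<open>X\<close> at \<open>p\<close>.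
\<close>

definition map_at :: "('a, 'e::euclidean_space) atlas \<Rightarrow> ('a vfield \<Rightarrow> 'a vfield) \<Rightarrow> 'a \<Rightarrow>
    (('a \<Rightarrow> real) \<Rightarrow> real) \<Rightarrow> ('a \<Rightarrow> real) \<Rightarrow> real" where
  "map_at A F p v = value_at (F (SOME X. vector_field A X \<and> value_at X p = v)) p"

definition trace_at :: "('a, 'e::euclidean_space) atlas \<Rightarrow> ('a vfield \<Rightarrow> 'a vfield) \<Rightarrow> 'a \<Rightarrow> real" where
  "trace_at A F p = lin_trace (tangent_space A p) (map_at A F p)"

definition rank_at :: "('a, 'e::euclidean_space) atlas \<Rightarrow> ('a vfield \<Rightarrow> 'a vfield) \<Rightarrow> 'a \<Rightarrow> nat" where
  "rank_at A F p = fvs.dim {value_at (F X) p | X. vector_field A X}"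

definition tensor11 :: "('a, 'e::euclidean_space) atlas \<Rightarrow> ('a vfield \<Rightarrow> 'a vfield) \<Rightarrow> bool" where
  "tensor11 A F \<longleftrightarrow>
     (\<forall>X. vector_field A X \<longrightarrow> vector_field A (F X)) \<and>
     (\<forall>X Y. vector_field A X \<longrightarrow> vector_field A Y \<longrightarrow> F (X + Y) = F X + F Y) \<and>
     (\<forall>h X. smooth_fun A h \<longrightarrow> vector_field A X \<longrightarrow> F (h \<odot> X) = h \<odot> F X)"

definition one_form :: "('a, 'e::euclidean_space) atlas \<Rightarrow> ('a vfield \<Rightarrow> 'a \<Rightarrow> real) \<Rightarrow> bool" where
  "one_form A \<omega> \<longleftrightarrow>
     (\<forall>X. vector_field A X \<longrightarrow> smooth_fun A (\<omega> X)) \<and>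
     (\<forall>X Y. vector_field A X \<longrightarrow> vector_field A Y \<longrightarrow> \<omega> (X + Y) = \<omega> X + \<omega> Y) \<and>
     (\<forall>h X. smooth_fun A h \<longrightarrow> vector_field A X \<longrightarrow> \<omega> (h \<odot> X) = h * \<omega> X)"

type_synonym 'a form2 = "'a vfield \<Rightarrow> 'a vfield \<Rightarrow> 'a \<Rightarrow> real"

text \<open>Additivity and homogeneity in the second argument follow from symmetry.\<close>

definition riemannian_metric :: "('a, 'e::euclidean_space) atlas \<Rightarrow> 'a form2 \<Rightarrow> bool" where
  "riemannian_metric A g \<longleftrightarrow>
     (\<forall>Y. vector_field A Y \<longrightarrow> one_form A (\<lambda>X. g X Y)) \<and>
     (\<forall>X Y. vector_field A X \<longrightarrow> vector_field A Y \<longrightarrow> g X Y = g Y X) \<and>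
     (\<forall>X p. vector_field A X \<longrightarrow> value_at X p \<noteq> 0 \<longrightarrow> g X X p > 0)"

definition orthonormal_frame_at ::
    "('a, 'e::euclidean_space) atlas \<Rightarrow> 'a form2 \<Rightarrow> 'a \<Rightarrow> (nat \<Rightarrow> 'a vfield) \<Rightarrow> bool" where
  "orthonormal_frame_at A g p E \<longleftrightarrow>
     (\<forall>i<DIM('e). vector_field A (E i)) \<and>
     (\<forall>i<DIM('e). \<forall>j<DIM('e). g (E i) (E j) p = (if i = j then 1 else 0))"

definition metric_trace_at ::
    "('a, 'e::euclidean_space) atlas \<Rightarrow> 'a form2 \<Rightarrow> 'a form2 \<Rightarrow> 'a \<Rightarrow> real" where
  "metric_trace_at A g T p =
     (let E = (SOME E. orthonormal_frame_at A g p E) in \<Sum>i<DIM('e). T (E i) (E i) p)"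

definition ext_deriv :: "('a vfield \<Rightarrow> 'a \<Rightarrow> real) \<Rightarrow> 'a form2" where
  "ext_deriv \<omega> X Y = (\<lambda>p. (X (\<omega> Y) p - Y (\<omega> X) p - \<omega> (bracket X Y) p) / 2)"

definition lie_deriv :: "'a vfield \<Rightarrow> 'a form2 \<Rightarrow> 'a form2" where
  "lie_deriv V g X Y = (\<lambda>p. V (g X Y) p - g (bracket V X) Y p - g X (bracket V Y) p)"

type_synonym 'a conn = "'a vfield \<Rightarrow> 'a vfield \<Rightarrow> 'a vfield"

definition connection :: "('a, 'e::euclidean_space) atlas \<Rightarrow> 'a conn \<Rightarrow> bool" where
  "connection A nabla \<longleftrightarrow>
     (\<forall>Y. vector_field A Y \<longrightarrow> tensor11 A (\<lambda>X. nabla X Y)) \<and>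
     (\<forall>X Y Z. vector_field A X \<longrightarrow> vector_field A Y \<longrightarrow> vector_field A Z \<longrightarrow>
        nabla X (Y + Z) = nabla X Y + nabla X Z) \<and>
     (\<forall>h X Y. smooth_fun A h \<longrightarrow> vector_field A X \<longrightarrow> vector_field A Y \<longrightarrow>
        nabla X (h \<odot> Y) = X h \<odot> Y + h \<odot> nabla X Y)"

definition levi_civita :: "('a, 'e::euclidean_space) atlas \<Rightarrow> 'a form2 \<Rightarrow> 'a conn \<Rightarrow> bool" where
  "levi_civita A g nabla \<longleftrightarrow> connection A nabla \<and>
     (\<forall>X Y. vector_field A X \<longrightarrow> vector_field A Y \<longrightarrow> nabla X Y - nabla Y X = bracket X Y) \<and>
     (\<forall>X Y Z. vector_field A X \<longrightarrow> vector_field A Y \<longrightarrow> vector_field A Z \<longrightarrow>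
        X (g Y Z) = g (nabla X Y) Z + g Y (nabla X Z))"

definition curvature :: "'a conn \<Rightarrow> 'a vfield \<Rightarrow> 'a vfield \<Rightarrow> 'a vfield \<Rightarrow> 'a vfield" where
  "curvature nabla X Y Z = nabla X (nabla Y Z) - nabla Y (nabla X Z) - nabla (bracket X Y) Z"

definition ricci :: "('a, 'e::euclidean_space) atlas \<Rightarrow> 'a conn \<Rightarrow> 'a form2" where
  "ricci A nabla X Y = (\<lambda>p. trace_at A (\<lambda>Z. curvature nabla Z X Y) p)"

definition scalar_curvature ::
    "('a, 'e::euclidean_space) atlas \<Rightarrow> 'a form2 \<Rightarrow> 'a conn \<Rightarrow> 'a \<Rightarrow> real" where
  "scalar_curvature A g nabla p = metric_trace_at A g (ricci A nabla) p"

definition star_ricci ::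
    "('a, 'e::euclidean_space) atlas \<Rightarrow> ('a vfield \<Rightarrow> 'a vfield) \<Rightarrow> 'a conn \<Rightarrow> 'a form2" where
  "star_ricci A f nabla X Y = (\<lambda>p. trace_at A (\<lambda>Z. curvature nabla X (f Y) (f Z)) p / 2)"

text \<open>The families \<open>\<xi>\<close> and \<open>\<eta>\<close> are only relevant on the indices \<open>1..s\<close>.\<close>

definition eta_bar :: "nat \<Rightarrow> (nat \<Rightarrow> 'a vfield \<Rightarrow> 'a \<Rightarrow> real) \<Rightarrow> 'a vfield \<Rightarrow> 'a \<Rightarrow> real" where
  "eta_bar s \<eta> X = (\<Sum>i=1..s. \<eta> i X)"

definition xi_bar :: "nat \<Rightarrow> (nat \<Rightarrow> 'a vfield) \<Rightarrow> 'a vfield" where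
  "xi_bar s \<xi> = (\<Sum>i=1..s. \<xi> i)"

locale weak_metric_f_manifold = smooth_manifold A
  for A :: "('a::{t2_space, second_countable_topology}, 'e::euclidean_space) atlas" +
  fixes n s :: nat
    and f Q :: "'a vfield \<Rightarrow> 'a vfield"
    and \<xi> :: "nat \<Rightarrow> 'a vfield"
    and \<eta> :: "nat \<Rightarrow> 'a vfield \<Rightarrow> 'a \<Rightarrow> real"
    and g :: "'a form2"
  assumes n_pos: "n > 0" and s_gt_1: "s > 1"
    and dim_M: "DIM('e) = 2 * n + s"
    and metric: "riemannian_metric A g"
    and f_tensor: "tensor11 A f"
    and f_skew: "vector_field A X \<Longrightarrow> vector_field A Y \<Longrightarrow> g (f X) Y = - g X (f Y)"
    and f_rank: "rank_at A f p = 2 * n"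
    and Q_tensor: "tensor11 A Q"
    and Q_selfadjoint: "vector_field A X \<Longrightarrow> vector_field A Y \<Longrightarrow> g (Q X) Y = g X (Q Y)"
    and Q_nonsingular: "vector_field A X \<Longrightarrow> value_at (Q X) p = 0 \<Longrightarrow> value_at X p = 0"
    and xi_field: "i \<in> {1..s} \<Longrightarrow> vector_field A (\<xi> i)"
    and xi_orthonormal: "i \<in> {1..s} \<Longrightarrow> j \<in> {1..s} \<Longrightarrow>
           g (\<xi> i) (\<xi> j) = (\<lambda>p. if i = j then 1 else 0)"
    and eta_form: "i \<in> {1..s} \<Longrightarrow> one_form A (\<eta> i)"
    and eta_dual: "i \<in> {1..s} \<Longrightarrow> j \<in> {1..s} \<Longrightarrow> \<eta> i (\<xi> j) = (\<lambda>p. if i = j then 1 else 0)"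
    and f_square: "vector_field A X \<Longrightarrow> f (f X) = - Q X + (\<Sum>i=1..s. \<eta> i X \<odot> \<xi> i)"
    and Q_xi: "i \<in> {1..s} \<Longrightarrow> Q (\<xi> i) = \<xi> i"
    and compatible: "vector_field A X \<Longrightarrow> vector_field A Y \<Longrightarrow>
           g (f X) (f Y) = g X (Q Y) - (\<Sum>i=1..s. \<eta> i X * \<eta> i Y)"

definition nijenhuis :: "('a vfield \<Rightarrow> 'a vfield) \<Rightarrow> 'a vfield \<Rightarrow> 'a vfield \<Rightarrow> 'a vfield" where
  "nijenhuis f X Y =
     f (f (bracket X Y)) + bracket (f X) (f Y) - f (bracket (f X) Y) - f (bracket X (f Y))"

definition normal_structure :: "('a, 'e::euclidean_space) atlas \<Rightarrow> nat \<Rightarrow> ('a vfield \<Rightarrow> 'a vfield) \<Rightarrow>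
    (nat \<Rightarrow> 'a vfield) \<Rightarrow> (nat \<Rightarrow> 'a vfield \<Rightarrow> 'a \<Rightarrow> real) \<Rightarrow> bool" where
  "normal_structure A s f \<xi> \<eta> \<longleftrightarrow>
     (\<forall>X Y. vector_field A X \<longrightarrow> vector_field A Y \<longrightarrow>
        nijenhuis f X Y + (\<Sum>i=1..s. (\<lambda>p. 2 * ext_deriv (\<eta> i) X Y p) \<odot> \<xi> i) = 0)"

text \<open>In general \<open>\<beta>\<close> is a smooth function.\<close>

locale weak_beta_f_kenmotsu = weak_metric_f_manifold A n s f Q \<xi> \<eta> g
  for A :: "('a::{t2_space, second_countable_topology}, 'e::euclidean_space) atlas"
    and n s f Q \<xi> \<eta> g +
  fixes nabla :: "'a conn" and \<beta> :: "'a \<Rightarrow> real"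
  assumes beta_smooth: "smooth_fun A \<beta>"
    and normal: "normal_structure A s f \<xi> \<eta>"
    and levi_civita: "levi_civita A g nabla"
    and nabla_f: "vector_field A X \<Longrightarrow> vector_field A Y \<Longrightarrow>
           nabla X (f Y) - f (nabla X Y) = \<beta> \<odot> (g (f X) Y \<odot> xi_bar s \<xi> - eta_bar s \<eta> Y \<odot> f X)"

definition star_eta_ricci_soliton :: "('a, 'e::euclidean_space) atlas \<Rightarrow> nat \<Rightarrow>
    ('a vfield \<Rightarrow> 'a vfield) \<Rightarrow> (nat \<Rightarrow> 'a vfield \<Rightarrow> 'a \<Rightarrow> real) \<Rightarrow> 'a form2 \<Rightarrow> 'a conn \<Rightarrow>
    'a vfield \<Rightarrow> real \<Rightarrow> real \<Rightarrow> bool" where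
  "star_eta_ricci_soliton A s f \<eta> g nabla V lam mu \<longleftrightarrow> vector_field A V \<and>
     (\<forall>X Y p. vector_field A X \<longrightarrow> vector_field A Y \<longrightarrow>
        lie_deriv V g X Y p / 2 + star_ricci A f nabla X Y p =
          lam * (g X Y p - (\<Sum>i=1..s. \<eta> i X p * \<eta> i Y p))
          + (lam + mu) * (eta_bar s \<eta> X p * eta_bar s \<eta> Y p))"

definition eta_einstein :: "('a, 'e::euclidean_space) atlas \<Rightarrow> nat \<Rightarrow>
    (nat \<Rightarrow> 'a vfield \<Rightarrow> 'a \<Rightarrow> real) \<Rightarrow> 'a form2 \<Rightarrow> 'a conn \<Rightarrow> ('a \<Rightarrow> real) \<Rightarrow> ('a \<Rightarrow> real) \<Rightarrow> bool" where
  "eta_einstein A s \<eta> g nabla a b \<longleftrightarrow>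
     (\<forall>X Y p. vector_field A X \<longrightarrow> vector_field A Y \<longrightarrow>
        ricci A nabla X Y p =
          a p * g X Y p - a p * (\<Sum>i=1..s. \<eta> i X p * \<eta> i Y p)
          + (a p + b p) * (eta_bar s \<eta> X p * eta_bar s \<eta> Y p))"

end

theory Submission
  imports Defs
begin

text \<open>
  The structure equations make every \<open>\<xi> i\<close> satisfy \<open>\<nabla>\<^sub>X \<xi> i = \<beta> P X\<close>, where \<open>P\<close> is the
  projection onto \<open>\<D>\<close>; this determines the curvature in the directions \<open>\<xi> i\<close> and the Lie derivatives
  of \<open>g\<close>, \<open>f\<close>, the connection and hence the \<open>*\<close>-Ricci tensor along \<open>\<xi> i\<close>.  On \<open>\<D>\<close> the soliton
  equation reads \<open>Ric* = (\<lambda> - \<beta> d) g\<close> with \<open>d = \<Sum>i. \<delta> i\<close>.  Its Lie derivative along \<open>\<xi> i\<close> forces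
  \<open>g(fX, fY) = \<kappa> g(X, Y)\<close> on \<open>\<D>\<close>, that is, \<open>Q\<close> is the multiple \<open>\<kappa>\<close> of the identity there; a second
  Lie derivative, together with the \<open>(\<xi> i, \<xi> j)\<close> components of the soliton equation, shows that
  \<open>d\<close> is constant along all \<open>\<xi> j\<close>, and then \<open>Ric* = - s \<beta>\<^sup>2 \<kappa> g\<close> on \<open>\<D>\<close>.  The first Bianchi
  identity and the Ricci identity for \<open>f\<close> give \<open>Ric* = \<kappa> (Ric + (2n - 1) s \<beta>\<^sup>2 g)\<close> on \<open>\<D>\<close>, so
  that \<open>Ric = - 2 s n \<beta>\<^sup>2 g\<close> there.
\<close>

section \<open>Smooth functions on Euclidean spaces\<close>

text \<open>Vector fields are derivations and a trace refers to a basis picked by choice, so neither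
  the dimension of a tangent space, nor pointwise dependence, nor a rule for differentiating a trace
  comes for free; the analytic half exists to supply these. The geometric obstacle is that
  \<open>d\<close> is not known to be constant, so on \<D> the soliton equation only makes the
  star-Ricci tensor a function times \<open>g\<close>. Two growth laws are played against each
  other: along \<xi> i the metric grows on \<D> at rate 2 \<beta>, whereas the star-Ricci tensor
  picks up an inhomogeneous term in \<open>g (f X) (f Y)\<close>, because \<open>f\<close> is
  invariant but the curvature is not. That term is what ties \<open>Q\<close> to the identity.
  Nonsingularity of \<open>Q\<close> gives \<kappa> \<noteq> 0, and cancelling \<kappa> is what
  frees Ric of all soliton data.\<close>

lemma frechet_derivative_eq: "(f has_derivative D) (at x) \<Longrightarrow> frechet_derivative f (at x) = D"
  using frechet_derivative_at by metis

lemma Ck_on_cong: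
  assumes "open S" "\<And>x. x \<in> S \<Longrightarrow> f x = g x"
  shows "Ck_on k S f \<longleftrightarrow> Ck_on k S g"
  using assms(2)
proof (induction k arbitrary: f g)
  case 0
  then show ?case by (simp cong: continuous_on_cong)
next
  case (Suc k)
  have der: "(f has_derivative D) (at x) \<longleftrightarrow> (g has_derivative D) (at x)" if "x \<in> S" for x D
    using that Suc.prems assms(1)
    by (auto intro: has_derivative_transform_within_open[of f D x UNIV S g]
        has_derivative_transform_within_open[of g D x UNIV S f])
  have diff: "(f differentiable (at x)) \<longleftrightarrow> (g differentiable (at x))" if "x \<in> S" for x
    using der[OF that] by (simp add: differentiable_def)
  have fd: "frechet_derivative f (at x) = frechet_derivative g (at x)" if "x \<in> S" for x
    using der[OF that] by (simp add: frechet_derivative_def)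
  show ?case
    using Suc.IH[of "\<lambda>x. frechet_derivative f (at x) v" "\<lambda>x. frechet_derivative g (at x) v" for v]
    by (simp add: diff fd)
qed

lemma Ck_on_SucD: "Ck_on (Suc k) S f \<Longrightarrow> Ck_on k S f"
proof (induction k arbitrary: f)
  case 0
  then show ?case
    by (auto intro!: continuous_at_imp_continuous_on differentiable_imp_continuous_within)
next
  case (Suc k)
  then show ?case by (metis Ck_on.simps(2))
qed

lemma Ck_on_subset: "Ck_on k S f \<Longrightarrow> T \<subseteq> S \<Longrightarrow> Ck_on k T f"
  by (induction k arbitrary: f) (auto intro: continuous_on_subset)

lemma Ck_on_Un: "open S \<Longrightarrow> open T \<Longrightarrow> Ck_on k S f \<Longrightarrow> Ck_on k T f \<Longrightarrow> Ck_on k (S \<union> T) f"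
  by (induction k arbitrary: f) (auto intro: continuous_on_open_Un)

lemma Ck_on_const: "Ck_on k S (\<lambda>_. c)"
  by (induction k arbitrary: c) (auto simp: frechet_derivative_const)

lemma Ck_on_add:
  assumes "open S" "Ck_on k S f" "Ck_on k S g" shows "Ck_on k S (\<lambda>x. f x + g x)"
  using assms(2,3)
proof (induction k arbitrary: f g)
  case (Suc k)
  have "frechet_derivative (\<lambda>x. f x + g x) (at x) v
      = frechet_derivative f (at x) v + frechet_derivative g (at x) v" if "x \<in> S" for x v
    using Suc.prems that
    by (subst frechet_derivative_eq[OF has_derivative_add[of f "frechet_derivative f (at x)" _ g "frechet_derivative g (at x)"]])
       (auto simp: frechet_derivative_works[symmetric])
  then have "Ck_on k S (\<lambda>x. frechet_derivative (\<lambda>x. f x + g x) (at x) v) \<longleftrightarrow>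
    Ck_on k S (\<lambda>x. frechet_derivative f (at x) v + frechet_derivative g (at x) v)" for v
    by (intro Ck_on_cong[OF assms(1)]) simp
  with Suc show ?case by simp
qed (auto intro: continuous_intros)

lemma Ck_on_mult:
  fixes f g :: "'e::euclidean_space \<Rightarrow> real"
  assumes "open S" "Ck_on k S f" "Ck_on k S g" shows "Ck_on k S (\<lambda>x. f x * g x)"
  using assms(2,3)
proof (induction k arbitrary: f g)
  case (Suc k)
  have "frechet_derivative (\<lambda>x. f x * g x) (at x) v
      = f x * frechet_derivative g (at x) v + frechet_derivative f (at x) v * g x" if "x \<in> S" for x v
    using Suc.prems that
    by (subst frechet_derivative_eq[OF has_derivative_mult[of f "frechet_derivative f (at x)" x UNIV g "frechet_derivative g (at x)"]])
       (auto simp: frechet_derivative_works[symmetric])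
  then have "Ck_on k S (\<lambda>x. frechet_derivative (\<lambda>x. f x * g x) (at x) v) \<longleftrightarrow>
    Ck_on k S (\<lambda>x. f x * frechet_derivative g (at x) v + frechet_derivative f (at x) v * g x)" for v
    by (intro Ck_on_cong[OF assms(1)]) simp
  with Suc Ck_on_SucD[OF Suc.prems(1)] Ck_on_SucD[OF Suc.prems(2)] show ?case
    by (auto intro!: Ck_on_add assms(1) differentiable_mult)
qed (auto intro: continuous_intros)

lemma Ck_on_linear:
  assumes "open S" "bounded_linear L" "Ck_on k S f" shows "Ck_on k S (\<lambda>x. L (f x))"
  using assms(3)
proof (induction k arbitrary: f)
  case 0
  then show ?case by (auto intro: bounded_linear.continuous_on[OF assms(2)])
next
  case (Suc k)
  have der: "((\<lambda>x. L (f x)) has_derivative (\<lambda>v. L (frechet_derivative f (at x) v))) (at x)" if "x \<in> S" for x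
    using Suc.prems that by (intro bounded_linear.has_derivative[OF assms(2)]) (auto simp: frechet_derivative_works[symmetric])
  have "Ck_on k S (\<lambda>x. frechet_derivative (\<lambda>x. L (f x)) (at x) v) \<longleftrightarrow>
    Ck_on k S (\<lambda>x. L (frechet_derivative f (at x) v))" for v
    using frechet_derivative_eq[OF der] by (intro Ck_on_cong[OF assms(1)]) simp
  with Suc der show ?case by (auto simp: differentiable_def)
qed

lemma Ck_on_sum:
  assumes "open S" "\<And>i. i \<in> I \<Longrightarrow> Ck_on k S (f i)" shows "Ck_on k S (\<lambda>x. \<Sum>i\<in>I. f i x)"
  using assms(2)
  by (induction I rule: infinite_finite_induct) (auto intro!: Ck_on_add assms(1) Ck_on_const)

lemma Ck_on_ident: "Ck_on k S (\<lambda>x. x)"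
  by (cases k) (auto simp: frechet_derivative_eq[OF has_derivative_ident] intro: Ck_on_const)

lemma Ck_on_inner:
  fixes f g :: "'e::euclidean_space \<Rightarrow> 'b::euclidean_space"
  assumes "open S" "Ck_on k S f" "Ck_on k S g"
  shows "Ck_on k S (\<lambda>x. f x \<bullet> g x)"
proof -
  have comp: "Ck_on k S (\<lambda>x. h x \<bullet> b)" if "Ck_on k S h" for h :: "'e \<Rightarrow> 'b" and b
    by (rule Ck_on_linear[OF assms(1) bounded_linear_inner_left that])
  have "Ck_on k S (\<lambda>x. \<Sum>b\<in>Basis. (f x \<bullet> b) * (g x \<bullet> b))"
    by (intro Ck_on_sum Ck_on_mult comp assms)
  then show ?thesis by (subst euclidean_inner)
qed

text \<open>When base point and direction both vary, expanding the direction in the basis separates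
  the two: only derivatives in fixed directions remain, and those are what \<open>Ck_on\<close>
  controls.\<close>

lemma frechet_derivative_basis:
  fixes h :: "'d::euclidean_space \<Rightarrow> real"
  assumes "h differentiable (at y)"
  shows "frechet_derivative h (at y) v = (\<Sum>b\<in>Basis. (v \<bullet> b) * frechet_derivative h (at y) b)"
  (is "?D v = _")
proof -
  have lin: "linear ?D" using assms by (rule linear_frechet_derivative)
  have "?D v = ?D (\<Sum>b\<in>Basis. (v \<bullet> b) *\<^sub>R b)" by (simp add: euclidean_representation)
  also have "\<dots> = (\<Sum>b\<in>Basis. (v \<bullet> b) * ?D b)"
    by (simp add: linear_sum[OF lin] linear_cmul[OF lin])
  finally show ?thesis .
qed

lemma Ck_on_compose:
  fixes f :: "'e::euclidean_space \<Rightarrow> 'd::euclidean_space" and h :: "'d \<Rightarrow> real"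
  assumes "open S" "open T" "Ck_on k S f" "Ck_on k T h" "f ` S \<subseteq> T"
  shows "Ck_on k S (\<lambda>x. h (f x))"
  using assms(3,4)
proof (induction k arbitrary: h)
  case 0
  then show ?case using assms(5) by (auto intro: continuous_on_compose2)
next
  case (Suc k)
  have der: "((\<lambda>x. h (f x)) has_derivative
      (\<lambda>v. frechet_derivative h (at (f x)) (frechet_derivative f (at x) v))) (at x)" if "x \<in> S" for x
    using Suc.prems that assms(5)
    by (intro has_derivative_compose[of f _ x UNIV h]) (auto simp: frechet_derivative_works[symmetric])
  \<comment> \<open>The chain rule in coordinates: each factor
    \<open>frechet_derivative h (at (f x)) b\<close> is again a composition with \<open>f\<close>,
    now in a fixed direction, so the induction hypothesis covers it.\<close>
  have "frechet_derivative (\<lambda>x. h (f x)) (at x) v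
      = (\<Sum>b\<in>Basis. (frechet_derivative f (at x) v \<bullet> b) * frechet_derivative h (at (f x)) b)" if "x \<in> S" for x v
    using Suc.prems that assms(5)
    by (simp add: frechet_derivative_eq[OF der] frechet_derivative_basis[of h "f x" "frechet_derivative f (at x) v"] image_subset_iff)
  then have "Ck_on k S (\<lambda>x. frechet_derivative (\<lambda>x. h (f x)) (at x) v) \<longleftrightarrow>
    Ck_on k S (\<lambda>x. \<Sum>b\<in>Basis. (frechet_derivative f (at x) v \<bullet> b) * frechet_derivative h (at (f x)) b)" for v
    by (intro Ck_on_cong[OF assms(1)]) simp
  moreover have "Ck_on k S (\<lambda>x. \<Sum>b\<in>Basis. (frechet_derivative f (at x) v \<bullet> b) * frechet_derivative h (at (f x)) b)" for v
  proof (intro Ck_on_sum Ck_on_mult assms(1))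
    show "Ck_on k S (\<lambda>x. frechet_derivative f (at x) v \<bullet> b)" for b
      by (rule Ck_on_linear[OF assms(1) bounded_linear_inner_left]) (use Suc.prems in simp)
    show "Ck_on k S (\<lambda>x. frechet_derivative h (at (f x)) b)" for b
      using Suc.prems Ck_on_SucD[OF Suc.prems(1)] by (intro Suc.IH) auto
  qed
  ultimately have "Ck_on k S (\<lambda>x. frechet_derivative (\<lambda>x. h (f x)) (at x) v)" for v by blast
  moreover have "(\<lambda>x. h (f x)) differentiable (at x)" if "x \<in> S" for x
    using der[OF that] unfolding differentiable_def by blast
  ultimately show ?case by simp
qed

lemma smooth_on_cong: "open S \<Longrightarrow> (\<And>x. x \<in> S \<Longrightarrow> f x = g x) \<Longrightarrow> smooth_on S f \<longleftrightarrow> smooth_on S g"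
  by (simp add: smooth_on_def Ck_on_cong[of S f g])

lemma smooth_on_subset: "smooth_on S f \<Longrightarrow> T \<subseteq> S \<Longrightarrow> smooth_on T f"
  by (auto simp: smooth_on_def intro: Ck_on_subset)

lemma smooth_on_Suc: "smooth_on S f \<Longrightarrow> Ck_on (Suc k) S f"
  unfolding smooth_on_def by (rule spec)

lemma smooth_on_differentiable: "smooth_on S f \<Longrightarrow> x \<in> S \<Longrightarrow> f differentiable (at x)"
  using smooth_on_Suc[of S f 0] by simp

lemma smooth_on_derivative: "smooth_on S f \<Longrightarrow> smooth_on S (\<lambda>x. frechet_derivative f (at x) v)"
proof -
  assume "smooth_on S f"
  then have "Ck_on k S (\<lambda>x. frechet_derivative f (at x) v)" for k
    using smooth_on_Suc[of S f k] by simp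
  then show ?thesis by (simp add: smooth_on_def)
qed

lemma smooth_on_continuous: "smooth_on S f \<Longrightarrow> continuous_on S f"
proof -
  assume "smooth_on S f"
  then have "Ck_on 0 S f" unfolding smooth_on_def by (rule spec)
  then show ?thesis by simp
qed

lemma smooth_on_Un: "open S \<Longrightarrow> open T \<Longrightarrow> smooth_on S f \<Longrightarrow> smooth_on T f \<Longrightarrow> smooth_on (S \<union> T) f"
  unfolding smooth_on_def by (intro allI Ck_on_Un; blast)

lemma smooth_on_const: "smooth_on S (\<lambda>_. c)"
  unfolding smooth_on_def by (simp add: Ck_on_const)

lemma smooth_on_ident: "smooth_on S (\<lambda>x. x)"
  unfolding smooth_on_def by (simp add: Ck_on_ident)

lemma smooth_on_add: "open S \<Longrightarrow> smooth_on S f \<Longrightarrow> smooth_on S g \<Longrightarrow> smooth_on S (\<lambda>x. f x + g x)"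
  unfolding smooth_on_def by (intro allI Ck_on_add; blast)

lemma smooth_on_mult:
  "open S \<Longrightarrow> smooth_on S f \<Longrightarrow> smooth_on S g \<Longrightarrow> smooth_on S (\<lambda>x. f x * g x :: real)"
  unfolding smooth_on_def by (intro allI Ck_on_mult; blast)

lemma smooth_on_linear: "open S \<Longrightarrow> bounded_linear L \<Longrightarrow> smooth_on S f \<Longrightarrow> smooth_on S (\<lambda>x. L (f x))"
  unfolding smooth_on_def by (rule allI, rule Ck_on_linear) auto

lemma smooth_on_sum:
  assumes "open S" "\<And>i. i \<in> I \<Longrightarrow> smooth_on S (f i)"
  shows "smooth_on S (\<lambda>x. \<Sum>i\<in>I. f i x)"
proof -
  have "Ck_on k S (\<lambda>x. \<Sum>i\<in>I. f i x)" for k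
    by (rule Ck_on_sum[OF assms(1)]) (use assms(2) in \<open>simp add: smooth_on_def\<close>)
  then show ?thesis by (simp add: smooth_on_def)
qed

lemma smooth_on_inner:
  assumes "open S" "smooth_on S f" "smooth_on S g"
  shows "smooth_on S (\<lambda>x. f x \<bullet> (g x :: 'b::euclidean_space))"
proof -
  have "Ck_on k S (\<lambda>x. f x \<bullet> g x)" for k
    by (rule Ck_on_inner[OF assms(1)]) (use assms(2,3) in \<open>simp_all add: smooth_on_def\<close>)
  then show ?thesis by (simp add: smooth_on_def)
qed

lemma smooth_on_diff_const: "open S \<Longrightarrow> smooth_on S (\<lambda>x. x - a)"
  using smooth_on_add[OF _ smooth_on_ident smooth_on_const[of S "- a"]] by simp

lemma smooth_on_compose:
  fixes f :: "'e::euclidean_space \<Rightarrow> 'd::euclidean_space" and h :: "'d \<Rightarrow> real"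
  assumes "open S" "open T" "smooth_on S f" "smooth_on T h" "f ` S \<subseteq> T"
  shows "smooth_on S (\<lambda>x. h (f x))"
proof -
  have "Ck_on k S (\<lambda>x. h (f x))" for k
    by (rule Ck_on_compose[OF assms(1,2) _ _ assms(5)]) (use assms(3,4) in \<open>simp_all add: smooth_on_def\<close>)
  then show ?thesis by (simp add: smooth_on_def)
qed

section \<open>Smooth bump functions\<close>

definition flat_exp :: "nat \<Rightarrow> real \<Rightarrow> real" where
  "flat_exp m t = (if t > 0 then exp (- (1 / t)) / t ^ m else 0)"

lemma flat_exp_tendsto: "(flat_exp m \<longlongrightarrow> 0) (at 0)"
proof -
  have "((\<lambda>x. x ^ m / exp x) \<longlongrightarrow> (0::real)) at_top"
    by (rule tendsto_power_div_exp_0)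
  then have "((\<lambda>t. inverse t ^ m / exp (inverse t)) \<longlongrightarrow> (0::real)) (at_right 0)"
    by (rule filterlim_compose[OF _ filterlim_inverse_at_top_right])
  moreover have "\<forall>\<^sub>F t in at_right 0. inverse t ^ m / exp (inverse t) = flat_exp m t"
    by (auto simp: eventually_at_filter flat_exp_def exp_minus field_simps power_inverse)
  ultimately have "(flat_exp m \<longlongrightarrow> 0) (at_right 0)"
    by (rule Lim_transform_eventually)
  moreover have "(flat_exp m \<longlongrightarrow> 0) (at_left 0)"
    by (rule tendsto_eventually) (auto simp: eventually_at_filter flat_exp_def)
  ultimately show ?thesis by (simp add: filterlim_at_split)
qed

text \<open>Differentiating \<open>exp (- (1 / t))\<close> only brings in powers of
  \<open>1 / t\<close>. The exponent \<open>m\<close> makes the family closed under differentiation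
  up to linear combinations, so smoothness becomes an induction over all \<open>m\<close> at
  once.\<close>

lemma flat_exp_deriv:
  "(flat_exp m has_real_derivative (flat_exp (m + 2) t - real m * flat_exp (m + 1) t)) (at t)"
proof (cases t "0::real" rule: linorder_cases)
  case less
  then have "\<forall>\<^sub>F x in nhds t. x < 0"
    using eventually_nhds_in_open[of "{..<0}" t] by simp
  then have "\<forall>\<^sub>F x in nhds t. flat_exp m x = 0"
    by eventually_elim (simp add: flat_exp_def)
  with less show ?thesis
    using DERIV_cong_ev[of t t "flat_exp m" "\<lambda>_. 0" 0 0] by (simp add: flat_exp_def)
next
  case equal
  have "((\<lambda>h. flat_exp (m + 1) h) \<longlongrightarrow> 0) (at 0)" by (rule flat_exp_tendsto)
  \<comment> \<open>At \<open>0\<close> the difference quotient of one member of the family is the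
    next member, whose limit is already known.\<close>
  moreover have "flat_exp (m + 1) = (\<lambda>h. (flat_exp m (0 + h) - flat_exp m 0) / h)"
    by (auto simp: flat_exp_def)
  ultimately have "((\<lambda>h. (flat_exp m (0 + h) - flat_exp m 0) / h) \<longlongrightarrow> 0) (at 0)"
    by (simp only:)
  moreover have "flat_exp (m + 2) 0 - real m * flat_exp (m + 1) 0 = 0"
    by (simp add: flat_exp_def)
  ultimately show ?thesis by (simp only: DERIV_def equal)
next
  case greater
  have "((\<lambda>x. exp (- (1 / x)) / x ^ m) has_real_derivative
      (exp (- (1 / t)) / t\<^sup>2 * t ^ m - exp (- (1 / t)) * (real m * t ^ (m - 1))) / (t ^ m * t ^ m)) (at t)"
    using greater by (auto intro!: derivative_eq_intros simp: power2_eq_square)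
  moreover have "(exp (- (1 / t)) / t\<^sup>2 * t ^ m - exp (- (1 / t)) * (real m * t ^ (m - 1))) / (t ^ m * t ^ m)
      = flat_exp (m + 2) t - real m * flat_exp (m + 1) t"
    using greater by (cases m) (auto simp: flat_exp_def field_simps power2_eq_square)
  ultimately have "((\<lambda>x. exp (- (1 / x)) / x ^ m) has_real_derivative
      (flat_exp (m + 2) t - real m * flat_exp (m + 1) t)) (at t)" by simp
  moreover have "\<forall>\<^sub>F x in nhds t. x > 0"
    using eventually_nhds_in_open[of "{0<..}" t] greater by simp
  then have "\<forall>\<^sub>F x in nhds t. flat_exp m x = exp (- (1 / x)) / x ^ m"
    by eventually_elim (simp add: flat_exp_def)
  ultimately show ?thesis
    using DERIV_cong_ev[of t t "flat_exp m" "\<lambda>x. exp (- (1 / x)) / x ^ m"] by blast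
qed

lemma smooth_on_flat_exp: "smooth_on UNIV (flat_exp m)"
proof -
  have "Ck_on k UNIV (flat_exp m)" for k
  proof (induction k arbitrary: m)
    case 0
    then show ?case using flat_exp_deriv
      by (auto intro!: continuous_at_imp_continuous_on DERIV_isCont)
  next
    case (Suc k)
    have fd: "frechet_derivative (flat_exp m) (at t) v
        = flat_exp (m + 2) t * v + (- real m * v) * flat_exp (m + 1) t" for t v
      using frechet_derivative_eq[OF flat_exp_deriv[unfolded has_field_derivative_def], of m t]
      by (simp add: algebra_simps)
    have "flat_exp m differentiable (at t)" for t
      using flat_exp_deriv[unfolded has_field_derivative_def, of m t] unfolding differentiable_def by blast
    moreover have "Ck_on k UNIV (\<lambda>t. frechet_derivative (flat_exp m) (at t) v)" for v
      unfolding fd by (intro Ck_on_add Ck_on_mult Ck_on_const Suc.IH open_UNIV)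
    ultimately show ?case by simp
  qed
  then show ?thesis by (simp add: smooth_on_def)
qed

lemma smooth_bump:
  fixes a :: "'e::euclidean_space"
  assumes "r > 0"
  obtains u :: "'e \<Rightarrow> real" where "smooth_on UNIV u" "u a = 1" "\<And>x. x \<notin> cball a r \<Longrightarrow> u x = 0"
proof
  \<comment> \<open>The argument of \<open>flat_exp 0\<close> is positive exactly on the open ball;
    the constant factor undoes the value \<open>exp (- (1 / r\<^sup>2))\<close> at the
    centre.\<close>
  let ?u = "\<lambda>x. flat_exp 0 (r\<^sup>2 + (-1) * ((x - a) \<bullet> (x - a))) * exp (1 / r\<^sup>2)"
  show "smooth_on UNIV ?u"
    by (intro smooth_on_mult smooth_on_const smooth_on_compose[OF _ _ _ smooth_on_flat_exp]
        smooth_on_add smooth_on_inner smooth_on_diff_const) auto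
  show "?u a = 1" using assms by (simp add: flat_exp_def flip: exp_add)
  show "?u x = 0" if "x \<notin> cball a r" for x
  proof -
    have "r < norm (x - a)" using that by (simp add: dist_norm norm_minus_commute)
    then have "r\<^sup>2 < (x - a) \<bullet> (x - a)" using assms
      by (simp add: power_strict_mono flip: power2_norm_eq_inner)
    then show ?thesis by (simp add: flat_exp_def)
  qed
qed

section \<open>Differentiation under the integral and Hadamard's lemma\<close>

lemma Ck_on_segment_integral:
  fixes F :: "'e::euclidean_space \<Rightarrow> real"
  assumes "smooth_on (ball y r) F" "r > 0"
  shows "Ck_on k (ball y r) (\<lambda>z. integral {0..1} (\<lambda>t. t ^ j * F (y + t *\<^sub>R (z - y))))"
  using assms(1)
\<comment> \<open>Differentiating in \<open>z\<close> pulls one factor \<open>t\<close> out of the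
  argument of \<open>F\<close>; allowing \<open>t ^ j\<close> and an arbitrary \<open>F\<close>
  makes the claim stable under differentiation.\<close>
proof (induction k arbitrary: j F)
  have in_ball: "y + t *\<^sub>R (z - y) \<in> ball y r" if "z \<in> ball y r" "t \<in> {0..1}" for z t
  proof -
    have "\<bar>t\<bar> * norm (z - y) \<le> 1 * norm (z - y)" using that by (intro mult_right_mono) auto
    with that show ?thesis by (auto simp: dist_norm norm_minus_commute)
  qed
  have cont: "continuous_on (ball y r \<times> {0..1}) (\<lambda>(z, t). t ^ j * F (y + t *\<^sub>R (z - y)))"
    if "smooth_on (ball y r) F" for j and F :: "'e \<Rightarrow> real"
    unfolding split_beta
    by (intro continuous_intros continuous_on_compose2[OF smooth_on_continuous[OF that]])
       (auto simp del: mem_ball intro!: in_ball)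
  {
    case 0
    show ?case using integral_continuous_on_param[of "ball y r" 0 1 "\<lambda>z t. t ^ j * F (y + t *\<^sub>R (z - y))"]
      cont[OF 0] by simp
  next
    case (Suc k)
    let ?D = "\<lambda>w. frechet_derivative F (at w)"
    \<comment> \<open>The \<open>z\<close>-derivative of the integrand as a bounded linear map, the
      form that the Leibniz rule takes; the basis expansion makes its joint continuity
      visible.\<close>
    define fx where "fx z t = (\<Sum>b\<in>Basis. (t ^ Suc j * ?D (y + t *\<^sub>R (z - y)) b) *\<^sub>R blinfun_inner_left b)"
      for z t
    have fx_apply: "blinfun_apply (fx z t) v = t ^ Suc j * ?D (y + t *\<^sub>R (z - y)) v"
      if "z \<in> ball y r" "t \<in> {0..1}" for z t v
      using frechet_derivative_basis[OF smooth_on_differentiable[OF Suc.prems in_ball[OF that]], of v]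
      by (simp add: fx_def blinfun.sum_left blinfun.scaleR_left sum_distrib_left mult_ac)
    have cont_fx: "continuous_on (ball y r \<times> {0..1}) (\<lambda>(z, t). fx z t)"
      unfolding fx_def split_beta
      using cont[OF smooth_on_derivative[OF Suc.prems], of "Suc j"]
      by (intro continuous_on_sum continuous_on_scaleR continuous_on_const) (simp add: split_beta)
    have der: "((\<lambda>z. integral {0..1} (\<lambda>t. t ^ j * F (y + t *\<^sub>R (z - y)))) has_derivative
        blinfun_apply (integral {0..1} (fx z0))) (at z0)" if z0: "z0 \<in> ball y r" for z0
    proof -
      have d: "((\<lambda>z. t ^ j * F (y + t *\<^sub>R (z - y))) has_derivative blinfun_apply (fx z t)) (at z within ball y r)"
        if "z \<in> ball y r" "t \<in> {0..1}" for z t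
      proof -
        let ?w = "y + t *\<^sub>R (z - y)"
        have lin: "linear (?D ?w)"
          using smooth_on_differentiable[OF Suc.prems in_ball[OF that]] by (rule linear_frechet_derivative)
        have "(F has_derivative ?D ?w) (at ?w)"
          using smooth_on_differentiable[OF Suc.prems in_ball[OF that]] by (simp add: frechet_derivative_works)
        moreover have "((\<lambda>z. y + t *\<^sub>R (z - y)) has_derivative (\<lambda>v. t *\<^sub>R v)) (at z within ball y r)"
          by (auto intro!: derivative_eq_intros)
        ultimately have "((\<lambda>z. F (y + t *\<^sub>R (z - y))) has_derivative (\<lambda>v. ?D ?w (t *\<^sub>R v))) (at z within ball y r)"
          using has_derivative_compose by fast
        then have "((\<lambda>z. t ^ j * F (y + t *\<^sub>R (z - y))) has_derivative (\<lambda>v. t ^ j * ?D ?w (t *\<^sub>R v))) (at z within ball y r)"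
          by (rule has_derivative_mult_right)
        moreover have "(\<lambda>v. t ^ j * ?D ?w (t *\<^sub>R v)) = blinfun_apply (fx z t)"
          by (rule ext) (simp add: fx_apply[OF that] linear_cmul[OF lin])
        ultimately show ?thesis by simp
      qed
      have int: "(\<lambda>t. t ^ j * F (y + t *\<^sub>R (z - y))) integrable_on {0..1}" if "z \<in> ball y r" for z
        by (intro integrable_continuous_interval continuous_intros
            continuous_on_compose2[OF smooth_on_continuous[OF Suc.prems]])
           (use in_ball that in auto)
      show ?thesis
        using leibniz_rule[of "ball y r" 0 1 "\<lambda>z t. t ^ j * F (y + t *\<^sub>R (z - y))" fx z0]
          d int cont_fx z0 by (simp add: at_within_open[OF z0])
    qed
    have "frechet_derivative (\<lambda>z. integral {0..1} (\<lambda>t. t ^ j * F (y + t *\<^sub>R (z - y)))) (at z) v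
        = integral {0..1} (\<lambda>t. t ^ Suc j * ?D (y + t *\<^sub>R (z - y)) v)" if "z \<in> ball y r" for z v
    proof -
      have "fx z integrable_on {0..1}"
      proof (rule integrable_continuous_interval)
        have "continuous_on {0..1} (\<lambda>t. (\<lambda>(z, t). fx z t) (z, t))"
          by (rule continuous_on_compose2[OF cont_fx]) (use that in \<open>auto intro!: continuous_intros\<close>)
        then show "continuous_on {0..1} (fx z)" by simp
      qed
      then have "blinfun_apply (integral {0..1} (fx z)) v = integral {0..1} (\<lambda>t. fx z t v)"
        by (rule blinfun_apply_integral)
      also have "\<dots> = integral {0..1} (\<lambda>t. t ^ Suc j * ?D (y + t *\<^sub>R (z - y)) v)"
        using that by (intro integral_cong) (simp add: fx_apply)
      finally show ?thesis by (simp add: frechet_derivative_eq[OF der[OF that]])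
    qed
    then have "Ck_on k (ball y r) (\<lambda>z. frechet_derivative (\<lambda>z. integral {0..1} (\<lambda>t. t ^ j * F (y + t *\<^sub>R (z - y)))) (at z) v)" for v
      using Suc.IH[OF smooth_on_derivative[OF Suc.prems], of "Suc j" v]
      by (subst Ck_on_cong[of _ _ "\<lambda>z. integral {0..1} (\<lambda>t. t ^ Suc j * ?D (y + t *\<^sub>R (z - y)) v)"]) auto
    moreover have "(\<lambda>z. integral {0..1} (\<lambda>t. t ^ j * F (y + t *\<^sub>R (z - y)))) differentiable (at z)"
      if "z \<in> ball y r" for z
      using der[OF that] unfolding differentiable_def by blast
    ultimately show ?case by simp
  }
qed

text \<open>Integrate the derivative of \<open>F\<close> along the segment from \<open>y\<close> to
  \<open>z\<close>. The point is the smoothness of the coefficients: a derivation can be applied to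
  the right-hand side, and at \<open>y\<close> it sees only the partial derivatives.\<close>

lemma Hadamard_lemma:
  fixes F :: "'e::euclidean_space \<Rightarrow> real"
  assumes "smooth_on (ball y r) F" "r > 0"
  obtains H where "\<And>b. smooth_on (ball y r) (H b)"
    "\<And>z. z \<in> ball y r \<Longrightarrow> F z = F y + (\<Sum>b\<in>Basis. ((z - y) \<bullet> b) * H b z)"
    "\<And>b. H b y = frechet_derivative F (at y) b"
proof
  let ?D = "\<lambda>w. frechet_derivative F (at w)"
  let ?H = "\<lambda>b z. integral {0..1} (\<lambda>t. ?D (y + t *\<^sub>R (z - y)) b)"
  show "smooth_on (ball y r) (?H b)" for b
    using Ck_on_segment_integral[OF smooth_on_derivative[OF assms(1)] assms(2), of _ 0]
    by (simp add: smooth_on_def)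
  show "?H b y = ?D y b" for b by simp
  show "F z = F y + (\<Sum>b\<in>Basis. ((z - y) \<bullet> b) * ?H b z)" if z: "z \<in> ball y r" for z
  proof -
    have in_ball: "y + t *\<^sub>R (z - y) \<in> ball y r" if "t \<in> {0..1}" for t
    proof -
      have "\<bar>t\<bar> * norm (z - y) \<le> 1 * norm (z - y)" using that by (intro mult_right_mono) auto
      with z show ?thesis by (auto simp: dist_norm norm_minus_commute)
    qed
    have "((\<lambda>t. F (y + t *\<^sub>R (z - y))) has_vector_derivative ?D (y + t *\<^sub>R (z - y)) (z - y)) (at t within {0..1})"
      if "t \<in> {0..1}" for t
    proof -
      let ?w = "y + t *\<^sub>R (z - y)"
      have diff: "F differentiable (at ?w)" using smooth_on_differentiable[OF assms(1) in_ball[OF that]] .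
      then have "(F has_derivative ?D ?w) (at ?w)" by (simp add: frechet_derivative_works)
      moreover have "((\<lambda>t. y + t *\<^sub>R (z - y)) has_derivative (\<lambda>s. s *\<^sub>R (z - y))) (at t within {0..1})"
        by (auto intro!: derivative_eq_intros)
      ultimately have "((\<lambda>t. F (y + t *\<^sub>R (z - y))) has_derivative (\<lambda>s. ?D ?w (s *\<^sub>R (z - y)))) (at t within {0..1})"
        using has_derivative_compose by fast
      then show ?thesis
        by (simp add: has_vector_derivative_def linear_cmul[OF linear_frechet_derivative[OF diff]])
    qed
    then have "((\<lambda>t. ?D (y + t *\<^sub>R (z - y)) (z - y)) has_integral F z - F y) {0..1}"
      using fundamental_theorem_of_calculus[of 0 1 "\<lambda>t. F (y + t *\<^sub>R (z - y))"] by simp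
    then have "F z - F y = integral {0..1} (\<lambda>t. ?D (y + t *\<^sub>R (z - y)) (z - y))"
      by (simp add: integral_unique)
    also have "\<dots> = integral {0..1} (\<lambda>t. \<Sum>b\<in>Basis. ((z - y) \<bullet> b) * ?D (y + t *\<^sub>R (z - y)) b)"
      using frechet_derivative_basis[OF smooth_on_differentiable[OF assms(1) in_ball]]
      by (intro integral_cong) blast
    also have "\<dots> = (\<Sum>b\<in>Basis. ((z - y) \<bullet> b) * ?H b z)"
    proof -
      have "(\<lambda>t. ?D (y + t *\<^sub>R (z - y)) b) integrable_on {0..1}" for b
        by (intro integrable_continuous_interval continuous_intros
            continuous_on_compose2[OF smooth_on_continuous[OF smooth_on_derivative[OF assms(1)]]])
           (use in_ball in auto)
      then show ?thesis by (subst integral_sum) (auto intro!: integrable_on_mult_right)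
    qed
    finally show ?thesis by simp
  qed
qed

section \<open>Local frames of vector fields\<close>

lemma sum_fun_apply: "(\<Sum>i\<in>I. f i) x = (\<Sum>i\<in>I. f i x)"
  by (induction I rule: infinite_finite_induct) auto

lemma smooth_funI: "(\<And>U \<phi>. (U, \<phi>) \<in> A \<Longrightarrow> smooth_on (\<phi> ` U) (h \<circ> inv_into U \<phi>)) \<Longrightarrow> smooth_fun A h"
  by (auto simp: smooth_fun_def)

lemma smooth_funD: "smooth_fun A h \<Longrightarrow> (U, \<phi>) \<in> A \<Longrightarrow> smooth_on (\<phi> ` U) (h \<circ> inv_into U \<phi>)"
  by (auto simp: smooth_fun_def)

context smooth_manifold
begin

lemma open_chart_image: "(U, \<phi>) \<in> A \<Longrightarrow> open (\<phi> ` U)"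
  using chart_open by blast

lemma inv_chart: "(U, \<phi>) \<in> A \<Longrightarrow> q \<in> U \<Longrightarrow> inv_into U \<phi> (\<phi> q) = q"
  using chart_homeo homeomorphism_apply1 by blast

lemma open_chart_image_Int:
  assumes "(U, \<phi>) \<in> A" "open X" shows "open (\<phi> ` (U \<inter> X))"
proof -
  have "openin (top_of_set (\<phi> ` U)) (\<phi> ` (U \<inter> X))"
    using chart_homeo[OF assms(1)] assms(2) by (intro homeomorphism_imp_open_map) auto
  then show ?thesis using open_chart_image[OF assms(1)] by (simp add: openin_open_eq)
qed

lemma smooth_fun_const [simp]: "smooth_fun A (\<lambda>_. c)"
  by (rule smooth_funI) (simp add: comp_def smooth_on_const)

lemma smooth_fun_0 [simp]: "smooth_fun A 0"
  using smooth_fun_const[of 0] by (simp add: zero_fun_def)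

lemma smooth_fun_add [simp]:
  assumes "smooth_fun A h" "smooth_fun A k" shows "smooth_fun A (h + k)"
proof (rule smooth_funI)
  fix U \<phi> assume c: "(U, \<phi>) \<in> A"
  show "smooth_on (\<phi> ` U) ((h + k) \<circ> inv_into U \<phi>)"
    using smooth_on_add[OF open_chart_image[OF c] smooth_funD[OF assms(1) c] smooth_funD[OF assms(2) c]]
    by (simp add: comp_def plus_fun_def)
qed

lemma smooth_fun_mult [simp]:
  assumes "smooth_fun A h" "smooth_fun A k" shows "smooth_fun A (h * k)"
proof (rule smooth_funI)
  fix U \<phi> assume c: "(U, \<phi>) \<in> A"
  show "smooth_on (\<phi> ` U) ((h * k) \<circ> inv_into U \<phi>)"
    using smooth_on_mult[OF open_chart_image[OF c] smooth_funD[OF assms(1) c] smooth_funD[OF assms(2) c]]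
    by (simp add: comp_def times_fun_def)
qed

lemma smooth_fun_add' [simp]: "smooth_fun A h \<Longrightarrow> smooth_fun A k \<Longrightarrow> smooth_fun A (\<lambda>p. h p + k p)"
  using smooth_fun_add[of h k] by (simp add: plus_fun_def)

lemma smooth_fun_mult' [simp]: "smooth_fun A h \<Longrightarrow> smooth_fun A k \<Longrightarrow> smooth_fun A (\<lambda>p. h p * k p)"
  using smooth_fun_mult[of h k] by (simp add: times_fun_def)

lemma smooth_fun_uminus' [simp]: "smooth_fun A h \<Longrightarrow> smooth_fun A (\<lambda>p. - h p)"
  using smooth_fun_mult'[OF smooth_fun_const[of "-1"], of h] by simp

lemma smooth_fun_diff' [simp]: "smooth_fun A h \<Longrightarrow> smooth_fun A k \<Longrightarrow> smooth_fun A (\<lambda>p. h p - k p)"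
  using smooth_fun_add'[of h "\<lambda>p. - k p"] by simp

lemma smooth_fun_uminus [simp]: "smooth_fun A h \<Longrightarrow> smooth_fun A (- h)"
  using smooth_fun_uminus'[of h] by (simp add: fun_Compl_def)

lemma smooth_fun_diff [simp]: "smooth_fun A h \<Longrightarrow> smooth_fun A k \<Longrightarrow> smooth_fun A (h - k)"
  using smooth_fun_diff'[of h k] by (simp add: fun_diff_def)

lemma smooth_fun_sum [simp]: "(\<And>i. i \<in> I \<Longrightarrow> smooth_fun A (h i)) \<Longrightarrow> smooth_fun A (\<Sum>i\<in>I. h i)"
  by (induction I rule: infinite_finite_induct) auto

lemma smooth_fun_sum' [simp]: "(\<And>i. i \<in> I \<Longrightarrow> smooth_fun A (h i)) \<Longrightarrow> smooth_fun A (\<lambda>p. \<Sum>i\<in>I. h i p)"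
  by (induction I rule: infinite_finite_induct) auto

end

section \<open>Cutting off in a chart\<close>

definition chart_extension :: "'a set \<Rightarrow> ('a \<Rightarrow> 'e) \<Rightarrow> ('e \<Rightarrow> real) \<Rightarrow> 'a \<Rightarrow> real" where
  "chart_extension U \<phi> u = (\<lambda>q. if q \<in> U then u (\<phi> q) else 0)"

context smooth_manifold
begin

text \<open>In another chart the extension is \<open>u\<close> after a transition map over
  \<open>U\<close>, and it vanishes off \<open>K'\<close>, the preimage of \<open>K\<close>. Since
  \<open>K'\<close> is compact in a Hausdorff space it is closed, so \<open>U\<close> and the
  complement of \<open>K'\<close> are two open sets on which smoothness can be checked
  separately.\<close>

lemma smooth_chart_extension:
  assumes c: "(U, \<phi>) \<in> A" and "compact K" "K \<subseteq> W" "open W" "W \<subseteq> \<phi> ` U" "smooth_on W u"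
    and zero: "\<And>y. y \<in> \<phi> ` U - K \<Longrightarrow> u y = 0"
  shows "smooth_fun A (chart_extension U \<phi> u)"
proof (rule smooth_funI)
  fix T \<psi> assume c': "(T, \<psi>) \<in> A"
  let ?v = "inv_into T \<psi>"
  have "open (\<phi> ` U - K)"
    using open_chart_image[OF c] assms(2) by (intro open_Diff compact_imp_closed)
  moreover have "smooth_on (\<phi> ` U - K) u"
    by (subst smooth_on_cong[OF calculation zero]) (auto intro: smooth_on_const)
  ultimately have "smooth_on (W \<union> (\<phi> ` U - K)) u" using assms by (intro smooth_on_Un)
  moreover have "W \<union> (\<phi> ` U - K) = \<phi> ` U" using assms by auto
  ultimately have su: "smooth_on (\<phi> ` U) u" by simp
  define K' where "K' = inv_into U \<phi> ` K"
  have "compact K'" unfolding K'_def using chart_homeo[OF c] assms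
    by (intro compact_continuous_image) (auto simp: homeomorphism_def intro: continuous_on_subset)
  then have "closed K'" by (rule compact_imp_closed)
  have K'U: "K' \<subseteq> U" unfolding K'_def using assms inv_chart[OF c] by auto
  have o1: "open (\<psi> ` (T \<inter> U))" and o2: "open (\<psi> ` (T \<inter> - K'))"
    using open_chart_image_Int[OF c'] chart_open[OF c] \<open>closed K'\<close> by (auto simp: open_Compl)
  have "smooth_on (\<psi> ` (T \<inter> U)) (\<lambda>x. u ((\<phi> \<circ> ?v) x))"
    by (rule smooth_on_compose[OF o1 open_chart_image[OF c] chart_compatible[OF c' c] su])
       (auto simp: inv_chart[OF c'])
  then have s1: "smooth_on (\<psi> ` (T \<inter> U)) (chart_extension U \<phi> u \<circ> ?v)"
    by (subst smooth_on_cong[OF o1, where g="\<lambda>x. u ((\<phi> \<circ> ?v) x)"])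
       (auto simp: chart_extension_def inv_chart[OF c'])
  have "chart_extension U \<phi> u q = 0" if "q \<notin> K'" for q
  proof (cases "q \<in> U")
    case True
    then have "\<phi> q \<notin> K" using that inv_chart[OF c True] unfolding K'_def by force
    with True zero show ?thesis by (auto simp: chart_extension_def)
  qed (simp add: chart_extension_def)
  then have s2: "smooth_on (\<psi> ` (T \<inter> - K')) (chart_extension U \<phi> u \<circ> ?v)"
    by (subst smooth_on_cong[OF o2, where g="\<lambda>x. 0"])
       (auto simp: inv_chart[OF c'] intro: smooth_on_const)
  have "\<psi> ` (T \<inter> U) \<union> \<psi> ` (T \<inter> - K') = \<psi> ` T" using K'U by auto
  then show "smooth_on (\<psi> ` T) (chart_extension U \<phi> u \<circ> ?v)"
    using smooth_on_Un[OF o1 o2 s1 s2] by simp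
qed

lemma frechet_derivative_chart_extension:
  assumes c: "(U, \<phi>) \<in> A" and y: "y \<in> \<phi> ` U" and "u differentiable (at y)"
  shows "frechet_derivative (chart_extension U \<phi> u \<circ> inv_into U \<phi>) (at y) = frechet_derivative u (at y)"
proof (rule frechet_derivative_eq)
  have "(u has_derivative frechet_derivative u (at y)) (at y)"
    using assms(3) by (simp add: frechet_derivative_works)
  then show "(chart_extension U \<phi> u \<circ> inv_into U \<phi> has_derivative frechet_derivative u (at y)) (at y)"
    by (rule has_derivative_transform_within_open[OF _ open_chart_image[OF c] y])
       (auto simp: inv_chart[OF c] chart_extension_def)
qed

section \<open>Vector fields as derivations and as directional derivatives\<close>

lemma vector_fieldI:
  assumes "\<And>h. smooth_fun A h \<Longrightarrow> smooth_fun A (X h)"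
    and "\<And>h k p. smooth_fun A h \<Longrightarrow> smooth_fun A k \<Longrightarrow> X (h + k) p = X h p + X k p"
    and "\<And>c h p. smooth_fun A h \<Longrightarrow> X (\<lambda>p. c * h p) p = c * X h p"
    and "\<And>h k p. smooth_fun A h \<Longrightarrow> smooth_fun A k \<Longrightarrow> X (h * k) p = X h p * k p + h p * X k p"
    and "\<And>h p. \<not> smooth_fun A h \<Longrightarrow> X h p = 0"
  shows "vector_field A X"
  using assms unfolding vector_field_def fun_eq_iff by simp

lemma vf_smooth [simp]: "vector_field A X \<Longrightarrow> smooth_fun A h \<Longrightarrow> smooth_fun A (X h)"
  by (simp add: vector_field_def)

lemma vf_add: "vector_field A X \<Longrightarrow> smooth_fun A h \<Longrightarrow> smooth_fun A k \<Longrightarrow> X (h + k) = X h + X k"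
  by (simp add: vector_field_def)

lemma vf_cmult: "vector_field A X \<Longrightarrow> smooth_fun A h \<Longrightarrow> X (\<lambda>p. c * h p) = (\<lambda>p. c * X h p)"
  by (simp add: vector_field_def)

lemma vf_mult: "vector_field A X \<Longrightarrow> smooth_fun A h \<Longrightarrow> smooth_fun A k \<Longrightarrow> X (h * k) = X h * k + h * X k"
  by (simp add: vector_field_def)

lemma vf_nonsmooth: "vector_field A X \<Longrightarrow> \<not> smooth_fun A h \<Longrightarrow> X h = 0"
  by (simp add: vector_field_def)

lemma vf_const:
  assumes "vector_field A X" shows "X (\<lambda>_. c) = 0"
proof -
  have "X ((\<lambda>_. 1) * (\<lambda>_. 1)) = X (\<lambda>_. 1) * (\<lambda>_. 1) + (\<lambda>_. 1) * X (\<lambda>_. 1)"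
    using assms by (intro vf_mult) auto
  then have 1: "X (\<lambda>_. 1) = 0" by (simp add: fun_eq_iff times_fun_def)
  have "X (\<lambda>p. c * (\<lambda>_. 1) p) = (\<lambda>p. c * X (\<lambda>_. 1) p)" using assms by (intro vf_cmult) auto
  with 1 show ?thesis by (simp add: fun_eq_iff)
qed

lemma vf_zero: "vector_field A X \<Longrightarrow> X 0 = 0"
  using vf_const[of X 0] by (simp add: zero_fun_def)

lemma vf_add': "vector_field A X \<Longrightarrow> smooth_fun A h \<Longrightarrow> smooth_fun A k
    \<Longrightarrow> X (\<lambda>p. h p + k p) = (\<lambda>p. X h p + X k p)"
  using vf_add[of X h k] by (simp add: plus_fun_def)

lemma vf_mult': "vector_field A X \<Longrightarrow> smooth_fun A h \<Longrightarrow> smooth_fun A k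
    \<Longrightarrow> X (\<lambda>p. h p * k p) = (\<lambda>p. X h p * k p + h p * X k p)"
  using vf_mult[of X h k] by (simp add: plus_fun_def times_fun_def)

lemma vf_uminus': "vector_field A X \<Longrightarrow> smooth_fun A h \<Longrightarrow> X (\<lambda>p. - h p) = (\<lambda>p. - X h p)"
  using vf_cmult[of X h "-1"] by simp

lemma vf_diff': "vector_field A X \<Longrightarrow> smooth_fun A h \<Longrightarrow> smooth_fun A k
    \<Longrightarrow> X (\<lambda>p. h p - k p) = (\<lambda>p. X h p - X k p)"
  using vf_add'[of X h "\<lambda>p. - k p"] by (simp add: vf_uminus')

lemma vf_diff: "vector_field A X \<Longrightarrow> smooth_fun A h \<Longrightarrow> smooth_fun A k \<Longrightarrow> X (h - k) = X h - X k"
  using vf_diff'[of X h k] by (simp add: fun_diff_def)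

lemma vf_sum: "vector_field A X \<Longrightarrow> (\<And>i. i \<in> I \<Longrightarrow> smooth_fun A (h i)) \<Longrightarrow> X (\<Sum>i\<in>I. h i) = (\<Sum>i\<in>I. X (h i))"
  by (induction I rule: infinite_finite_induct) (auto simp: vf_add vf_zero)

lemma vf_sum': "vector_field A X \<Longrightarrow> (\<And>i. i \<in> I \<Longrightarrow> smooth_fun A (h i))
    \<Longrightarrow> X (\<lambda>p. \<Sum>i\<in>I. h i p) = (\<lambda>p. \<Sum>i\<in>I. X (h i) p)"
proof (induction I rule: infinite_finite_induct)
  case (insert x F)
  then show ?case using vf_add'[of X "h x" "\<lambda>p. \<Sum>i\<in>F. h i p"] by (simp add: fun_eq_iff)
qed (auto simp: fun_eq_iff vf_const)

text \<open>Hadamard's expansion of \<open>h\<close> holds only in a ball of the chart. Multiplying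
  it by cutoffs turns it into an identity of global smooth functions, to which the derivation
  applies directly, without a prior proof that derivations are local.\<close>

lemma vf_chart_direction:
  assumes X: "vector_field A X" and c: "(U, \<phi>) \<in> A" and q: "q \<in> U"
  obtains \<kappa> where "\<And>h. smooth_fun A h \<Longrightarrow>
    X h q = frechet_derivative (h \<circ> inv_into U \<phi>) (at (\<phi> q)) \<kappa>"
proof -
  define y where "y = \<phi> q"
  have yS: "y \<in> \<phi> ` U" using q by (simp add: y_def)
  obtain r where r: "r > 0" "cball y r \<subseteq> \<phi> ` U"
    using open_contains_cball open_chart_image[OF c] yS by blast
  obtain u :: "'e \<Rightarrow> real" where u: "smooth_on UNIV u" "u y = 1" "\<And>x. x \<notin> cball y (r/2) \<Longrightarrow> u x = 0"
    using smooth_bump[of "r/2" y] r(1) by auto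
  have sub: "cball y (r/2) \<subseteq> ball y r" "ball y r \<subseteq> \<phi> ` U" using r ball_subset_cball[of y r] by auto
  have cut: "smooth_fun A (chart_extension U \<phi> (\<lambda>z. u z * w z))" if "smooth_on (ball y r) w" for w
    using u that sub smooth_on_subset[OF u(1)]
    by (intro smooth_chart_extension[OF c, of "cball y (r/2)" "ball y r"] smooth_on_mult) auto
  define uu where "uu = chart_extension U \<phi> (\<lambda>z. u z * 1)"
  have uu: "smooth_fun A uu" unfolding uu_def by (rule cut) (rule smooth_on_const)
  have uuq: "uu q = 1" using u(2) q by (simp add: uu_def chart_extension_def y_def)
  define x where "x b = chart_extension U \<phi> (\<lambda>z. u z * ((z - y) \<bullet> b))" for b
  have x: "smooth_fun A (x b)" for b
    unfolding x_def by (rule cut) (intro smooth_on_inner smooth_on_diff_const smooth_on_const open_ball)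
  have xq: "x b q = 0" for b by (simp add: x_def chart_extension_def y_def)
  \<comment> \<open>The components of the direction are the values of \<open>X\<close> on the
    cut-off coordinate functions.\<close>
  define \<kappa> where "\<kappa> = (\<Sum>b\<in>Basis. X (x b) q *\<^sub>R b)"
  have "X h q = frechet_derivative (h \<circ> inv_into U \<phi>) (at (\<phi> q)) \<kappa>" if h: "smooth_fun A h" for h
  proof -
    let ?F = "h \<circ> inv_into U \<phi>"
    have sF: "smooth_on (\<phi> ` U) ?F" using smooth_funD[OF h c] .
    have diffF: "?F differentiable (at y)" using smooth_on_differentiable[OF sF yS] .
    obtain H where H: "\<And>b. smooth_on (ball y r) (H b)"
      "\<And>z. z \<in> ball y r \<Longrightarrow> ?F z = ?F y + (\<Sum>b\<in>Basis. ((z - y) \<bullet> b) * H b z)"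
      "\<And>b. H b y = frechet_derivative ?F (at y) b"
      using Hadamard_lemma[OF smooth_on_subset[OF sF sub(2)] r(1)] by blast
    define k where "k b = chart_extension U \<phi> (\<lambda>z. u z * H b z)" for b
    have k: "smooth_fun A (k b)" for b unfolding k_def by (rule cut[OF H(1)])
    have kq: "k b q = frechet_derivative ?F (at y) b" for b
      using H(3)[of b] u(2) q by (simp add: k_def chart_extension_def y_def)
    \<comment> \<open>The cutoff occurs twice because \<open>x b\<close> and \<open>k b\<close>
      carry one factor each. The Leibniz rule yields \<open>h q * X (uu * uu) q\<close> on both
      sides, so that only \<open>X h q\<close> and the linear terms remain.\<close>
    have "uu * uu * h = (\<lambda>p. h q * (uu * uu) p) + (\<Sum>b\<in>Basis. x b * k b)"
    proof
      fix p
      have "uu p * uu p * h p = h q * (uu p * uu p) + (\<Sum>b\<in>Basis. x b p * k b p)"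
      proof (cases "p \<in> U \<and> \<phi> p \<in> cball y (r/2)")
        case True
        then have "\<phi> p \<in> ball y r" using sub by auto
        from H(2)[OF this] True q have "h p = h q + (\<Sum>b\<in>Basis. ((\<phi> p - y) \<bullet> b) * H b (\<phi> p))"
          by (simp add: inv_chart[OF c] y_def)
        then have "u (\<phi> p) * u (\<phi> p) * h p = h q * (u (\<phi> p) * u (\<phi> p)) +
           (\<Sum>b\<in>Basis. (u (\<phi> p) * ((\<phi> p - y) \<bullet> b)) * (u (\<phi> p) * H b (\<phi> p)))"
          by (simp add: algebra_simps sum_distrib_left)
        with True show ?thesis by (simp add: uu_def x_def k_def chart_extension_def)
      next
        case False
        then show ?thesis using u(3)[of "\<phi> p"] by (auto simp: uu_def x_def k_def chart_extension_def)
      qed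
      then show "(uu * uu * h) p = ((\<lambda>p. h q * (uu * uu) p) + (\<Sum>b\<in>Basis. x b * k b)) p"
        by (simp add: sum_fun_apply)
    qed
    then have "X (uu * uu * h) = X ((\<lambda>p. h q * (uu * uu) p) + (\<Sum>b\<in>Basis. x b * k b))" by simp
    also have "\<dots> = (\<lambda>p. h q * X (uu * uu) p) + (\<Sum>b\<in>Basis. X (x b) * k b + x b * X (k b))"
      using X uu x k
      by (subst vf_add) (auto simp: vf_cmult[of X "uu * uu"] vf_sum vf_mult[of X "x _" "k _"] simp del: times_fun_apply)
    finally have "X (uu * uu * h) q = h q * X (uu * uu) q + (\<Sum>b\<in>Basis. X (x b) q * k b q)"
      by (simp add: sum_fun_apply xq)
    moreover have "X (uu * uu * h) q = X (uu * uu) q * h q + X h q"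
      using X uu h by (simp add: vf_mult[of X "uu * uu" h] uuq)
    ultimately have "X h q = (\<Sum>b\<in>Basis. X (x b) q * k b q)" by simp
    then have "X h q = (\<Sum>b\<in>Basis. X (x b) q * frechet_derivative ?F (at y) b)" by (simp add: kq)
    also have "\<dots> = frechet_derivative ?F (at y) \<kappa>"
      unfolding \<kappa>_def using linear_frechet_derivative[OF diffF] by (simp add: linear_sum linear_cmul)
    finally show ?thesis by (simp add: y_def)
  qed
  then show ?thesis using that by blast
qed

lemma vector_field_chart_direction:
  assumes c: "(U, \<phi>) \<in> A" and K: "compact K" "K \<subseteq> \<phi> ` U"
    and w: "smooth_on UNIV w" "\<And>y. y \<notin> K \<Longrightarrow> w y = 0"
  shows "vector_field A (\<lambda>h. if smooth_fun A h
    then chart_extension U \<phi> (\<lambda>y. frechet_derivative (h \<circ> inv_into U \<phi>) (at y) (w y)) else 0)"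
    (is "vector_field A ?X")
proof (rule vector_fieldI)
  let ?i = "inv_into U \<phi>"
  note S = open_chart_image[OF c]
  have diff: "(h \<circ> ?i) differentiable (at y)" if "smooth_fun A h" "y \<in> \<phi> ` U" for h y
    using smooth_on_differentiable[OF smooth_funD[OF that(1) c] that(2)] .
  have der: "(h \<circ> ?i has_derivative frechet_derivative (h \<circ> ?i) (at y)) (at y)"
    if "smooth_fun A h" "y \<in> \<phi> ` U" for h y
    using diff[OF that] by (simp add: frechet_derivative_works)
  show "smooth_fun A (?X h)" if h: "smooth_fun A h" for h
  proof -
    let ?G = "\<lambda>y. \<Sum>b\<in>Basis. (w y \<bullet> b) * frechet_derivative (h \<circ> ?i) (at y) b"
    have "smooth_on (\<phi> ` U) ?G"
      by (intro smooth_on_sum smooth_on_mult smooth_on_inner smooth_on_const S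
          smooth_on_derivative smooth_funD[OF h c] smooth_on_subset[OF w(1)]) auto
    then have "smooth_on (\<phi> ` U) (\<lambda>y. frechet_derivative (h \<circ> ?i) (at y) (w y))"
      by (subst smooth_on_cong[OF S, where g="?G"]) (auto intro!: frechet_derivative_basis diff[OF h])
    then show ?thesis
      using h K S w(2) linear_0[OF linear_frechet_derivative[OF diff[OF h]]]
      by (auto intro!: smooth_chart_extension[OF c K(1,2) S])
  qed
  show "?X (h + k) p = ?X h p + ?X k p" if hk: "smooth_fun A h" "smooth_fun A k" for h k p
  proof (cases "p \<in> U")
    case True
    then have "frechet_derivative ((h + k) \<circ> ?i) (at (\<phi> p))
      = (\<lambda>v. frechet_derivative (h \<circ> ?i) (at (\<phi> p)) v + frechet_derivative (k \<circ> ?i) (at (\<phi> p)) v)"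
      using has_derivative_add[OF der[OF hk(1), of "\<phi> p"] der[OF hk(2), of "\<phi> p"]]
      by (intro frechet_derivative_eq) (simp add: comp_def)
    with True hk show ?thesis by (simp add: chart_extension_def)
  qed (simp add: hk chart_extension_def)
  show "?X (\<lambda>p. c * h p) p = c * ?X h p" if h: "smooth_fun A h" for h p c
  proof (cases "p \<in> U")
    case True
    then have "frechet_derivative ((\<lambda>p. c * h p) \<circ> ?i) (at (\<phi> p))
      = (\<lambda>v. c * frechet_derivative (h \<circ> ?i) (at (\<phi> p)) v)"
      using has_derivative_mult_right[OF der[OF h, of "\<phi> p"], of c]
      by (intro frechet_derivative_eq) (simp add: comp_def)
    with True h show ?thesis by (simp add: chart_extension_def)
  qed (simp add: h chart_extension_def)
  show "?X (h * k) p = ?X h p * k p + h p * ?X k p" if hk: "smooth_fun A h" "smooth_fun A k" for h k p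
  proof (cases "p \<in> U")
    case True
    then have "frechet_derivative ((h * k) \<circ> ?i) (at (\<phi> p))
      = (\<lambda>v. h p * frechet_derivative (k \<circ> ?i) (at (\<phi> p)) v + frechet_derivative (h \<circ> ?i) (at (\<phi> p)) v * k p)"
      using has_derivative_mult[OF der[OF hk(1), of "\<phi> p"] der[OF hk(2), of "\<phi> p"]]
      by (intro frechet_derivative_eq) (simp add: comp_def inv_chart[OF c])
    with True hk show ?thesis by (simp add: chart_extension_def)
  qed (simp add: hk chart_extension_def)
qed simp

lemma fmult_apply [simp]: "(h \<odot> X) k p = h p * X k p"
  by (simp add: fmult_def)

text \<open>
  The frame consists of the coordinate fields, cut off by a bump function \<open>u\<close>.  Instead of using
  a bump function that is constant near \<open>p\<close>, the derivative of \<open>u\<close> in the coordinate functions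
  \<open>u * (\<phi> - a) \<bullet> b\<close> is compensated by the extra pair with index \<open>0\<close>.
\<close>

lemma local_frame:
  fixes p :: 'a
  obtains \<rho> :: "'a \<Rightarrow> real" and x :: "'e \<Rightarrow> 'a \<Rightarrow> real" and Y :: "'e \<Rightarrow> 'a vfield"
  where "smooth_fun A \<rho>" "\<rho> p = 1" "\<And>k. smooth_fun A (x k)" "\<And>k. vector_field A (Y k)"
    "\<And>X. vector_field A X \<Longrightarrow> \<rho> \<odot> X = (\<Sum>k\<in>insert 0 Basis. X (x k) \<odot> Y k)"
    "(\<Sum>k\<in>insert 0 Basis. Y k (x k) p) = real DIM('e)"
proof -
  have "p \<in> (\<Union>(U, \<phi>)\<in>A. U)" by (simp add: chart_cover)
  then obtain U \<phi> where c: "(U, \<phi>) \<in> A" and p: "p \<in> U" by auto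
  define a where "a = \<phi> p"
  let ?i = "inv_into U \<phi>"
  have aS: "a \<in> \<phi> ` U" using p by (simp add: a_def)
  obtain r where r: "r > 0" "cball a r \<subseteq> \<phi> ` U"
    using open_contains_cball open_chart_image[OF c] aS by blast
  obtain u :: "'e \<Rightarrow> real" where u: "smooth_on UNIV u" "u a = 1" "\<And>x. x \<notin> cball a r \<Longrightarrow> u x = 0"
    using smooth_bump[of r a] r(1) by auto
  have cut: "smooth_fun A (chart_extension U \<phi> (\<lambda>z. u z * w z))" if "smooth_on UNIV w" for w
    using u r that smooth_on_subset[OF u(1)] smooth_on_subset[OF that]
    by (intro smooth_chart_extension[OF c compact_cball r(2) open_chart_image[OF c]] smooth_on_mult
        open_chart_image[OF c]) auto
  \<comment> \<open>No basis vector is \<open>0\<close>, so index \<open>0\<close> is free for the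
    extra pair: its function is the bare cutoff and its field the cut-off radial field pointing
    towards \<open>a\<close>.\<close>
  define l where "l k z = (if k = 0 then 1 else (z - a) \<bullet> k)" for k z :: 'e
  define w where "w k z = u z *\<^sub>R (if k = 0 then a - z else k)" for k z :: 'e
  have "smooth_on UNIV (l k)" for k
    unfolding l_def by (cases "k = 0") (auto intro!: smooth_on_const smooth_on_inner smooth_on_diff_const)
  define x where "x k = chart_extension U \<phi> (\<lambda>z. u z * l k z)" for k
  have x: "smooth_fun A (x k)" for k unfolding x_def by (rule cut) fact
  have w: "smooth_on UNIV (w k)" "z \<notin> cball a r \<Longrightarrow> w k z = 0" for k z
  proof -
    have "smooth_on UNIV (\<lambda>z. \<Sum>b\<in>Basis. (u z * ((if k = 0 then a - z else k) \<bullet> b)) *\<^sub>R b)"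
    proof (intro smooth_on_sum open_UNIV)
      fix b :: 'e
      have "smooth_on UNIV (\<lambda>z. u z * (if k = 0 then - ((z - a) \<bullet> b) else k \<bullet> b))"
        using smooth_on_linear[OF open_UNIV bounded_linear_minus[OF bounded_linear_inner_left] smooth_on_diff_const[OF open_UNIV, of a], of b]
        by (intro smooth_on_mult u(1) open_UNIV; cases "k = 0") (auto intro!: smooth_on_const)
      then have "smooth_on UNIV (\<lambda>z. (u z * (if k = 0 then - ((z - a) \<bullet> b) else k \<bullet> b)) *\<^sub>R b)"
        by (rule smooth_on_linear[OF open_UNIV bounded_linear_scaleR_left])
      moreover have "(\<lambda>z. (u z * (if k = 0 then - ((z - a) \<bullet> b) else k \<bullet> b)) *\<^sub>R b)
          = (\<lambda>z. (u z * ((if k = 0 then a - z else k) \<bullet> b)) *\<^sub>R b)"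
        by (auto simp: fun_eq_iff inner_diff_left)
      ultimately show "smooth_on UNIV (\<lambda>z. (u z * ((if k = 0 then a - z else k) \<bullet> b)) *\<^sub>R b)" by simp
    qed
    moreover have "(\<lambda>z. \<Sum>b\<in>Basis. (u z * ((if k = 0 then a - z else k) \<bullet> b)) *\<^sub>R b) = w k"
    proof
      fix z
      have "w k z = (\<Sum>b\<in>Basis. (w k z \<bullet> b) *\<^sub>R b)" by (simp only: euclidean_representation)
      then show "(\<Sum>b\<in>Basis. (u z * ((if k = 0 then a - z else k) \<bullet> b)) *\<^sub>R b) = w k z"
        by (simp add: w_def)
    qed
    ultimately show "smooth_on UNIV (w k)" by simp
    show "w k z = 0" if "z \<notin> cball a r" using u(3)[OF that] by (simp add: w_def)
  qed
  define Y :: "'e \<Rightarrow> 'a vfield" where "Y k = (\<lambda>h. if smooth_fun A h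
    then chart_extension U \<phi> (\<lambda>y. frechet_derivative (h \<circ> ?i) (at y) (w k y)) else 0)" for k
  have Y: "vector_field A (Y k)" for k
    unfolding Y_def using vector_field_chart_direction[OF c compact_cball r(2) w] .
  define \<rho> where "\<rho> = x 0 * x 0"
  have du: "(u has_derivative frechet_derivative u (at y)) (at y)" for y
    using smooth_on_differentiable[OF u(1)] by (simp add: frechet_derivative_works)
  have dx: "frechet_derivative (x k \<circ> ?i) (at y) v
      = frechet_derivative u (at y) v * l k y + u y * (if k = 0 then 0 else v \<bullet> k)"
    if "y \<in> \<phi> ` U" for k y v
  proof -
    have "(l k has_derivative (\<lambda>v. if k = 0 then 0 else v \<bullet> k)) (at y)"
      unfolding l_def by (cases "k = 0") (auto intro!: derivative_eq_intros)
    from has_derivative_mult[OF du this]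
    have d: "((\<lambda>z. u z * l k z) has_derivative
      (\<lambda>v. u y * (if k = 0 then 0 else v \<bullet> k) + frechet_derivative u (at y) v * l k y)) (at y)" .
    then have "(\<lambda>z. u z * l k z) differentiable (at y)" unfolding differentiable_def by blast
    from frechet_derivative_chart_extension[OF c that this] show ?thesis
      unfolding x_def frechet_derivative_eq[OF d] by simp
  qed
  have "\<rho> \<odot> X = (\<Sum>k\<in>insert 0 Basis. X (x k) \<odot> Y k)" if X: "vector_field A X" for X
  proof (intro ext)
    fix h q
    have "\<rho> q * X h q = (\<Sum>k\<in>insert 0 Basis. X (x k) q * Y k h q)"
    proof (cases "smooth_fun A h \<and> q \<in> U")
      case False
      then show ?thesis using vf_nonsmooth[OF X, of h]
        by (auto simp: Y_def \<rho>_def x_def chart_extension_def)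
    next
      case True
      define y where "y = \<phi> q"
      have yS: "y \<in> \<phi> ` U" using True by (simp add: y_def)
      obtain \<kappa> where \<kappa>: "\<And>h. smooth_fun A h \<Longrightarrow> X h q = frechet_derivative (h \<circ> ?i) (at y) \<kappa>"
        using vf_chart_direction[OF X c, of q] True y_def by metis
      let ?D = "frechet_derivative (h \<circ> ?i) (at y)"
      let ?u' = "frechet_derivative u (at y) \<kappa>"
      have lin: "linear ?D"
        using smooth_on_differentiable[OF smooth_funD[OF _ c] yS] True by (intro linear_frechet_derivative) auto
      have combine: "d * ?D (t *\<^sub>R v) + (\<Sum>b\<in>Basis. e b * ?D (t *\<^sub>R b))
          = t * ?D (d *\<^sub>R v + (\<Sum>b\<in>Basis. e b *\<^sub>R b))" for d t v and e :: "'e \<Rightarrow> real"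
        by (simp add: linear_add[OF lin] linear_sum[OF lin] linear_cmul[OF lin] sum_distrib_left distrib_left mult.left_commute)
      have Yh: "Y k h q = ?D (w k y)" for k
        using True by (simp add: Y_def chart_extension_def y_def)
      have "(\<Sum>k\<in>insert 0 Basis. X (x k) q * Y k h q)
        = ?u' * ?D (u y *\<^sub>R (a - y)) + (\<Sum>b\<in>Basis. (?u' * ((y - a) \<bullet> b) + u y * (\<kappa> \<bullet> b)) * ?D (u y *\<^sub>R b))"
        unfolding Yh \<kappa>[OF x] dx[OF yS] by (auto simp: l_def w_def intro!: sum.cong)
      also have "\<dots> = u y * ?D (?u' *\<^sub>R (a - y) + (\<Sum>b\<in>Basis. (?u' * ((y - a) \<bullet> b) + u y * (\<kappa> \<bullet> b)) *\<^sub>R b))"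
        by (rule combine)
      also have "(\<Sum>b\<in>Basis. (?u' * ((y - a) \<bullet> b) + u y * (\<kappa> \<bullet> b)) *\<^sub>R b) = ?u' *\<^sub>R (y - a) + u y *\<^sub>R \<kappa>"
      proof -
        have "(\<Sum>b\<in>Basis. (?u' * ((y - a) \<bullet> b) + u y * (\<kappa> \<bullet> b)) *\<^sub>R b)
          = (\<Sum>b\<in>Basis. ((?u' *\<^sub>R (y - a) + u y *\<^sub>R \<kappa>) \<bullet> b) *\<^sub>R b)"
          by (simp add: inner_add_left inner_scaleR_left)
        then show ?thesis by (simp only: euclidean_representation)
      qed
      also have "?u' *\<^sub>R (a - y) + (?u' *\<^sub>R (y - a) + u y *\<^sub>R \<kappa>) = u y *\<^sub>R \<kappa>"
        by (simp add: algebra_simps)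
      also have "u y * ?D (u y *\<^sub>R \<kappa>) = \<rho> q * X h q"
      proof -
        have "\<rho> q = u y * u y" using True by (simp add: \<rho>_def x_def chart_extension_def l_def y_def)
        then show ?thesis using True by (simp add: linear_cmul[OF lin] \<kappa>)
      qed
      finally show ?thesis by simp
    qed
    then show "(\<rho> \<odot> X) h q = (\<Sum>k\<in>insert 0 Basis. X (x k) \<odot> Y k) h q"
      by (simp add: sum_fun_apply)
  qed
  \<comment> \<open>This sum is the trace of the identity at \<open>p\<close> and later identifies
    the dimension of the tangent space. The redundant pair contributes nothing, because its radial
    field vanishes at the centre.\<close>
  moreover have "(\<Sum>k\<in>insert 0 Basis. Y k (x k) p) = real DIM('e)"
  proof -
    have "Y k (x k) p = (if k = 0 then 0 else k \<bullet> k)" for k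
    proof -
      have "Y k (x k) p = frechet_derivative (x k \<circ> ?i) (at a) (w k a)"
        using x p by (simp add: Y_def chart_extension_def a_def)
      also have "\<dots> = (if k = 0 then 0 else k \<bullet> k)"
        unfolding dx[OF aS] using linear_0[OF linear_frechet_derivative[OF smooth_on_differentiable[OF u(1), of a]]]
        by (auto simp: l_def w_def u(2))
      finally show ?thesis .
    qed
    moreover have "(\<Sum>k\<in>(Basis :: 'e set). if k = 0 then 0 else k \<bullet> k) = (\<Sum>k\<in>(Basis :: 'e set). 1)"
      by (rule sum.cong) auto
    ultimately show ?thesis by simp
  qed
  moreover have "\<rho> p = 1" using p u(2) by (simp add: \<rho>_def x_def chart_extension_def l_def a_def)
  moreover have "smooth_fun A \<rho>" unfolding \<rho>_def using x by simp
  ultimately show ?thesis using x Y by (intro that[of \<rho> x Y])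
qed

end

section \<open>Tensors and traces\<close>

context smooth_manifold
begin

lemma vector_field_add [simp]: "vector_field A X \<Longrightarrow> vector_field A Y \<Longrightarrow> vector_field A (X + Y)"
  by (rule vector_fieldI) (auto simp: vf_add vf_cmult vf_mult vf_nonsmooth vf_const vf_zero algebra_simps)

lemma vector_field_0 [simp]: "vector_field A 0"
  by (rule vector_fieldI) auto

lemma vector_field_uminus [simp]: "vector_field A X \<Longrightarrow> vector_field A (- X)"
  by (rule vector_fieldI) (auto simp: vf_add vf_cmult vf_mult vf_nonsmooth vf_const vf_zero algebra_simps)

lemma vector_field_diff [simp]: "vector_field A X \<Longrightarrow> vector_field A Y \<Longrightarrow> vector_field A (X - Y)"
  using vector_field_add[of X "- Y"] by simp

lemma vector_field_fmult [simp]: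
  assumes "smooth_fun A h" "vector_field A X" shows "vector_field A (h \<odot> X)"
proof (rule vector_fieldI)
  have eq: "(h \<odot> X) k = h * X k" for k by (simp add: fun_eq_iff)
  show "smooth_fun A ((h \<odot> X) k)" if "smooth_fun A k" for k using that assms by (simp add: eq)
qed (use assms in \<open>auto simp: vf_add vf_cmult vf_mult vf_nonsmooth vf_const vf_zero algebra_simps\<close>)

lemma vector_field_sum:
  "(\<And>i. i \<in> I \<Longrightarrow> vector_field A (X i)) \<Longrightarrow> vector_field A (\<Sum>i\<in>I. X i)"
  by (induction I rule: infinite_finite_induct) auto

lemma vector_field_sum' [simp]:
  "\<forall>i\<in>I. vector_field A (X i) \<Longrightarrow> vector_field A (\<Sum>i\<in>I. X i)"
  by (rule vector_field_sum) blast

lemma vector_field_bracket [simp]: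
  assumes "vector_field A X" "vector_field A Y" shows "vector_field A (bracket X Y)"
  using assms unfolding bracket_def
  by (intro vector_fieldI)
     (auto simp: vf_add[of X] vf_add[of Y] vf_cmult vf_mult[of X] vf_mult[of Y] vf_nonsmooth vf_const vf_zero algebra_simps)

lemma bracket_apply: "bracket X Y h p = X (Y h) p - Y (X h) p"
  by (simp add: bracket_def)

lemma vf_fmult_right: "vector_field A X \<Longrightarrow> vector_field A Y \<Longrightarrow> smooth_fun A h \<Longrightarrow> smooth_fun A k
    \<Longrightarrow> X ((h \<odot> Y) k) p = X h p * Y k p + h p * X (Y k) p"
  by (simp add: fmult_def vf_mult')

lemma bracket_antisym: "bracket X Y = - bracket Y X"
  by (simp add: fun_eq_iff bracket_apply)

lemma bracket_add_right:
  assumes "vector_field A X" "vector_field A Y" "vector_field A Z"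
  shows "bracket X (Y + Z) = bracket X Y + bracket X Z"
proof (intro ext)
  fix h p
  show "bracket X (Y + Z) h p = (bracket X Y + bracket X Z) h p"
    using assms by (cases "smooth_fun A h") (auto simp: bracket_apply vf_add vf_nonsmooth vf_const vf_zero)
qed

lemma bracket_diff_right:
  assumes "vector_field A X" "vector_field A Y" "vector_field A Z"
  shows "bracket X (Y - Z) = bracket X Y - bracket X Z"
proof (intro ext)
  fix h p
  show "bracket X (Y - Z) h p = (bracket X Y - bracket X Z) h p"
    using assms by (cases "smooth_fun A h") (auto simp: bracket_apply vf_diff[of X] vf_nonsmooth vf_const vf_zero)
qed

lemma bracket_sum_right:
  assumes "vector_field A X" "\<And>i. i \<in> I \<Longrightarrow> vector_field A (Y i)"
  shows "bracket X (\<Sum>i\<in>I. Y i) = (\<Sum>i\<in>I. bracket X (Y i))"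
  using assms(2)
proof (induction I rule: infinite_finite_induct)
  case (insert i I)
  have "bracket X (Y i + sum Y I) = bracket X (Y i) + bracket X (sum Y I)"
    using insert assms(1) by (intro bracket_add_right vector_field_sum) auto
  also have "bracket X (sum Y I) = (\<Sum>i\<in>I. bracket X (Y i))" using insert by simp
  finally show ?case unfolding sum.insert[OF insert.hyps] .
qed (use assms(1) in \<open>auto simp: bracket_def fun_eq_iff vf_zero\<close>)

lemma bracket_fmult_right:
  assumes "vector_field A X" "vector_field A Y" "smooth_fun A h"
  shows "bracket X (h \<odot> Y) = X h \<odot> Y + h \<odot> bracket X Y"
proof (intro ext)
  fix k p
  show "bracket X (h \<odot> Y) k p = (X h \<odot> Y + h \<odot> bracket X Y) k p"
    using assms by (cases "smooth_fun A k")
      (auto simp: bracket_apply vf_fmult_right algebra_simps vf_nonsmooth vf_const vf_zero)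
qed

lemma Jacobi_identity:
  assumes "vector_field A X" "vector_field A Y" "vector_field A Z"
  shows "bracket X (bracket Y Z) = bracket (bracket X Y) Z + bracket Y (bracket X Z)"
proof (intro ext)
  fix h p
  show "bracket X (bracket Y Z) h p = (bracket (bracket X Y) Z + bracket Y (bracket X Z)) h p"
    using assms by (cases "smooth_fun A h") (auto simp: bracket_def vf_diff vf_nonsmooth vf_const vf_zero)
qed

lemma tensor11_field [simp]: "tensor11 A F \<Longrightarrow> vector_field A X \<Longrightarrow> vector_field A (F X)"
  by (simp add: tensor11_def)

lemma tensor11_add: "tensor11 A F \<Longrightarrow> vector_field A X \<Longrightarrow> vector_field A Y \<Longrightarrow> F (X + Y) = F X + F Y"
  by (simp add: tensor11_def)

lemma tensor11_fmult: "tensor11 A F \<Longrightarrow> smooth_fun A h \<Longrightarrow> vector_field A X \<Longrightarrow> F (h \<odot> X) = h \<odot> F X"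
  by (simp add: tensor11_def)

lemma one_form_smooth [simp]: "one_form A \<omega> \<Longrightarrow> vector_field A X \<Longrightarrow> smooth_fun A (\<omega> X)"
  by (simp add: one_form_def)

lemma one_form_add: "one_form A \<omega> \<Longrightarrow> vector_field A X \<Longrightarrow> vector_field A Y \<Longrightarrow> \<omega> (X + Y) = \<omega> X + \<omega> Y"
  by (simp add: one_form_def)

lemma one_form_fmult: "one_form A \<omega> \<Longrightarrow> smooth_fun A h \<Longrightarrow> vector_field A X \<Longrightarrow> \<omega> (h \<odot> X) = h * \<omega> X"
  by (simp add: one_form_def)

lemma fmult_minus_1: "(\<lambda>_. -1) \<odot> X = - X"
  by (simp add: fun_eq_iff)

lemma tensor11_uminus: "tensor11 A F \<Longrightarrow> vector_field A X \<Longrightarrow> F (- X) = - F X"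
  using tensor11_fmult[of F "\<lambda>_. -1" X] by (simp add: fmult_minus_1)

lemma tensor11_diff: "tensor11 A F \<Longrightarrow> vector_field A X \<Longrightarrow> vector_field A Y \<Longrightarrow> F (X - Y) = F X - F Y"
  using tensor11_add[of F X "- Y"] by (simp add: tensor11_uminus[of F])

lemma tensor11_0: "tensor11 A F \<Longrightarrow> F 0 = 0"
  using tensor11_add[of F 0 0] by simp

lemma tensor11_sum: "tensor11 A F \<Longrightarrow> (\<And>i. i \<in> I \<Longrightarrow> vector_field A (X i)) \<Longrightarrow> F (\<Sum>i\<in>I. X i) = (\<Sum>i\<in>I. F (X i))"
  by (induction I rule: infinite_finite_induct) (auto simp: tensor11_add[of F] tensor11_0[of F])

lemma one_form_uminus: "one_form A \<omega> \<Longrightarrow> vector_field A X \<Longrightarrow> \<omega> (- X) = - \<omega> X"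
  using one_form_fmult[of \<omega> "\<lambda>_. -1" X] by (simp add: fmult_minus_1 fun_eq_iff)

lemma one_form_diff: "one_form A \<omega> \<Longrightarrow> vector_field A X \<Longrightarrow> vector_field A Y \<Longrightarrow> \<omega> (X - Y) = \<omega> X - \<omega> Y"
  using one_form_add[of \<omega> X "- Y"] by (simp add: one_form_uminus[of \<omega>])

lemma one_form_0: "one_form A \<omega> \<Longrightarrow> \<omega> 0 = 0"
  using one_form_add[of \<omega> 0 0] by simp

lemma one_form_sum: "one_form A \<omega> \<Longrightarrow> (\<And>i. i \<in> I \<Longrightarrow> vector_field A (X i)) \<Longrightarrow> \<omega> (\<Sum>i\<in>I. X i) = (\<Sum>i\<in>I. \<omega> (X i))"
  by (induction I rule: infinite_finite_induct) (auto simp: one_form_add[of \<omega>] one_form_0[of \<omega>])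

lemma tensor11_id: "tensor11 A (\<lambda>X. X)"
  by (simp add: tensor11_def)

lemma tensor11_one_form: "tensor11 A F \<Longrightarrow> smooth_fun A h \<Longrightarrow> one_form A (\<lambda>X. F X h)"
  unfolding one_form_def by (auto simp: tensor11_add[of F] tensor11_fmult[of F] fun_eq_iff)

lemma vf_one_form: "smooth_fun A h \<Longrightarrow> one_form A (\<lambda>X. X h)"
  using tensor11_one_form[OF tensor11_id] .

text \<open>By function-linearity, \<open>\<rho> * \<omega> X\<close> is a combination of the fixed
  functions \<open>\<omega> (Y k)\<close> with coefficients \<open>X (x k)\<close>, which vanish at
  \<open>p\<close>; and \<open>\<rho>\<close> is \<open>1\<close> there.\<close>

lemma one_form_local:
  assumes \<omega>: "one_form A \<omega>" and X: "vector_field A X" and X0: "\<And>h. X h p = 0"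
  shows "\<omega> X p = 0"
proof -
  obtain \<rho> :: "'a \<Rightarrow> real" and x :: "'e \<Rightarrow> 'a \<Rightarrow> real" and Y :: "'e \<Rightarrow> 'a vfield" where
    fr: "smooth_fun A \<rho>" "\<rho> p = 1" "\<And>k. smooth_fun A (x k)" "\<And>k. vector_field A (Y k)"
    "\<And>X. vector_field A X \<Longrightarrow> \<rho> \<odot> X = (\<Sum>k\<in>insert 0 Basis. X (x k) \<odot> Y k)"
    by (rule local_frame[of p]) blast
  have "\<rho> * \<omega> X = \<omega> (\<rho> \<odot> X)" using \<omega> X fr(1) by (simp add: one_form_fmult[of \<omega>])
  also have "\<dots> = (\<Sum>k\<in>insert 0 Basis. X (x k) * \<omega> (Y k))"
    unfolding fr(5)[OF X] using \<omega> X fr(3,4) by (subst one_form_sum[of \<omega>]) (auto simp: one_form_fmult[of \<omega>])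
  finally have "(\<rho> * \<omega> X) p = (\<Sum>k\<in>insert 0 Basis. X (x k) * \<omega> (Y k)) p" by simp
  then show ?thesis using fr(2) X0 by (simp add: sum_fun_apply)
qed

lemma one_form_cong_at:
  assumes "one_form A \<omega>" "vector_field A X" "vector_field A Y" "value_at X p = value_at Y p"
  shows "\<omega> X p = \<omega> Y p"
  using one_form_local[OF assms(1), of "X - Y" p] assms
  by (simp add: one_form_diff[of \<omega>] value_at_def fun_eq_iff)

section \<open>Tangent spaces and traces\<close>

lemma tangent_space_subspace: "fvs.subspace (tangent_space A p)"
proof (rule fvs.subspaceI)
  show "0 \<in> tangent_space A p"
    unfolding tangent_space_def by (auto intro!: exI[of _ 0] simp: value_at_def fun_eq_iff)
  show "u + v \<in> tangent_space A p" if uv: "u \<in> tangent_space A p" "v \<in> tangent_space A p" for u v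
  proof -
    obtain X Y where "u = value_at X p" "v = value_at Y p" "vector_field A X" "vector_field A Y"
      using uv unfolding tangent_space_def by auto
    then show ?thesis unfolding tangent_space_def
      by (auto intro!: exI[of _ "X + Y"] simp: value_at_def fun_eq_iff)
  qed
  show "fscale c u \<in> tangent_space A p" if u: "u \<in> tangent_space A p" for c u
  proof -
    obtain X where "u = value_at X p" "vector_field A X"
      using u unfolding tangent_space_def by auto
    then show ?thesis unfolding tangent_space_def
      by (auto intro!: exI[of _ "(\<lambda>_. c) \<odot> X"] simp: value_at_def fun_eq_iff fscale_def)
  qed
qed

text \<open>The bound is one too large because of the redundant member of the local frame.
  Finiteness is all that is wanted at this stage; \<open>spanning_at_dim\<close> finds the exact
  dimension.\<close>

lemma tangent_space_finite_span:
  obtains S where "finite S" "card S \<le> Suc DIM('e)" "tangent_space A p \<subseteq> fvs.span S"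
proof -
  obtain \<rho> :: "'a \<Rightarrow> real" and x :: "'e \<Rightarrow> 'a \<Rightarrow> real" and Y :: "'e \<Rightarrow> 'a vfield" where
    fr: "\<rho> p = 1" "\<And>X. vector_field A X \<Longrightarrow> \<rho> \<odot> X = (\<Sum>k\<in>insert 0 Basis. X (x k) \<odot> Y k)"
    by (rule local_frame[of p]) blast
  let ?S = "(\<lambda>k. value_at (Y k) p) ` insert 0 Basis"
  have "value_at X p \<in> fvs.span ?S" if "vector_field A X" for X
  proof -
    have "value_at X p = (\<Sum>k\<in>insert 0 Basis. fscale (X (x k) p) (value_at (Y k) p))"
    proof
      fix h
      have "(\<rho> \<odot> X) h p = (\<Sum>k\<in>insert 0 Basis. X (x k) \<odot> Y k) h p" by (simp only: fr(2)[OF that])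
      then show "value_at X p h = (\<Sum>k\<in>insert 0 Basis. fscale (X (x k) p) (value_at (Y k) p)) h"
        using fr(1) by (simp add: sum_fun_apply value_at_def fscale_def)
    qed
    also have "\<dots> \<in> fvs.span ?S"
      by (intro fvs.span_sum fvs.span_scale fvs.span_base imageI)
    finally show ?thesis .
  qed
  moreover have "card ?S \<le> Suc DIM('e)"
    using card_image_le[of "insert 0 (Basis :: 'e set)" "\<lambda>k. value_at (Y k) p"] by simp
  ultimately show ?thesis using that[of ?S] by (auto simp: tangent_space_def)
qed

end

text \<open>A map given as a sum of covectors times vectors has the sum of the pairings as its
  trace, in whichever basis. The vectors \<open>w k\<close> may be linearly dependent.\<close>

lemma trace_of_finite_rank:
  assumes B: "finite B" "fvs.independent B" "fvs.span B = T"
    and L: "\<And>v. v \<in> T \<Longrightarrow> L v = (\<Sum>k\<in>K. fscale (c k v) (w k))"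
    and w: "\<And>k. k \<in> K \<Longrightarrow> w k \<in> T"
    and c: "\<And>k r. k \<in> K \<Longrightarrow> c k (\<Sum>b\<in>B. fscale (r b) b) = (\<Sum>b\<in>B. r b * c k b)"
  shows "(\<Sum>b\<in>B. fvs.representation B (L b) b) = (\<Sum>k\<in>K. c k (w k))"
proof -
  have "fvs.representation B (L b) b = (\<Sum>k\<in>K. c k b * fvs.representation B (w k) b)" if "b \<in> B" for b
  proof -
    have "b \<in> T" using that B(3) fvs.span_base by blast
    have "fvs.representation B (\<Sum>k\<in>K. fscale (c k b) (w k)) = (\<lambda>b'. \<Sum>k\<in>K. fvs.representation B (fscale (c k b) (w k)) b')"
      using w B by (intro fvs.representation_sum) (auto intro: fvs.span_scale)
    then show ?thesis
      using w B \<open>b \<in> T\<close> by (simp add: L fvs.representation_scale)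
  qed
  then have "(\<Sum>b\<in>B. fvs.representation B (L b) b) = (\<Sum>b\<in>B. \<Sum>k\<in>K. c k b * fvs.representation B (w k) b)"
    by simp
  also have "\<dots> = (\<Sum>k\<in>K. \<Sum>b\<in>B. fvs.representation B (w k) b * c k b)"
    by (subst sum.swap) (simp add: mult.commute)
  also have "\<dots> = (\<Sum>k\<in>K. c k (w k))"
  proof (rule sum.cong)
    fix k assume k: "k \<in> K"
    have "(\<Sum>b\<in>B. fscale (fvs.representation B (w k) b) b) = w k"
      using w[OF k] B by (intro fvs.sum_representation_eq) auto
    with c[OF k, of "fvs.representation B (w k)"]
    show "(\<Sum>b\<in>B. fvs.representation B (w k) b * c k b) = c k (w k)" by simp
  qed simp
  finally show ?thesis .
qed

context smooth_manifold
begin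

text \<open>This removes both choices hidden in a trace: the basis in \<open>lin_trace\<close> and
  the extending vector field in \<open>map_at\<close>. Since the family over \<open>K\<close> need
  not be a basis, the redundant local frame is admissible as well as an orthonormal one.\<close>

lemma trace_at_finite_rank:
  assumes \<omega>: "\<And>k. k \<in> K \<Longrightarrow> one_form A (\<omega> k)" and W: "\<And>k. k \<in> K \<Longrightarrow> vector_field A (W k)"
    and F: "\<And>X h. vector_field A X \<Longrightarrow> F X h p = (\<Sum>k\<in>K. \<omega> k X p * W k h p)"
  shows "trace_at A F p = (\<Sum>k\<in>K. \<omega> k (W k) p)"
proof -
  let ?T = "tangent_space A p"
  define ex where "ex v = (SOME X. vector_field A X \<and> value_at X p = v)" for v
  have ex: "vector_field A (ex v)" "value_at (ex v) p = v" if "v \<in> ?T" for v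
    using someI_ex[of "\<lambda>X. vector_field A X \<and> value_at X p = v"] that
    unfolding ex_def tangent_space_def by blast+
  define c where "c k v = \<omega> k (ex v) p" for k v
  have c: "c k (value_at X p) = \<omega> k X p" if "k \<in> K" "vector_field A X" for k X
  proof -
    have "value_at X p \<in> ?T" using that unfolding tangent_space_def by blast
    then show ?thesis unfolding c_def using ex that(2) by (intro one_form_cong_at[OF \<omega>[OF that(1)]]) auto
  qed
  define B where "B = (SOME B. fvs.independent B \<and> fvs.span B = ?T)"
  have "\<exists>B. fvs.independent B \<and> fvs.span B = ?T"
    using fvs.basis_exists[of ?T] fvs.span_subspace[OF _ _ tangent_space_subspace[of p]] by metis
  then have B: "fvs.independent B" "fvs.span B = ?T"
    using someI_ex[of "\<lambda>B. fvs.independent B \<and> fvs.span B = ?T"] unfolding B_def by auto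
  obtain S where "finite S" "?T \<subseteq> fvs.span S" by (rule tangent_space_finite_span)
  then have fB: "finite B"
    using fvs.independent_span_bound[of S B] B fvs.span_superset[of B] by auto
  have BT: "b \<in> ?T" if "b \<in> B" for b using that B(2) fvs.span_superset by blast
  have "(\<Sum>b\<in>B. fvs.representation B (map_at A F p b) b) = (\<Sum>k\<in>K. c k (value_at (W k) p))"
  proof (rule trace_of_finite_rank[where K=K and c=c and w="\<lambda>k. value_at (W k) p", OF fB B])
    fix v assume "v \<in> ?T"
    from F[OF ex(1)[OF this]]
    show "map_at A F p v = (\<Sum>k\<in>K. fscale (c k v) (value_at (W k) p))"
      unfolding map_at_def c_def ex_def[symmetric]
      by (simp add: fun_eq_iff value_at_def fscale_def sum_fun_apply)
  next
    show "value_at (W k) p \<in> ?T" if "k \<in> K" for k using W[OF that] unfolding tangent_space_def by blast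
  next
    fix k r assume k: "k \<in> K"
    have vf: "vector_field A (\<Sum>b\<in>B. (\<lambda>_. r b) \<odot> ex b)" using ex BT by simp
    have "(\<Sum>b\<in>B. fscale (r b) b) = value_at (\<Sum>b\<in>B. (\<lambda>_. r b) \<odot> ex b) p"
    proof
      fix h
      have "b h = ex b h p" if "b \<in> B" for b
        using ex(2)[OF BT[OF that]] by (metis value_at_def)
      then show "(\<Sum>b\<in>B. fscale (r b) b) h = value_at (\<Sum>b\<in>B. (\<lambda>_. r b) \<odot> ex b) p h"
        by (simp add: sum_fun_apply value_at_def fscale_def)
    qed
    then have "c k (\<Sum>b\<in>B. fscale (r b) b) = \<omega> k (\<Sum>b\<in>B. (\<lambda>_. r b) \<odot> ex b) p"
      using c[OF k vf] by simp
    also have "\<dots> = (\<Sum>b\<in>B. r b * c k b)"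
      using \<omega>[OF k] ex BT by (simp add: one_form_sum[of "\<omega> k"] one_form_fmult[of "\<omega> k"] sum_fun_apply c_def)
    finally show "c k (\<Sum>b\<in>B. fscale (r b) b) = (\<Sum>b\<in>B. r b * c k b)" .
  qed
  also have "\<dots> = (\<Sum>k\<in>K. \<omega> k (W k) p)" using c W by simp
  finally show ?thesis by (simp add: trace_at_def lin_trace_def B_def Let_def)
qed

end

section \<open>Orthonormal frames of a Riemannian metric\<close>

locale riemannian_manifold = smooth_manifold A
  for A :: "('a::{t2_space, second_countable_topology}, 'e::euclidean_space) atlas" +
  fixes g :: "'a form2"
  assumes g_metric: "riemannian_metric A g"
begin

lemma g_one_form: "vector_field A Y \<Longrightarrow> one_form A (\<lambda>X. g X Y)"
  using g_metric by (simp add: riemannian_metric_def)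

lemma g_sym: "vector_field A X \<Longrightarrow> vector_field A Y \<Longrightarrow> g X Y = g Y X"
  using g_metric by (simp add: riemannian_metric_def)

lemma g_pos: "vector_field A X \<Longrightarrow> value_at X p \<noteq> 0 \<Longrightarrow> g X X p > 0"
  using g_metric by (simp add: riemannian_metric_def)

lemma g_smooth [simp]: "vector_field A X \<Longrightarrow> vector_field A Y \<Longrightarrow> smooth_fun A (g X Y)"
  using one_form_smooth[OF g_one_form] .

lemma g_add_left: "vector_field A X \<Longrightarrow> vector_field A Y \<Longrightarrow> vector_field A Z \<Longrightarrow> g (X + Y) Z = g X Z + g Y Z"
  using one_form_add[OF g_one_form] .

lemma g_diff_left: "vector_field A X \<Longrightarrow> vector_field A Y \<Longrightarrow> vector_field A Z \<Longrightarrow> g (X - Y) Z = g X Z - g Y Z"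
  using one_form_diff[OF g_one_form] .

lemma g_uminus_left: "vector_field A X \<Longrightarrow> vector_field A Z \<Longrightarrow> g (- X) Z = - g X Z"
  using one_form_uminus[OF g_one_form] .

lemma g_0_left: "vector_field A Z \<Longrightarrow> g 0 Z = 0"
  using one_form_0[OF g_one_form] .

lemma g_fmult_left: "smooth_fun A h \<Longrightarrow> vector_field A X \<Longrightarrow> vector_field A Z \<Longrightarrow> g (h \<odot> X) Z = h * g X Z"
  using one_form_fmult[OF g_one_form] .

lemma g_sum_left: "vector_field A Z \<Longrightarrow> \<forall>i\<in>I. vector_field A (X i) \<Longrightarrow> g (\<Sum>i\<in>I. X i) Z = (\<Sum>i\<in>I. g (X i) Z)"
  using one_form_sum[OF g_one_form, of Z I X] by simp

lemma g_add_right: "vector_field A X \<Longrightarrow> vector_field A Y \<Longrightarrow> vector_field A Z \<Longrightarrow> g Z (X + Y) = g Z X + g Z Y"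
  by (simp add: g_sym[of Z] g_add_left)

lemma g_diff_right: "vector_field A X \<Longrightarrow> vector_field A Y \<Longrightarrow> vector_field A Z \<Longrightarrow> g Z (X - Y) = g Z X - g Z Y"
  by (simp add: g_sym[of Z] g_diff_left)

lemma g_uminus_right: "vector_field A X \<Longrightarrow> vector_field A Z \<Longrightarrow> g Z (- X) = - g Z X"
  by (simp add: g_sym[of Z] g_uminus_left)

lemma g_0_right: "vector_field A Z \<Longrightarrow> g Z 0 = 0"
  by (simp add: g_sym[of Z] g_0_left)

lemma g_fmult_right: "smooth_fun A h \<Longrightarrow> vector_field A X \<Longrightarrow> vector_field A Z \<Longrightarrow> g Z (h \<odot> X) = h * g Z X"
  by (simp add: g_sym[of Z] g_fmult_left)

lemma g_sum_right: "vector_field A Z \<Longrightarrow> \<forall>i\<in>I. vector_field A (X i) \<Longrightarrow> g Z (\<Sum>i\<in>I. X i) = (\<Sum>i\<in>I. g Z (X i))"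
  by (simp add: g_sym[of Z] g_sum_left)

lemmas g_linear = g_add_left g_diff_left g_uminus_left g_0_left g_fmult_left g_sum_left
  g_add_right g_diff_right g_uminus_right g_0_right g_fmult_right g_sum_right

lemma g_eq_0D: "vector_field A X \<Longrightarrow> g X X p = 0 \<Longrightarrow> X h p = 0"
  using g_pos[of X p] by (metis value_at_def less_irrefl zero_fun_apply)

lemma vector_field_eqI:
  assumes "vector_field A X" "vector_field A Y" "\<And>W p. vector_field A W \<Longrightarrow> g X W p = g Y W p"
  shows "X = Y"
proof (intro ext)
  fix h p
  have "g (X - Y) (X - Y) p = 0" using assms by (simp add: g_diff_left)
  then have "(X - Y) h p = 0" using assms by (intro g_eq_0D[of "X - Y"]) auto
  then show "X h p = Y h p" by simp
qed

definition orthonormal_at :: "'a \<Rightarrow> nat \<Rightarrow> (nat \<Rightarrow> 'a vfield) \<Rightarrow> bool" where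
  "orthonormal_at p k E \<longleftrightarrow> (\<forall>i<k. vector_field A (E i)) \<and>
     (\<forall>i<k. \<forall>j<k. g (E i) (E j) p = (if i = j then 1 else 0))"

lemma orthonormal_frame_at_iff: "orthonormal_frame_at A g p E \<longleftrightarrow> orthonormal_at p DIM('e) E"
  by (simp add: orthonormal_frame_at_def orthonormal_at_def)

definition spanning_at :: "'a \<Rightarrow> nat \<Rightarrow> (nat \<Rightarrow> 'a vfield) \<Rightarrow> bool" where
  "spanning_at p k E \<longleftrightarrow> (\<forall>X h. vector_field A X \<longrightarrow> X h p = (\<Sum>i<k. g X (E i) p * E i h p))"

text \<open>Orthonormality at \<open>p\<close> makes the values at \<open>p\<close> distinct and
  linearly independent, so a finite spanning set bounds their number. Even this crude bound stops
  the extension of orthonormal systems.\<close>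

lemma orthonormal_at_le:
  assumes "orthonormal_at p k E" shows "k \<le> Suc DIM('e)"
proof -
  have E: "\<And>i. i < k \<Longrightarrow> vector_field A (E i)"
    and on: "\<And>i j. i < k \<Longrightarrow> j < k \<Longrightarrow> g (E i) (E j) p = (if i = j then 1 else 0)"
    using assms by (auto simp: orthonormal_at_def)
  let ?v = "\<lambda>i. value_at (E i) p"
  have coeff: "r j = 0" if "j < k" "(\<Sum>i<k. fscale (r i) (?v i)) = 0" for r j
  proof -
    let ?Z = "\<Sum>i<k. (\<lambda>_. r i) \<odot> E i"
    have "?Z h p = 0" for h
      using fun_cong[OF that(2), of h] by (simp add: sum_fun_apply fscale_def value_at_def)
    moreover have "vector_field A ?Z" using E by (intro vector_field_sum vector_field_fmult) auto
    ultimately have "g ?Z (E j) p = 0"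
      using E that(1) by (intro one_form_local[OF g_one_form]) auto
    moreover have "g ?Z (E j) p = (\<Sum>i<k. r i * g (E i) (E j) p)"
      using E that(1) by (simp add: g_linear sum_fun_apply)
    moreover have "\<dots> = (\<Sum>i<k. if i = j then r i else 0)"
      using on that(1) by (intro sum.cong) auto
    ultimately show ?thesis using that(1) by simp
  qed
  have inj: "inj_on ?v {..<k}"
  proof (rule inj_onI, rule ccontr)
    fix i j assume ij: "i \<in> {..<k}" "j \<in> {..<k}" "?v i = ?v j" "i \<noteq> j"
    have "g (E i) (E i) p = g (E j) (E i) p"
      using ij E by (intro one_form_cong_at[OF g_one_form]) auto
    with ij on show False by auto
  qed
  have "fvs.independent (?v ` {..<k})"
  proof (rule ccontr)
    assume "\<not> fvs.independent (?v ` {..<k})"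
    then obtain u where u: "\<exists>v\<in>?v ` {..<k}. u v \<noteq> 0" "(\<Sum>v\<in>?v ` {..<k}. fscale (u v) v) = 0"
      using fvs.dependent_finite[of "?v ` {..<k}"] by auto
    have "(\<Sum>i<k. fscale (u (?v i)) (?v i)) = 0" using u(2) by (simp add: sum.reindex[OF inj])
    from coeff[OF _ this] show False using u(1) by auto
  qed
  moreover obtain S where S: "finite S" "card S \<le> Suc DIM('e)" "tangent_space A p \<subseteq> fvs.span S"
    by (rule tangent_space_finite_span)
  moreover have "?v ` {..<k} \<subseteq> fvs.span S" using E S(3) by (auto simp: tangent_space_def)
  ultimately have "card (?v ` {..<k}) \<le> card S" using fvs.independent_span_bound by blast
  then show ?thesis using S(2) by (simp add: card_image[OF inj])
qed

text \<open>One Gram-Schmidt step, with the coefficients frozen at their values at \<open>p\<close>,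
  since orthonormality is required only there.\<close>

lemma orthonormal_at_extend:
  assumes on: "orthonormal_at p k E" and "\<not> spanning_at p k E"
  obtains E' where "orthonormal_at p (Suc k) E'"
proof -
  obtain X h where X: "vector_field A X" and ne: "X h p \<noteq> (\<Sum>i<k. g X (E i) p * E i h p)"
    using assms(2) by (auto simp: spanning_at_def)
  have E: "\<And>i. i < k \<Longrightarrow> vector_field A (E i)"
    and onE: "\<And>i j. i < k \<Longrightarrow> j < k \<Longrightarrow> g (E i) (E j) p = (if i = j then 1 else 0)"
    using on by (auto simp: orthonormal_at_def)
  define R where "R = X - (\<Sum>i<k. (\<lambda>_. g X (E i) p) \<odot> E i)"
  have R: "vector_field A R" unfolding R_def using X E
    by (intro vector_field_diff vector_field_sum vector_field_fmult) auto
  have "R h p \<noteq> 0" using ne by (simp add: R_def sum_fun_apply)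
  then have pos: "g R R p > 0" using g_pos[OF R] by (auto simp: value_at_def fun_eq_iff)
  have RE: "g R (E j) p = 0" if "j < k" for j
  proof -
    have "g R (E j) p = g X (E j) p - (\<Sum>i<k. g X (E i) p * g (E i) (E j) p)"
      unfolding R_def using X E that by (simp add: g_linear sum_fun_apply)
    also have "(\<Sum>i<k. g X (E i) p * g (E i) (E j) p) = (\<Sum>i<k. if i = j then g X (E i) p else 0)"
      using onE that by (intro sum.cong) auto
    finally show ?thesis using that by simp
  qed
  have ER: "g (E j) R p = 0" if "j < k" for j
    using RE[OF that] g_sym[OF R E[OF that]] by simp
  define c where "c = 1 / sqrt (g R R p)"
  define E' where "E' i = (if i < k then E i else (\<lambda>_. c) \<odot> R)" for i
  have "c * (c * g R R p) = 1" using pos by (simp add: c_def field_simps)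
  then have "orthonormal_at p (Suc k) E'"
    using E R RE ER onE by (auto simp: orthonormal_at_def E'_def g_linear less_Suc_eq)
  then show ?thesis by (rule that)
qed

lemma spanning_at_expand:
  assumes "orthonormal_at p k E" "spanning_at p k E" "one_form A \<omega>" "vector_field A X"
  shows "\<omega> X p = (\<Sum>i<k. g X (E i) p * \<omega> (E i) p)"
proof -
  have E: "\<And>i. i < k \<Longrightarrow> vector_field A (E i)" using assms(1) by (auto simp: orthonormal_at_def)
  let ?R = "\<Sum>i<k. (\<lambda>_. g X (E i) p) \<odot> E i"
  have "value_at X p = value_at ?R p"
    using assms(2,4) by (simp add: fun_eq_iff value_at_def sum_fun_apply spanning_at_def)
  moreover have "vector_field A ?R" using E by (intro vector_field_sum vector_field_fmult) auto
  ultimately have "\<omega> X p = \<omega> ?R p" using assms(4) E by (intro one_form_cong_at[OF assms(3)]) auto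
  also have "\<omega> ?R = (\<Sum>i<k. \<omega> ((\<lambda>_. g X (E i) p) \<odot> E i))"
    using E by (intro one_form_sum[OF assms(3)]) auto
  also have "\<dots> p = (\<Sum>i<k. g X (E i) p * \<omega> (E i) p)"
    using E by (simp add: one_form_fmult[OF assms(3)] sum_fun_apply)
  finally show ?thesis .
qed

text \<open>The trace of the identity is computed twice: an orthonormal spanning system gives its
  length \<open>k\<close>, and the local frame gives the dimension of the model space.\<close>

lemma spanning_at_dim:
  assumes "orthonormal_at p k E" "spanning_at p k E" shows "k = DIM('e)"
proof -
  have E: "\<And>i. i < k \<Longrightarrow> vector_field A (E i)"
    and onE: "\<And>i j. i < k \<Longrightarrow> j < k \<Longrightarrow> g (E i) (E j) p = (if i = j then 1 else 0)"
    using assms(1) by (auto simp: orthonormal_at_def)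
  have "trace_at A (\<lambda>X. X) p = (\<Sum>i<k. g (E i) (E i) p)"
    using assms(2) E by (subst trace_at_finite_rank[where \<omega> = "\<lambda>i X. g X (E i)" and K="{..<k}" and W=E])
      (auto simp: spanning_at_def intro: g_one_form)
  also have "\<dots> = real k" using onE by simp
  finally have 1: "trace_at A (\<lambda>X. X) p = real k" .
  obtain \<rho> :: "'a \<Rightarrow> real" and x :: "'e \<Rightarrow> 'a \<Rightarrow> real" and Y :: "'e \<Rightarrow> 'a vfield" where
    fr: "smooth_fun A \<rho>" "\<rho> p = 1" "\<And>k. smooth_fun A (x k)" "\<And>k. vector_field A (Y k)"
    "\<And>X. vector_field A X \<Longrightarrow> \<rho> \<odot> X = (\<Sum>k\<in>insert 0 Basis. X (x k) \<odot> Y k)"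
    "(\<Sum>k\<in>insert 0 Basis. Y k (x k) p) = real DIM('e)"
    by (rule local_frame[of p]) blast
  have "X h p = (\<Sum>k\<in>insert 0 Basis. X (x k) p * Y k h p)" if "vector_field A X" for X h
  proof -
    have "(\<rho> \<odot> X) h p = (\<Sum>k\<in>insert 0 Basis. X (x k) \<odot> Y k) h p" by (simp only: fr(5)[OF that])
    then show ?thesis using fr(2) by (simp add: sum_fun_apply)
  qed
  then have "trace_at A (\<lambda>X. X) p = (\<Sum>k\<in>insert 0 Basis. Y k (x k) p)"
    using fr by (subst trace_at_finite_rank[where \<omega> = "\<lambda>k X. X (x k)" and K="insert 0 Basis" and W=Y])
      (auto intro: vf_one_form)
  with 1 fr(6) show ?thesis by simp
qed

lemma orthonormal_at_maximal:
  assumes "orthonormal_at p k E"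
  obtains k' E' where "k \<le> k'" "orthonormal_at p k' E'" "spanning_at p k' E'"
proof -
  have "\<exists>k' E'. k \<le> k' \<and> orthonormal_at p k' E' \<and> spanning_at p k' E'"
    using assms
  proof (induction "Suc DIM('e) - k" arbitrary: k E rule: less_induct)
    case less
    show ?case
    proof (cases "spanning_at p k E")
      case False
      obtain E' where E': "orthonormal_at p (Suc k) E'"
        using orthonormal_at_extend[OF less.prems False] by blast
      \<comment> \<open>The bound on the longer system shows that the truncated difference really
        decreases.\<close>
      have "Suc DIM('e) - Suc k < Suc DIM('e) - k" using orthonormal_at_le[OF E'] by simp
      from less.hyps[OF this E'] show ?thesis by (meson Suc_leD)
    qed (use less.prems in blast)
  qed
  then show ?thesis using that by blast
qed

lemma orthonormal_frame_exists:
  obtains E where "orthonormal_frame_at A g p E"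
proof -
  have "orthonormal_at p 0 (\<lambda>_. 0)" by (simp add: orthonormal_at_def)
  then obtain k E where "orthonormal_at p k E" "spanning_at p k E" by (rule orthonormal_at_maximal)
  with spanning_at_dim[OF this] that show ?thesis by (simp add: orthonormal_frame_at_iff)
qed

text \<open>If it did not span, it could be enlarged to a maximal system, which would span with more
  than the dimension many members.\<close>

lemma orthonormal_frame_spanning:
  assumes "orthonormal_frame_at A g p E" shows "spanning_at p DIM('e) E"
proof (rule ccontr)
  assume "\<not> spanning_at p DIM('e) E"
  then obtain E' where "orthonormal_at p (Suc DIM('e)) E'"
    using assms orthonormal_at_extend unfolding orthonormal_frame_at_iff by blast
  then obtain k E'' where "Suc DIM('e) \<le> k" "orthonormal_at p k E''" "spanning_at p k E''"
    by (rule orthonormal_at_maximal)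
  with spanning_at_dim show False by fastforce
qed

lemma orthonormal_frame_field: "orthonormal_frame_at A g p E \<Longrightarrow> i < DIM('e) \<Longrightarrow> vector_field A (E i)"
  by (simp add: orthonormal_frame_at_def)

lemma orthonormal_frame_g: "orthonormal_frame_at A g p E \<Longrightarrow> i < DIM('e) \<Longrightarrow> j < DIM('e)
    \<Longrightarrow> g (E i) (E j) p = (if i = j then 1 else 0)"
  by (simp add: orthonormal_frame_at_def)

lemma orthonormal_frame_expand:
  assumes "orthonormal_frame_at A g p E" "one_form A \<omega>" "vector_field A X"
  shows "\<omega> X p = (\<Sum>i<DIM('e). g X (E i) p * \<omega> (E i) p)"
  using spanning_at_expand[of p "DIM('e)" E] orthonormal_frame_spanning assms
  by (simp add: orthonormal_frame_at_iff)

lemma trace_at_orthonormal: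
  assumes E: "orthonormal_frame_at A g p E" and F: "tensor11 A F"
  shows "trace_at A F p = (\<Sum>i<DIM('e). g (F (E i)) (E i) p)"
proof (rule trace_at_finite_rank[where \<omega> = "\<lambda>i X. g X (E i)" and W="\<lambda>i. F (E i)"])
  show "F X h p = (\<Sum>i<DIM('e). g X (E i) p * F (E i) h p)" if X: "vector_field A X" for X h
  proof (cases "smooth_fun A h")
    case True
    from orthonormal_frame_expand[OF E tensor11_one_form[OF F True] X] show ?thesis .
  next
    case False
    then show ?thesis using X F orthonormal_frame_field[OF E] by (simp add: vf_nonsmooth vf_const vf_zero)
  qed
qed (use F orthonormal_frame_field[OF E] in \<open>auto intro!: g_one_form\<close>)

lemma metric_trace_at_orthonormal:
  assumes "\<And>E. orthonormal_frame_at A g p E \<Longrightarrow> (\<Sum>i<DIM('e). T (E i) (E i) p) = c"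
  shows "metric_trace_at A g T p = c"
proof -
  have "\<exists>E. orthonormal_frame_at A g p E" using orthonormal_frame_exists by blast
  then have "orthonormal_frame_at A g p (SOME E. orthonormal_frame_at A g p E)" by (rule someI_ex)
  then show ?thesis using assms by (simp add: metric_trace_at_def Let_def)
qed

text \<open>Both traces are computed in the same local frame of \<open>local_frame\<close>.\<close>

lemma vf_trace_at:
  assumes F: "tensor11 A F" and sm: "smooth_fun A (trace_at A F)" and X: "vector_field A X"
  shows "X (trace_at A F) p = trace_at A (\<lambda>Z. bracket X (F Z) - F (bracket X Z)) p"
proof -
  obtain \<rho> :: "'a \<Rightarrow> real" and x :: "'e \<Rightarrow> 'a \<Rightarrow> real" and Y :: "'e \<Rightarrow> 'a vfield" where
    fr: "smooth_fun A \<rho>" "\<rho> p = 1" "\<And>k. smooth_fun A (x k)" "\<And>k. vector_field A (Y k)"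
    "\<And>X. vector_field A X \<Longrightarrow> \<rho> \<odot> X = (\<Sum>k\<in>insert 0 Basis. X (x k) \<odot> Y k)"
    by (rule local_frame[of p]) blast
  let ?K = "insert 0 Basis :: 'e set"
  have trace_scale: "trace_at A (\<lambda>Z. \<sigma> \<odot> F Z) q = \<sigma> q * trace_at A F q"
    if F: "tensor11 A F" and \<sigma>: "smooth_fun A \<sigma>" for F \<sigma> q
  proof -
    obtain E where E: "orthonormal_frame_at A g q E" by (rule orthonormal_frame_exists)
    have "tensor11 A (\<lambda>Z. \<sigma> \<odot> F Z)"
      using F \<sigma> unfolding tensor11_def by (auto simp: fun_eq_iff algebra_simps)
    then show ?thesis
      using F \<sigma> orthonormal_frame_field[OF E]
      by (simp add: trace_at_orthonormal[OF E] g_linear sum_distrib_left)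
  qed
  \<comment> \<open>Since \<open>\<rho>\<close> is \<open>1\<close> only at \<open>p\<close>, the
    frame gives the trace near \<open>p\<close> up to this factor, and the derivative of
    \<open>\<rho>\<close> has to be accounted for.\<close>
  have tr: "\<rho> q * trace_at A F q = (\<Sum>k\<in>?K. F (Y k) (x k) q)" if F: "tensor11 A F" for F q
  proof -
    have "trace_at A (\<lambda>Z. \<rho> \<odot> F Z) q = (\<Sum>k\<in>?K. F (Y k) (x k) q)"
    proof (rule trace_at_finite_rank[where \<omega> = "\<lambda>k Z. Z (x k)" and W="\<lambda>k. F (Y k)"])
      fix Z h assume Z: "vector_field A Z"
      have "\<rho> \<odot> F Z = F (\<rho> \<odot> Z)" using F fr(1) Z by (simp add: tensor11_fmult[of F])
      also have "\<dots> = (\<Sum>k\<in>?K. Z (x k) \<odot> F (Y k))"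
        unfolding fr(5)[OF Z] using F Z fr(3,4) by (subst tensor11_sum[of F]) (auto simp: tensor11_fmult[of F])
      finally show "(\<rho> \<odot> F Z) h q = (\<Sum>k\<in>?K. Z (x k) q * F (Y k) h q)" by (simp add: sum_fun_apply)
    qed (use F fr in \<open>auto intro!: vf_one_form\<close>)
    then show ?thesis using trace_scale[OF F fr(1)] by simp
  qed
  let ?L = "\<lambda>Z. bracket X (F Z) - F (bracket X Z)"
  have L: "tensor11 A ?L"
    unfolding tensor11_def
    using F X by (auto simp: bracket_add_right bracket_fmult_right tensor11_add[of F] tensor11_fmult[of F]
        fun_eq_iff algebra_simps)
  have "X \<rho> p * trace_at A F p = (\<Sum>k\<in>?K. F (Y k) (X (x k)) p + F (bracket X (Y k)) (x k) p)"
  proof -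
    \<comment> \<open>The bracket of \<open>X\<close> with the frame identity. The summand
      \<open>\<rho> \<odot> bracket X Z\<close> is expanded by the same identity, which leaves the
      derivative of \<open>\<rho>\<close> as a finite-rank expression in \<open>Z\<close>.\<close>
    have id: "X \<rho> \<odot> Z = (\<Sum>k\<in>?K. Z (X (x k)) \<odot> Y k + Z (x k) \<odot> bracket X (Y k))"
      if Z: "vector_field A Z" for Z
    proof -
      have "X \<rho> \<odot> Z + \<rho> \<odot> bracket X Z = bracket X (\<rho> \<odot> Z)"
        using X Z fr(1) by (simp add: bracket_fmult_right)
      also have "\<dots> = (\<Sum>k\<in>?K. X (Z (x k)) \<odot> Y k + Z (x k) \<odot> bracket X (Y k))"
        unfolding fr(5)[OF Z] using X Z fr(3,4) by (subst bracket_sum_right) (auto simp: bracket_fmult_right)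
      finally have "X \<rho> \<odot> Z = (\<Sum>k\<in>?K. X (Z (x k)) \<odot> Y k + Z (x k) \<odot> bracket X (Y k))
          - (\<Sum>k\<in>?K. bracket X Z (x k) \<odot> Y k)"
        using fr(5)[of "bracket X Z"] X Z by (simp add: eq_diff_eq)
      also have "\<dots> = (\<Sum>k\<in>?K. Z (X (x k)) \<odot> Y k + Z (x k) \<odot> bracket X (Y k))"
        unfolding sum_subtractf[symmetric]
        by (intro sum.cong) (auto simp: fun_eq_iff bracket_apply algebra_simps)
      finally show ?thesis .
    qed
    \<comment> \<open>The identity \<open>id\<close> contains two families of one-forms,
      \<open>X (x k)\<close> and \<open>x k\<close> evaluated on; the disjoint sum of the index set
      with itself lists them as one family.\<close>
    have "trace_at A (\<lambda>Z. X \<rho> \<odot> F Z) p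
      = (\<Sum>k\<in>?K <+> ?K. (case_sum (\<lambda>k. F (Y k)) (\<lambda>k. F (bracket X (Y k))) k)
           (case_sum (\<lambda>k. X (x k)) x k) p)"
    proof (rule trace_at_finite_rank[where \<omega> = "\<lambda>k Z. Z (case_sum (\<lambda>k. X (x k)) x k)"
          and W="case_sum (\<lambda>k. F (Y k)) (\<lambda>k. F (bracket X (Y k)))"])
      fix Z h assume Z: "vector_field A Z"
      have "X \<rho> \<odot> F Z = F (X \<rho> \<odot> Z)" using F X fr(1) Z by (simp add: tensor11_fmult[of F])
      also have "\<dots> = (\<Sum>k\<in>?K. Z (X (x k)) \<odot> F (Y k) + Z (x k) \<odot> F (bracket X (Y k)))"
        unfolding id[OF Z] using F X Z fr(3,4)
        by (subst tensor11_sum[of F]) (auto simp: tensor11_fmult[of F] tensor11_add[of F])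
      finally show "(X \<rho> \<odot> F Z) h p = (\<Sum>k\<in>?K <+> ?K. Z (case_sum (\<lambda>k. X (x k)) x k) p *
          (case_sum (\<lambda>k. F (Y k)) (\<lambda>k. F (bracket X (Y k))) k) h p)"
        by (simp add: sum_fun_apply sum.Plus sum.distrib)
    qed (use F X fr in \<open>auto intro!: vf_one_form split: sum.split\<close>)
    then show ?thesis
      using trace_scale[OF F, of "X \<rho>" p] X fr(1) by (simp add: sum.Plus sum.distrib)
  qed
  moreover have "X \<rho> p * trace_at A F p + X (trace_at A F) p = (\<Sum>k\<in>?K. X (F (Y k) (x k)) p)"
  proof -
    have "\<rho> * trace_at A F = (\<Sum>k\<in>?K. F (Y k) (x k))"
      using tr[OF F] by (simp add: fun_eq_iff sum_fun_apply)
    then have "X (\<rho> * trace_at A F) p = X (\<Sum>k\<in>?K. F (Y k) (x k)) p" by simp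
    also have "X (\<Sum>k\<in>?K. F (Y k) (x k)) = (\<Sum>k\<in>?K. X (F (Y k) (x k)))"
      using F fr by (intro vf_sum[OF X]) auto
    finally show ?thesis using X fr(1,2) sm by (simp add: vf_mult'[of X] sum_fun_apply)
  qed
  moreover have "trace_at A ?L p = (\<Sum>k\<in>?K. X (F (Y k) (x k)) p - F (Y k) (X (x k)) p - F (bracket X (Y k)) (x k) p)"
    using tr[OF L, of p] fr(2) by (simp add: bracket_apply)
  ultimately show ?thesis by (simp add: sum.distrib sum_subtractf)
qed

end

section \<open>The curvature of the Levi-Civita connection\<close>

locale levi_civita_manifold = riemannian_manifold A g
  for A :: "('a::{t2_space, second_countable_topology}, 'e::euclidean_space) atlas" and g +
  fixes nabla :: "'a conn"
  assumes nabla_levi_civita: "levi_civita A g nabla"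
begin

abbreviation R :: "'a vfield \<Rightarrow> 'a vfield \<Rightarrow> 'a vfield \<Rightarrow> 'a vfield" where
  "R \<equiv> curvature nabla"

lemma nabla_connection: "connection A nabla"
  using nabla_levi_civita by (simp add: levi_civita_def)

lemma nabla_tensor: "vector_field A Y \<Longrightarrow> tensor11 A (\<lambda>X. nabla X Y)"
  using nabla_connection by (simp add: connection_def)

lemma nabla_field [simp]: "vector_field A X \<Longrightarrow> vector_field A Y \<Longrightarrow> vector_field A (nabla X Y)"
  using tensor11_field[OF nabla_tensor] .

lemma nabla_add_left: "vector_field A X \<Longrightarrow> vector_field A Y \<Longrightarrow> vector_field A Z
    \<Longrightarrow> nabla (X + Y) Z = nabla X Z + nabla Y Z"
  using tensor11_add[OF nabla_tensor] .

lemma nabla_diff_left: "vector_field A X \<Longrightarrow> vector_field A Y \<Longrightarrow> vector_field A Z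
    \<Longrightarrow> nabla (X - Y) Z = nabla X Z - nabla Y Z"
  using tensor11_diff[OF nabla_tensor] .

lemma nabla_uminus_left: "vector_field A X \<Longrightarrow> vector_field A Z \<Longrightarrow> nabla (- X) Z = - nabla X Z"
  using tensor11_uminus[OF nabla_tensor] .

lemma nabla_0_left: "vector_field A Z \<Longrightarrow> nabla 0 Z = 0"
  using tensor11_0[OF nabla_tensor] .

lemma nabla_fmult_left: "smooth_fun A h \<Longrightarrow> vector_field A X \<Longrightarrow> vector_field A Z
    \<Longrightarrow> nabla (h \<odot> X) Z = h \<odot> nabla X Z"
  using tensor11_fmult[OF nabla_tensor] .

lemma nabla_add_right: "vector_field A X \<Longrightarrow> vector_field A Y \<Longrightarrow> vector_field A Z
    \<Longrightarrow> nabla X (Y + Z) = nabla X Y + nabla X Z"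
  using nabla_connection by (simp add: connection_def)

lemma nabla_fmult_right: "smooth_fun A h \<Longrightarrow> vector_field A X \<Longrightarrow> vector_field A Y
    \<Longrightarrow> nabla X (h \<odot> Y) = X h \<odot> Y + h \<odot> nabla X Y"
  using nabla_connection by (simp add: connection_def)

lemma nabla_uminus_right:
  assumes "vector_field A X" "vector_field A Y" shows "nabla X (- Y) = - nabla X Y"
  using nabla_fmult_right[of "\<lambda>_. -1" X Y] assms by (simp add: fmult_minus_1 fun_eq_iff vf_const)

lemma nabla_diff_right: "vector_field A X \<Longrightarrow> vector_field A Y \<Longrightarrow> vector_field A Z
    \<Longrightarrow> nabla X (Y - Z) = nabla X Y - nabla X Z"
  using nabla_add_right[of X Y "- Z"] by (simp add: nabla_uminus_right)

lemma nabla_0_right: "vector_field A X \<Longrightarrow> nabla X 0 = 0"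
  using nabla_add_right[of X 0 0] by simp

lemma nabla_sum_right:
  "vector_field A X \<Longrightarrow> \<forall>i\<in>I. vector_field A (Y i) \<Longrightarrow> nabla X (\<Sum>i\<in>I. Y i) = (\<Sum>i\<in>I. nabla X (Y i))"
  by (induction I rule: infinite_finite_induct) (auto simp: nabla_add_right nabla_0_right)

lemmas nabla_linear = nabla_add_left nabla_diff_left nabla_uminus_left nabla_0_left nabla_fmult_left
  nabla_add_right nabla_fmult_right nabla_uminus_right nabla_diff_right nabla_0_right nabla_sum_right

lemma bracket_nabla: "vector_field A X \<Longrightarrow> vector_field A Y \<Longrightarrow> bracket X Y = nabla X Y - nabla Y X"
  using nabla_levi_civita by (simp add: levi_civita_def)

lemma vf_g: "vector_field A X \<Longrightarrow> vector_field A Y \<Longrightarrow> vector_field A Z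
    \<Longrightarrow> X (g Y Z) = g (nabla X Y) Z + g Y (nabla X Z)"
  using nabla_levi_civita unfolding levi_civita_def by blast

lemma R_field [simp]: "vector_field A X \<Longrightarrow> vector_field A Y \<Longrightarrow> vector_field A Z \<Longrightarrow> vector_field A (R X Y Z)"
  by (simp add: curvature_def)

lemma R_antisym: "vector_field A X \<Longrightarrow> vector_field A Y \<Longrightarrow> vector_field A Z \<Longrightarrow> R X Y Z = - R Y X Z"
  using nabla_uminus_left[of "bracket Y X" Z]
  by (simp add: curvature_def bracket_antisym[of X Y])

lemma R_add_3: "vector_field A X \<Longrightarrow> vector_field A Y \<Longrightarrow> vector_field A Z \<Longrightarrow> vector_field A W
    \<Longrightarrow> R X Y (Z + W) = R X Y Z + R X Y W"
  by (simp add: curvature_def nabla_linear)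

lemma R_fmult_3: "vector_field A X \<Longrightarrow> vector_field A Y \<Longrightarrow> vector_field A Z \<Longrightarrow> smooth_fun A h
    \<Longrightarrow> R X Y (h \<odot> Z) = h \<odot> R X Y Z"
  by (simp add: curvature_def nabla_linear fun_eq_iff bracket_apply algebra_simps)

lemma R_add_1: "vector_field A X \<Longrightarrow> vector_field A Y \<Longrightarrow> vector_field A Z \<Longrightarrow> vector_field A W
    \<Longrightarrow> R (X + W) Y Z = R X Y Z + R W Y Z"
  by (simp add: curvature_def bracket_nabla nabla_linear)

lemma R_fmult_1: "vector_field A X \<Longrightarrow> vector_field A Y \<Longrightarrow> vector_field A Z \<Longrightarrow> smooth_fun A h
    \<Longrightarrow> R (h \<odot> X) Y Z = h \<odot> R X Y Z"
  by (simp add: curvature_def bracket_nabla nabla_linear fun_eq_iff algebra_simps)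

lemma tensor11_R_1: "vector_field A X \<Longrightarrow> vector_field A Y \<Longrightarrow> tensor11 A (\<lambda>Z. R Z X Y)"
  by (simp add: tensor11_def R_add_1 R_fmult_1)

lemma tensor11_R_3: "vector_field A X \<Longrightarrow> vector_field A Y \<Longrightarrow> tensor11 A (\<lambda>Z. R X Y Z)"
  by (simp add: tensor11_def R_add_3 R_fmult_3)

text \<open>Metric compatibility expands the second derivatives of the function
  \<open>g Z W\<close>; on a function, the commutator of \<open>X\<close> and \<open>Y\<close> is
  exactly their bracket, so the curvature terms must cancel.\<close>

lemma R_skew:
  assumes "vector_field A X" "vector_field A Y" "vector_field A Z" "vector_field A W"
  shows "g (R X Y Z) W p = - g (R X Y W) Z p"
proof -
  have XY: "X (Y (g Z W)) p = g (nabla X (nabla Y Z)) W p + g (nabla Y Z) (nabla X W) p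
      + g (nabla X Z) (nabla Y W) p + g Z (nabla X (nabla Y W)) p"
    if "vector_field A X" "vector_field A Y" for X Y
    using assms that by (simp add: vf_g vf_add'[of X])
  have "bracket X Y (g Z W) p = g (nabla (bracket X Y) Z) W p + g Z (nabla (bracket X Y) W) p"
    using assms by (simp add: vf_g[of "bracket X Y"])
  then have "g (R X Y Z) W p + g Z (R X Y W) p = 0"
    using assms XY[of X Y] XY[of Y X] by (simp add: bracket_apply curvature_def g_linear)
  then show ?thesis using assms g_sym[of Z "R X Y W"] by simp
qed

text \<open>Group the second derivatives by their outer field. Vanishing torsion turns each group
  into an iterated bracket, and the sum is the Jacobi identity.\<close>

lemma first_Bianchi:
  assumes "vector_field A X" "vector_field A Y" "vector_field A Z"
  shows "R X Y Z + R Y Z X + R Z X Y = 0"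
proof -
  have tor: "nabla X (nabla Y Z) - nabla X (nabla Z Y) - nabla (bracket Y Z) X = bracket X (bracket Y Z)"
    if "vector_field A X" "vector_field A Y" "vector_field A Z" for X Y Z
  proof -
    have "nabla X (bracket Y Z) = nabla X (nabla Y Z) - nabla X (nabla Z Y)"
      using that by (simp add: bracket_nabla[of Y Z] nabla_linear)
    then show ?thesis using that by (simp add: bracket_nabla[of X "bracket Y Z"])
  qed
  have "R X Y Z + R Y Z X + R Z X Y
    = (nabla X (nabla Y Z) - nabla X (nabla Z Y) - nabla (bracket Y Z) X)
      + (nabla Y (nabla Z X) - nabla Y (nabla X Z) - nabla (bracket Z X) Y)
      + (nabla Z (nabla X Y) - nabla Z (nabla Y X) - nabla (bracket X Y) Z)"
    by (simp add: curvature_def algebra_simps)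
  also have "\<dots> = bracket X (bracket Y Z) + bracket Y (bracket Z X) + bracket Z (bracket X Y)"
    by (simp only: tor[OF assms] tor[OF assms(2,3,1)] tor[OF assms(3,1,2)])
  also have "bracket Y (bracket Z X) = - bracket Y (bracket X Z)"
    using bracket_fmult_right[of Y "bracket X Z" "\<lambda>_. -1"] assms
    by (simp add: fmult_minus_1 bracket_antisym[of Z X] fun_eq_iff vf_const)
  also have "bracket Z (bracket X Y) = - bracket (bracket X Y) Z" by (rule bracket_antisym)
  finally have "R X Y Z + R Y Z X + R Z X Y
    = bracket X (bracket Y Z) + - bracket Y (bracket X Z) + - bracket (bracket X Y) Z" .
  also have "\<dots> = 0" by (simp add: Jacobi_identity[OF assms])
  finally show ?thesis .
qed

text \<open>The octahedron argument: a linear consequence of four cyclic identities and of skewness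
  in the first and in the last pair of arguments.\<close>

lemma R_pair_sym:
  assumes "vector_field A X" "vector_field A Y" "vector_field A Z" "vector_field A W"
  shows "g (R X Y Z) W p = g (R Z W X) Y p"
proof -
  let ?r = "\<lambda>X Y Z W. g (R X Y Z) W p"
  have a1: "?r X Y Z W = - ?r Y X Z W"
    if "vector_field A X" "vector_field A Y" "vector_field A Z" "vector_field A W" for X Y Z W
    using that R_antisym[of X Y Z] by (simp add: g_linear)
  have cyc: "?r X Y Z W + ?r Y Z X W + ?r Z X Y W = 0"
    if "vector_field A X" "vector_field A Y" "vector_field A Z" "vector_field A W" for X Y Z W
  proof -
    have "g (R X Y Z + R Y Z X + R Z X Y) W p = 0"
      using first_Bianchi[of X Y Z] that by (simp add: g_0_left)
    then show ?thesis using that by (simp add: g_linear)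
  qed
  note v = assms
  show ?thesis
    using cyc[OF v(1,2,3,4)] cyc[OF v(2,3,4,1)] cyc[OF v(3,4,1,2)] cyc[OF v(4,1,2,3)]
      a1[OF v(1,2,3,4)] a1[OF v(2,3,4,1)] a1[OF v(3,4,1,2)] a1[OF v(4,1,2,3)]
      a1[OF v(3,1,2,4)] a1[OF v(4,2,1,3)] a1[OF v(3,1,4,2)] a1[OF v(4,2,3,1)]
      R_skew[OF v(1,2,3,4), of p] R_skew[OF v(2,3,4,1), of p] R_skew[OF v(3,4,1,2), of p] R_skew[OF v(4,1,2,3), of p]
      R_skew[OF v(3,1,2,4), of p] R_skew[OF v(4,2,1,3), of p] R_skew[OF v(2,4,3,1), of p] R_skew[OF v(1,3,4,2), of p]
      a1[OF v(1,3,4,2)] a1[OF v(2,4,3,1)] a1[OF v(1,3,2,4)] a1[OF v(2,4,1,3)]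
    by linarith
qed

lemma ricci_orthonormal:
  assumes "orthonormal_frame_at A g p E" "vector_field A X" "vector_field A Y"
  shows "ricci A nabla X Y p = (\<Sum>i<DIM('e). g (R (E i) X Y) (E i) p)"
  using trace_at_orthonormal[OF assms(1) tensor11_R_1[OF assms(2,3)]] by (simp add: ricci_def)

lemma ricci_sym:
  assumes "vector_field A X" "vector_field A Y"
  shows "ricci A nabla X Y p = ricci A nabla Y X p"
proof -
  obtain E where E: "orthonormal_frame_at A g p E" by (rule orthonormal_frame_exists)
  have "g (R (E i) X Y) (E i) p = g (R (E i) Y X) (E i) p" if "i < DIM('e)" for i
  proof -
    have v: "vector_field A (E i)" using orthonormal_frame_field[OF E that] .
    have "g (R (E i) X Y) (E i) p = g (R Y (E i) (E i)) X p" using assms v by (simp add: R_pair_sym)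
    also have "\<dots> = - g (R (E i) Y (E i)) X p"
      using assms v R_antisym[of Y "E i" "E i"] by (simp add: g_linear)
    also have "\<dots> = g (R (E i) Y X) (E i) p" using R_skew[of "E i" Y "E i" X p] assms v by simp
    finally show ?thesis .
  qed
  then show ?thesis using assms by (simp add: ricci_orthonormal[OF E])
qed

text \<open>Summing a product over the frame transfers \<open>F\<close> from \<open>E i\<close> to
  \<open>X\<close>. With \<open>F = f\<close> and \<open>X\<close> in the kernel of
  \<open>f\<close>, such a sum is zero; this kills many correction terms below.\<close>

lemma frame_contract:
  assumes E: "orthonormal_frame_at A g p E" and F: "tensor11 A F" and X: "vector_field A X" and W: "vector_field A W"
  shows "(\<Sum>i<DIM('e). g X (E i) p * g (F (E i)) W p) = g (F X) W p"
proof -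
  have "one_form A (\<lambda>Z. g (F Z) W)"
    using F W unfolding one_form_def by (auto simp: tensor11_add[of F] tensor11_fmult[of F] g_linear)
  from orthonormal_frame_expand[OF E this X] show ?thesis by simp
qed

end

section \<open>Weak \<open>\<beta>f\<close>-Kenmotsu manifolds with constant \<open>\<beta>\<close>\<close>

text \<open>Indices run over \<open>{1..s}\<close>; keeping \<open>1\<close> unrewritten lets the
  guards \<open>1 \<le> i\<close> of the rules for \<open>\<xi> i\<close> match.\<close>

declare One_nat_def [simp del]

locale weak_f_kenmotsu_const = weak_beta_f_kenmotsu A n s f Q \<xi> \<eta> g nabla "\<lambda>_. \<beta>"
  for A :: "('a::{t2_space, second_countable_topology}, 'e::euclidean_space) atlas"
    and n s f Q \<xi> \<eta> g nabla and \<beta> :: real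

sublocale weak_f_kenmotsu_const \<subseteq> levi_civita_manifold A g nabla
  using metric levi_civita by unfold_locales

context weak_f_kenmotsu_const
begin

abbreviation xb :: "'a vfield" where "xb \<equiv> xi_bar s \<xi>"

text \<open>Written with \<open>g\<close> so that its properties follow from the calculus of the
  metric; \<open>eta_eq\<close> gives the translation to \<open>\<eta> i\<close>.\<close>

definition P :: "'a vfield \<Rightarrow> 'a vfield" where
  "P X = X - (\<Sum>i=1..s. g X (\<xi> i) \<odot> \<xi> i)"

lemma xi_vf [simp]: "1 \<le> i \<Longrightarrow> i \<le> s \<Longrightarrow> vector_field A (\<xi> i)"
  using xi_field by simp

lemma xb_vf [simp]: "vector_field A xb"
  by (simp add: xi_bar_def)

lemma f_vf [simp]: "vector_field A X \<Longrightarrow> vector_field A (f X)"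
  using f_tensor by simp

lemma f_add: "vector_field A X \<Longrightarrow> vector_field A Y \<Longrightarrow> f (X + Y) = f X + f Y"
  using tensor11_add[OF f_tensor] .

lemma f_diff: "vector_field A X \<Longrightarrow> vector_field A Y \<Longrightarrow> f (X - Y) = f X - f Y"
  using tensor11_diff[OF f_tensor] .

lemma f_fmult: "smooth_fun A h \<Longrightarrow> vector_field A X \<Longrightarrow> f (h \<odot> X) = h \<odot> f X"
  using tensor11_fmult[OF f_tensor] .

lemma f_0: "f 0 = 0"
  using tensor11_0[OF f_tensor] .

lemma f_sum: "\<forall>i\<in>I. vector_field A (X i) \<Longrightarrow> f (\<Sum>i\<in>I. X i) = (\<Sum>i\<in>I. f (X i))"
  using tensor11_sum[OF f_tensor, of I X] by simp

lemma Q_vf [simp]: "vector_field A X \<Longrightarrow> vector_field A (Q X)"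
  using Q_tensor by simp

lemma g_xi_xi: "1 \<le> i \<Longrightarrow> i \<le> s \<Longrightarrow> 1 \<le> j \<Longrightarrow> j \<le> s \<Longrightarrow> g (\<xi> i) (\<xi> j) p = (if i = j then 1 else 0)"
  using xi_orthonormal[of i j] by simp

lemma eta_xi: "1 \<le> i \<Longrightarrow> i \<le> s \<Longrightarrow> 1 \<le> j \<Longrightarrow> j \<le> s \<Longrightarrow> \<eta> i (\<xi> j) p = (if i = j then 1 else 0)"
  using eta_dual[of i j] by simp

lemma sum_delta_left: "1 \<le> i \<Longrightarrow> i \<le> s \<Longrightarrow> (\<Sum>j=1..s. c j * (if j = i then 1 else 0)) = (c i :: real)"
  by (simp add: if_distrib cong: if_cong)

text \<open>Compatibility on the pair (\<xi> i, \<xi> i) gives the squared length 1 - 1 = 0, and the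
  metric is definite.\<close>

lemma f_xi:
  assumes "1 \<le> i" "i \<le> s" shows "f (\<xi> i) = 0"
proof (intro ext)
  fix h p
  have "(\<Sum>j=1..s. \<eta> j (\<xi> i) p * \<eta> j (\<xi> i) p) = (\<Sum>j=1..s. \<eta> j (\<xi> i) p * (if j = i then 1 else 0))"
    using assms by (intro sum.cong) (auto simp: eta_xi)
  also have "\<dots> = 1" using assms by (simp add: sum_delta_left eta_xi)
  finally have "g (f (\<xi> i)) (f (\<xi> i)) p = 0"
    using assms by (simp add: compatible Q_xi g_xi_xi sum_fun_apply)
  then have "f (\<xi> i) h p = 0" using assms by (intro g_eq_0D[of "f (\<xi> i)"]) auto
  then show "f (\<xi> i) h p = 0 h p" by simp
qed

text \<open>Compatibility with second argument \<xi> i: the left-hand side vanishes because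
  \<open>f (\<xi> i) = 0\<close>.\<close>

lemma eta_eq:
  assumes "1 \<le> i" "i \<le> s" "vector_field A X" shows "\<eta> i X = g X (\<xi> i)"
proof
  fix p
  have "g (f X) (f (\<xi> i)) p = g X (\<xi> i) p - (\<Sum>j=1..s. \<eta> j X p * \<eta> j (\<xi> i) p)"
    using assms by (simp add: compatible Q_xi sum_fun_apply)
  also have "(\<Sum>j=1..s. \<eta> j X p * \<eta> j (\<xi> i) p) = (\<Sum>j=1..s. \<eta> j X p * (if j = i then 1 else 0))"
    using assms by (intro sum.cong) (auto simp: eta_xi)
  also have "\<dots> = \<eta> i X p" using assms by (simp only: sum_delta_left)
  finally have "g (f X) 0 p = g X (\<xi> i) p - \<eta> i X p" by (simp only: f_xi[OF assms(1,2)])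
  then show "\<eta> i X p = g X (\<xi> i) p" using assms by (simp add: g_0_right)
qed

lemma f_xb: "f xb = 0"
  by (simp add: xi_bar_def f_sum f_xi)

lemma eta_bar_eq: "vector_field A X \<Longrightarrow> eta_bar s \<eta> X = g X xb"
  by (simp add: eta_bar_def xi_bar_def g_linear eta_eq)

lemma g_f_xi: "1 \<le> i \<Longrightarrow> i \<le> s \<Longrightarrow> vector_field A X \<Longrightarrow> g (f X) (\<xi> i) = 0"
  by (simp add: f_skew f_xi g_0_right)

lemma g_f_xb: "vector_field A X \<Longrightarrow> g (f X) xb = 0"
  by (simp add: f_skew f_xb g_0_right)

lemma g_xi_xb: "1 \<le> i \<Longrightarrow> i \<le> s \<Longrightarrow> g (\<xi> i) xb = (\<lambda>_. 1)"
proof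
  fix p
  assume i: "1 \<le> i" "i \<le> s"
  have "g (\<xi> i) xb p = (\<Sum>j=1..s. g (\<xi> i) (\<xi> j) p)"
    using i by (simp add: xi_bar_def g_linear sum_fun_apply)
  also have "\<dots> = (\<Sum>j=1..s. 1 * (if j = i then 1 else 0))"
    using i by (intro sum.cong) (auto simp: g_xi_xi)
  finally show "g (\<xi> i) xb p = 1" using i by (simp only: sum_delta_left)
qed

lemma g_xb_xb: "g xb xb = (\<lambda>_. real s)"
proof
  fix p
  have "g xb xb p = (\<Sum>i=1..s. g (\<xi> i) xb p)"
    by (subst xi_bar_def) (simp add: g_linear sum_fun_apply)
  then show "g xb xb p = real s" by (simp add: g_xi_xb)
qed

lemma P_vf [simp]: "vector_field A X \<Longrightarrow> vector_field A (P X)"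
  by (simp add: P_def)

lemma tensor11_P: "tensor11 A P"
  unfolding tensor11_def
  by (auto simp: P_def g_linear fun_eq_iff sum_fun_apply sum.distrib algebra_simps sum_distrib_left)

lemma P_diff: "vector_field A X \<Longrightarrow> vector_field A Y \<Longrightarrow> P (X - Y) = P X - P Y"
  using tensor11_diff[OF tensor11_P] .

lemma P_fmult: "smooth_fun A h \<Longrightarrow> vector_field A X \<Longrightarrow> P (h \<odot> X) = h \<odot> P X"
  using tensor11_fmult[OF tensor11_P] .

lemma P_sum: "\<forall>i\<in>I. vector_field A (X i) \<Longrightarrow> P (\<Sum>i\<in>I. X i) = (\<Sum>i\<in>I. P (X i))"
  using tensor11_sum[OF tensor11_P, of I X] by simp

lemma P_xi: assumes "1 \<le> i" "i \<le> s" shows "P (\<xi> i) = 0"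
proof (intro ext)
  fix h p
  have "(\<Sum>j=1..s. g (\<xi> i) (\<xi> j) p * \<xi> j h p) = (\<Sum>j=1..s. \<xi> j h p * (if j = i then 1 else 0))"
    using assms by (intro sum.cong) (auto simp: g_xi_xi)
  then show "P (\<xi> i) h p = 0 h p" using assms by (simp add: P_def sum_fun_apply sum_delta_left)
qed

lemma P_xb: "P xb = 0"
  by (simp add: xi_bar_def P_sum P_xi)

lemma g_P_left: "vector_field A X \<Longrightarrow> vector_field A Y \<Longrightarrow> g (P X) Y p = g X Y p - (\<Sum>i=1..s. g X (\<xi> i) p * g Y (\<xi> i) p)"
proof -
  assume XY: "vector_field A X" "vector_field A Y"
  have "(\<Sum>i=1..s. g X (\<xi> i) p * g (\<xi> i) Y p) = (\<Sum>i=1..s. g X (\<xi> i) p * g Y (\<xi> i) p)"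
    using XY by (intro sum.cong) (auto simp: g_sym[of Y])
  then show ?thesis using XY by (simp add: P_def g_linear sum_fun_apply)
qed

lemma g_P_sym: "vector_field A X \<Longrightarrow> vector_field A Y \<Longrightarrow> g (P X) Y = g X (P Y)"
  by (simp add: fun_eq_iff g_P_left g_sym[of X "P Y"] g_sym[of Y X] mult.commute)

lemma g_P_xi: "1 \<le> i \<Longrightarrow> i \<le> s \<Longrightarrow> vector_field A X \<Longrightarrow> g (P X) (\<xi> i) = 0"
  by (simp add: g_P_sym P_xi g_0_right)

lemma g_P_xb: "vector_field A X \<Longrightarrow> g (P X) xb = 0"
  by (simp add: g_P_sym P_xb g_0_right)

lemma P_id: "(\<And>i. 1 \<le> i \<Longrightarrow> i \<le> s \<Longrightarrow> g X (\<xi> i) = 0) \<Longrightarrow> P X = X"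
  by (simp add: P_def fun_eq_iff sum_fun_apply)

lemma P_P: "vector_field A X \<Longrightarrow> P (P X) = P X"
  by (rule P_id) (simp add: g_P_xi)

lemma P_f: "vector_field A X \<Longrightarrow> P (f X) = f X"
  by (rule P_id) (simp add: g_f_xi)

lemma f_P: "vector_field A X \<Longrightarrow> f (P X) = f X"
  by (simp add: P_def f_diff f_sum f_fmult f_xi fun_eq_iff sum_fun_apply)

text \<open>On \<D> the square of \<open>f\<close> is \<open>- Q\<close>, which is injective at
  every point.\<close>

lemma P_eq_0:
  assumes X: "vector_field A X" and "f X = 0" shows "P X = 0"
proof (intro ext)
  fix h p
  have "f (f (P X)) = - Q (P X) + (\<Sum>i=1..s. \<eta> i (P X) \<odot> \<xi> i)" using X by (simp add: f_square)
  moreover have "(\<Sum>i=1..s. \<eta> i (P X) \<odot> \<xi> i) = 0"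
    using X by (simp add: eta_eq g_P_xi fun_eq_iff sum_fun_apply)
  moreover have "f (f (P X)) = 0" using assms by (simp add: f_P f_0)
  ultimately have "Q (P X) = 0" by simp
  then have "value_at (P X) p = 0" using X
    by (intro Q_nonsingular[of "P X" p, OF P_vf]) (auto simp: value_at_def fun_eq_iff)
  then show "P X h p = 0 h p" by (simp add: value_at_def fun_eq_iff)
qed

section \<open>Covariant derivatives of the structure and the curvature along \<xi> i\<close>

lemma nabla_f': "vector_field A X \<Longrightarrow> vector_field A Y \<Longrightarrow>
    nabla X (f Y) = f (nabla X Y) + (\<lambda>_. \<beta>) \<odot> (g (f X) Y \<odot> xb - g Y xb \<odot> f X)"
  using nabla_f[of X Y] by (simp add: eta_bar_eq diff_eq_eq add.commute)

text \<open>The image of \<open>f\<close> is orthogonal to \<xi> i, so of the Nijenhuis tensor only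
  the bracket of \<open>f X\<close> and \<open>f Y\<close> survives the product with \<xi>
  i.\<close>

lemma normal_d_eta:
  assumes "1 \<le> i" "i \<le> s" "vector_field A X" "vector_field A Y"
  shows "g (bracket (f X) (f Y)) (\<xi> i) p + 2 * ext_deriv (\<eta> i) X Y p = 0"
proof -
  have "(\<lambda>p. 2 * ext_deriv (\<eta> j) X Y p) = (\<lambda>p. X (\<eta> j Y) p - Y (\<eta> j X) p - \<eta> j (bracket X Y) p)" for j
    by (simp add: ext_deriv_def fun_eq_iff field_simps)
  then have sm: "smooth_fun A (\<lambda>p. 2 * ext_deriv (\<eta> j) X Y p)" if "1 \<le> j" "j \<le> s" for j
    using that assms by (simp add: eta_eq)
  have "nijenhuis f X Y + (\<Sum>j=1..s. (\<lambda>p. 2 * ext_deriv (\<eta> j) X Y p) \<odot> \<xi> j) = 0"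
    using normal assms by (simp add: normal_structure_def)
  then have "g (nijenhuis f X Y + (\<Sum>j=1..s. (\<lambda>p. 2 * ext_deriv (\<eta> j) X Y p) \<odot> \<xi> j)) (\<xi> i) p = 0"
    using assms by (simp add: g_0_left)
  then have "g (bracket (f X) (f Y)) (\<xi> i) p
      + (\<Sum>j=1..s. 2 * ext_deriv (\<eta> j) X Y p * g (\<xi> j) (\<xi> i) p) = 0"
    using assms sm by (simp add: nijenhuis_def g_linear g_f_xi sum_fun_apply)
  moreover have "(\<Sum>j=1..s. 2 * ext_deriv (\<eta> j) X Y p * g (\<xi> j) (\<xi> i) p)
      = (\<Sum>j=1..s. 2 * ext_deriv (\<eta> j) X Y p * (if j = i then 1 else 0))"
    using assms by (intro sum.cong) (auto simp: g_xi_xi)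
  ultimately show ?thesis using assms by (simp only: sum_delta_left)
qed

text \<open>The \<D>-part comes from the derivative of \<open>f\<close> at \<xi> i: it says that
  \<open>f\<close> kills \<open>nabla X (\<xi> i) - \<beta> X\<close>. That equation does not see
  the components along the \<xi> k; these are excluded by normality together with
  orthonormality.\<close>

lemma nabla_xi:
  assumes i: "1 \<le> i" "i \<le> s" and X: "vector_field A X"
  shows "nabla X (\<xi> i) = (\<lambda>_. \<beta>) \<odot> P X"
proof -
  have Pn: "P (nabla X (\<xi> i)) = (\<lambda>_. \<beta>) \<odot> P X"
    if i: "1 \<le> i" "i \<le> s" and X: "vector_field A X" for i X
  proof -
    have "nabla X (f (\<xi> i)) = f (nabla X (\<xi> i)) + (\<lambda>_. \<beta>) \<odot> (g (f X) (\<xi> i) \<odot> xb - g (\<xi> i) xb \<odot> f X)"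
      using i X by (simp add: nabla_f')
    then have "f (nabla X (\<xi> i)) = (\<lambda>_. \<beta>) \<odot> f X"
      using i X by (simp add: f_xi nabla_0_right g_f_xi g_xi_xb fun_eq_iff)
    then have "f (nabla X (\<xi> i) - (\<lambda>_. \<beta>) \<odot> X) = 0" using i X by (simp add: f_diff f_fmult)
    then have "P (nabla X (\<xi> i) - (\<lambda>_. \<beta>) \<odot> X) = 0" using i X by (intro P_eq_0) auto
    then show ?thesis using i X by (simp add: P_diff P_fmult)
  qed
  have anti: "g (nabla X (\<xi> i)) (\<xi> j) p = - g (nabla X (\<xi> j)) (\<xi> i) p"
    if ij: "1 \<le> i" "i \<le> s" "1 \<le> j" "j \<le> s" and X: "vector_field A X" for i j X p
  proof -
    have "X (g (\<xi> i) (\<xi> j)) p = 0" using xi_orthonormal[of i j] ij X by (simp add: vf_const)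
    then show ?thesis using ij X g_sym[of "\<xi> i" "nabla X (\<xi> j)"] by (simp add: vf_g)
  qed
  \<comment> \<open>Normality with \<open>f (\<xi> k) = 0\<close> makes d(\<eta> i) vanish whenever
    one argument is \<xi> k; rewritten with the connection, this exchanges the direction of
    differentiation.\<close>
  have d0: "g Y (nabla (\<xi> k) (\<xi> i)) p = - g (nabla Y (\<xi> k)) (\<xi> i) p"
    if ik: "1 \<le> i" "i \<le> s" "1 \<le> k" "k \<le> s" and Y: "vector_field A Y" for i k Y p
  proof -
    have "bracket 0 Z = 0" if "vector_field A Z" for Z using that by (simp add: bracket_def fun_eq_iff vf_zero)
    then have "ext_deriv (\<eta> i) (\<xi> k) Y p = 0"
      using normal_d_eta[of i "\<xi> k" Y p] ik Y by (simp add: f_xi g_0_left)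
    then have "\<xi> k (g Y (\<xi> i)) p - Y (g (\<xi> k) (\<xi> i)) p - g (bracket (\<xi> k) Y) (\<xi> i) p = 0"
      using ik Y by (simp add: ext_deriv_def eta_eq)
    moreover have "Y (g (\<xi> k) (\<xi> i)) p = 0" using xi_orthonormal[of k i] ik Y by (simp add: vf_const)
    ultimately show ?thesis using ik Y by (simp add: vf_g[of "\<xi> k"] bracket_nabla g_linear)
  qed
  \<comment> \<open>As in the uniqueness part of the Koszul formula: an array that is skew in its
    first two indices and symmetric in its last two is zero.\<close>
  have zero: "g (nabla (\<xi> k) (\<xi> i)) (\<xi> j) p = 0"
    if "1 \<le> i" "i \<le> s" "1 \<le> j" "j \<le> s" "1 \<le> k" "k \<le> s" for i j k p
  proof -
    let ?t = "\<lambda>i j k. g (nabla (\<xi> k) (\<xi> i)) (\<xi> j) p"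
    have s: "?t i j k = ?t i k j"
      if "1 \<le> i" "i \<le> s" "1 \<le> j" "j \<le> s" "1 \<le> k" "k \<le> s" for i j k
      using d0[of i k "\<xi> j" p] anti[of i k "\<xi> j" p] that g_sym[of "\<xi> j" "nabla (\<xi> k) (\<xi> i)"] by simp
    have a: "?t i j k = - ?t j i k"
      if "1 \<le> i" "i \<le> s" "1 \<le> j" "j \<le> s" "1 \<le> k" "k \<le> s" for i j k
      using anti[of i j "\<xi> k" p] that by simp
    show ?thesis
      using s[of i j k] a[of i k j] s[of k i j] a[of k j i] s[of j k i] a[of j i k] that by linarith
  qed
  have "nabla (\<xi> k) (\<xi> i) = 0" if k: "1 \<le> k" "k \<le> s" for k
  proof -
    have "P (nabla (\<xi> k) (\<xi> i)) = nabla (\<xi> k) (\<xi> i)"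
      using zero[of i] i k by (intro P_id) (auto simp: fun_eq_iff)
    then show ?thesis using Pn[of i "\<xi> k"] i k by (simp add: P_xi fun_eq_iff)
  qed
  \<comment> \<open>\<open>d0\<close> and skewness replace the direction \<open>X\<close> by \<xi>
    k, in which the derivative has just been shown to vanish.\<close>
  then have "g (nabla X (\<xi> i)) (\<xi> k) p = 0" if "1 \<le> k" "k \<le> s" for k p
    using d0[of k i X p] anti[of i k X p] d0[of i k X p] i X that by (simp add: g_0_right)
  then have "P (nabla X (\<xi> i)) = nabla X (\<xi> i)" by (intro P_id) (auto simp: fun_eq_iff)
  then show ?thesis using Pn[OF i X] by simp
qed

lemma nabla_xb: "vector_field A X \<Longrightarrow> nabla X xb = (\<lambda>_. real s * \<beta>) \<odot> P X"
  by (simp add: xi_bar_def nabla_sum_right nabla_xi fun_eq_iff sum_fun_apply)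

lemma nabla_P:
  assumes X: "vector_field A X" and Y: "vector_field A Y"
  shows "nabla X (P Y) = P (nabla X Y) - (\<lambda>_. \<beta>) \<odot> (g (P X) Y \<odot> xb + g Y xb \<odot> P X)"
proof -
  have "nabla X (P Y) = nabla X Y - (\<Sum>i=1..s. nabla X (g Y (\<xi> i) \<odot> \<xi> i))"
    using X Y by (simp add: P_def nabla_linear)
  also have "(\<Sum>i=1..s. nabla X (g Y (\<xi> i) \<odot> \<xi> i))
    = (\<Sum>i=1..s. g (nabla X Y) (\<xi> i) \<odot> \<xi> i + (\<lambda>_. \<beta>) \<odot> (g (P X) Y \<odot> \<xi> i + g Y (\<xi> i) \<odot> P X))"
  proof (rule sum.cong)
    fix i assume "i \<in> {1..s}"
    then have i: "1 \<le> i" "i \<le> s" by auto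
    show "nabla X (g Y (\<xi> i) \<odot> \<xi> i)
      = g (nabla X Y) (\<xi> i) \<odot> \<xi> i + (\<lambda>_. \<beta>) \<odot> (g (P X) Y \<odot> \<xi> i + g Y (\<xi> i) \<odot> P X)"
      using i X Y by (simp add: nabla_fmult_right vf_g nabla_xi g_linear g_sym[of Y "P X"] fun_eq_iff algebra_simps)
  qed simp
  also have "\<dots> = (\<Sum>i=1..s. g (nabla X Y) (\<xi> i) \<odot> \<xi> i) + (\<lambda>_. \<beta>) \<odot> (g (P X) Y \<odot> xb + g Y xb \<odot> P X)"
    using Y by (simp add: xi_bar_def g_linear fun_eq_iff sum_fun_apply sum.distrib
        distrib_left sum_distrib_left sum_distrib_right)
  finally have "nabla X (P Y) = nabla X Y - ((\<Sum>i=1..s. g (nabla X Y) (\<xi> i) \<odot> \<xi> i)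
      + (\<lambda>_. \<beta>) \<odot> (g (P X) Y \<odot> xb + g Y xb \<odot> P X))" .
  then show ?thesis unfolding P_def[of "nabla X Y"] by (simp only: diff_diff_add)
qed

text \<open>Since \<xi> i has derivative \<beta> \<open>P\<close>, the curvature is \<beta> times
  the antisymmetrised derivative of \<open>P\<close>; the part of that derivative along
  \<open>xb\<close> is symmetric in \<open>X\<close> and \<open>Y\<close> and drops out.\<close>

lemma R_xi:
  assumes "1 \<le> i" "i \<le> s" "vector_field A X" "vector_field A Y"
  shows "R X Y (\<xi> i) = (\<lambda>_. \<beta>\<^sup>2) \<odot> (g X xb \<odot> P Y - g Y xb \<odot> P X)"
proof -
  have "g (P Y) X = g (P X) Y" using assms by (simp add: g_P_sym g_sym[of Y "P X"])
  then show ?thesis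
    using assms by (simp add: curvature_def nabla_xi nabla_linear nabla_P bracket_nabla P_diff
        fun_eq_iff power2_eq_square vf_const algebra_simps)
qed

lemma R_xi_1:
  assumes i: "1 \<le> i" "i \<le> s" and X: "vector_field A X" and Y: "vector_field A Y"
  shows "R (\<xi> i) X Y = (\<lambda>_. \<beta>\<^sup>2) \<odot> (g Y xb \<odot> P X - g (P X) Y \<odot> xb)"
proof (rule vector_field_eqI)
  fix W p assume W: "vector_field A W"
  have "g (R (\<xi> i) X Y) W p = g (R Y W (\<xi> i)) X p" using i X Y W by (simp add: R_pair_sym)
  then show "g (R (\<xi> i) X Y) W p = g ((\<lambda>_. \<beta>\<^sup>2) \<odot> (g Y xb \<odot> P X - g (P X) Y \<odot> xb)) W p"
    using i X Y W by (simp add: R_xi g_linear g_P_sym g_sym[of W "P X"] g_sym[of Y "P X"] g_sym[of xb W])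
qed (use i X Y in auto)

section \<open>Lie derivatives of the structure along \<xi> i\<close>

lemma bracket_xi_f:
  assumes "1 \<le> i" "i \<le> s" "vector_field A X"
  shows "bracket (\<xi> i) (f X) = f (bracket (\<xi> i) X)"
  using assms by (simp add: bracket_nabla nabla_f' nabla_xi f_diff f_fmult P_f f_P f_xi g_0_left fun_eq_iff)

lemma bracket_xi_P:
  assumes "1 \<le> i" "i \<le> s" "vector_field A X"
  shows "bracket (\<xi> i) (P X) = P (bracket (\<xi> i) X)"
  using assms by (simp add: bracket_nabla nabla_P nabla_xi P_diff P_fmult P_P P_xi g_0_left fun_eq_iff)

lemma vf_xi_g:
  assumes "1 \<le> i" "i \<le> s" "vector_field A X" "vector_field A Y"
  shows "\<xi> i (g X Y) p = g (bracket (\<xi> i) X) Y p + g X (bracket (\<xi> i) Y) p + 2 * \<beta> * g (P X) Y p"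
  using assms by (simp add: vf_g bracket_nabla nabla_xi g_linear g_P_sym)

text \<open>The Lie derivative of the connection is the curvature term
  \<open>R (\<xi> i) X Y\<close> plus the second covariant derivative of \<xi> i. Both are explicit:
  their \<open>P X\<close> parts cancel and their \<open>xb\<close> parts add up.\<close>

lemma bracket_xi_nabla:
  assumes i: "1 \<le> i" "i \<le> s" and X: "vector_field A X" and Y: "vector_field A Y"
  shows "bracket (\<xi> i) (nabla X Y) = nabla (bracket (\<xi> i) X) Y + nabla X (bracket (\<xi> i) Y)
    - (\<lambda>_. 2 * \<beta>\<^sup>2) \<odot> (g (P X) Y \<odot> xb)"
proof -
  have 1: "nabla (\<xi> i) (nabla X Y) = R (\<xi> i) X Y + nabla X (nabla (\<xi> i) Y) + nabla (bracket (\<xi> i) X) Y"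
    by (simp add: curvature_def)
  have 2: "bracket (\<xi> i) (nabla X Y) = nabla (\<xi> i) (nabla X Y) - (\<lambda>_. \<beta>) \<odot> P (nabla X Y)"
    using i X Y by (simp add: bracket_nabla[of "\<xi> i" "nabla X Y"] nabla_xi)
  have 3: "nabla X (bracket (\<xi> i) Y) = nabla X (nabla (\<xi> i) Y) - (\<lambda>_. \<beta>) \<odot> nabla X (P Y)"
    using i X Y by (simp add: bracket_nabla[of "\<xi> i" Y] nabla_xi nabla_linear fun_eq_iff vf_const)
  show ?thesis
    unfolding 2 3 unfolding 1 R_xi_1[OF i X Y] nabla_P[OF X Y]
    by (simp add: fun_eq_iff power2_eq_square algebra_simps)
qed


text \<open>Applying \<open>bracket_xi_nabla\<close> to every connection term leaves, beyond the
  Leibniz rule, the antisymmetrised derivative of the correction term found there. The factor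
  \<open>s\<close> arises from differentiating \<open>xb\<close>, a sum of \<open>s\<close> fields
  each with derivative \<beta> \<open>P\<close>.\<close>

lemma bracket_xi_R:
  assumes i: "1 \<le> i" "i \<le> s" and X: "vector_field A X" and Y: "vector_field A Y" and Z: "vector_field A Z"
  shows "bracket (\<xi> i) (R X Y Z) = R (bracket (\<xi> i) X) Y Z + R X (bracket (\<xi> i) Y) Z + R X Y (bracket (\<xi> i) Z)
    + (\<lambda>_. 2 * \<beta> ^ 3) \<odot> ((g Y xb * g (P X) Z - g X xb * g (P Y) Z) \<odot> xb
      - (\<lambda>_. real s) \<odot> (g (P Y) Z \<odot> P X - g (P X) Z \<odot> P Y))"
proof -
  let ?c = "\<lambda>_. 2 * \<beta>\<^sup>2"
  let ?b = "bracket (\<xi> i)"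
  have second: "?b (nabla X (nabla Y Z)) = nabla (?b X) (nabla Y Z) + nabla X (nabla (?b Y) Z)
      + nabla X (nabla Y (?b Z))
      - ?c \<odot> ((g (nabla X (P Y)) Z + g (P Y) (nabla X Z) + g (P X) (nabla Y Z)) \<odot> xb + g (P Y) Z \<odot> nabla X xb)"
    if "vector_field A X" "vector_field A Y" for X Y
    using i that Z by (simp add: bracket_xi_nabla nabla_linear vf_g fun_eq_iff vf_const algebra_simps)
  have sym: "g (P Y) X = g (P X) Y" using X Y by (simp add: g_P_sym g_sym[of Y "P X"])
  have J: "?b (bracket X Y) = bracket (?b X) Y + bracket X (?b Y)"
    using i X Y by (intro Jacobi_identity) auto
  have third: "?b (nabla (bracket X Y) Z) = nabla (bracket (?b X) Y) Z + nabla (bracket X (?b Y)) Z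
      + nabla (bracket X Y) (?b Z) - ?c \<odot> ((g (P (nabla X Y)) Z - g (P (nabla Y X)) Z) \<odot> xb)"
  proof -
    have "g (P (bracket X Y)) Z = g (P (nabla X Y)) Z - g (P (nabla Y X)) Z"
      using X Y Z by (simp add: bracket_nabla P_diff g_linear)
    then show ?thesis using i X Y Z J by (simp add: bracket_xi_nabla nabla_add_left)
  qed
  have "?b (R X Y Z) = ?b (nabla X (nabla Y Z)) - ?b (nabla Y (nabla X Z)) - ?b (nabla (bracket X Y) Z)"
    using i X Y Z by (simp add: curvature_def bracket_diff_right)
  then show ?thesis
    unfolding second[OF X Y] second[OF Y X] third
    using X Y Z sym
    by (simp add: curvature_def nabla_P nabla_xb g_linear g_sym[of xb Z] fun_eq_iff
        power2_eq_square power3_eq_cube algebra_simps)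
qed

section \<open>Frame sums and the star-Ricci tensor\<close>

lemma frame_parseval:
  assumes "orthonormal_frame_at A g p E" "vector_field A X" "vector_field A W"
  shows "(\<Sum>i<DIM('e). g X (E i) p * g (E i) W p) = g X W p"
  using frame_contract[OF assms(1) tensor11_id assms(2,3)] .

text \<open>By Parseval each unit field \<xi> j takes away exactly 1 from the trace of the identity,
  and the dimension is 2n + s.\<close>

lemma trace_P:
  assumes E: "orthonormal_frame_at A g p E"
  shows "(\<Sum>i<DIM('e). g (P (E i)) (E i) p) = 2 * real n"
proof -
  have v: "vector_field A (E i)" if "i < DIM('e)" for i using orthonormal_frame_field[OF E that] .
  have "(\<Sum>i<DIM('e). g (P (E i)) (E i) p)
      = (\<Sum>i<DIM('e). 1 - (\<Sum>j=1..s. g (\<xi> j) (E i) p * g (E i) (\<xi> j) p))"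
  proof (rule sum.cong)
    fix i assume "i \<in> {..<DIM('e)}"
    then have i: "i < DIM('e)" by simp
    have "(\<Sum>j=1..s. g (E i) (\<xi> j) p * g (E i) (\<xi> j) p) = (\<Sum>j=1..s. g (\<xi> j) (E i) p * g (E i) (\<xi> j) p)"
      using v[OF i] by (intro sum.cong) (auto simp: g_sym[of "E i"])
    then show "g (P (E i)) (E i) p = 1 - (\<Sum>j=1..s. g (\<xi> j) (E i) p * g (E i) (\<xi> j) p)"
      using v[OF i] orthonormal_frame_g[OF E i i] by (simp add: g_P_left)
  qed simp
  also have "\<dots> = real DIM('e) - (\<Sum>j=1..s. \<Sum>i<DIM('e). g (\<xi> j) (E i) p * g (E i) (\<xi> j) p)"
    by (subst sum.swap) (simp add: sum_subtractf)
  also have "(\<Sum>j=1..s. \<Sum>i<DIM('e). g (\<xi> j) (E i) p * g (E i) (\<xi> j) p) = (\<Sum>j=1..s. 1)"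
    by (intro sum.cong) (auto simp: frame_parseval[OF E] g_xi_xi)
  finally show ?thesis using dim_M by simp
qed

text \<open>Supplies a test vector: an equation between multiples of \<open>g (P Z) Z\<close> can be
  cancelled to one between scalars. It exists because the trace of \<open>P\<close> is
  positive.\<close>

lemma horizontal_exists:
  obtains Z where "vector_field A Z" "g (P Z) Z p \<noteq> 0"
proof -
  obtain E where E: "orthonormal_frame_at A g p E" by (rule orthonormal_frame_exists)
  have "(\<Sum>i<DIM('e). g (P (E i)) (E i) p) \<noteq> 0" using trace_P[OF E] n_pos by simp
  then obtain i where "i \<in> {..<DIM('e)}" "g (P (E i)) (E i) p \<noteq> 0" by (rule sum.not_neutral_contains_not_neutral)
  then show ?thesis using that[of "E i"] orthonormal_frame_field[OF E] by simp
qed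

lemma tensor11_R_f: "vector_field A X \<Longrightarrow> vector_field A Y \<Longrightarrow> tensor11 A (\<lambda>Z. R X (f Y) (f Z))"
  by (simp add: tensor11_def f_add f_fmult R_add_3 R_fmult_3)

lemma star_ricci_orthonormal:
  assumes "orthonormal_frame_at A g p E" "vector_field A X" "vector_field A Y"
  shows "star_ricci A f nabla X Y p = (\<Sum>i<DIM('e). g (R X (f Y) (f (E i))) (E i) p) / 2"
  using trace_at_orthonormal[OF assms(1) tensor11_R_f[OF assms(2,3)]] by (simp add: star_ricci_def)

text \<open>As \<open>f\<close> is invariant along \<xi> i, the only defect in the Leibniz rule is
  that of the curvature. Its \<open>xb\<close> part is traced away by \<open>f xb = 0\<close>, and
  the rest contracts to \<open>g (f X) (f Y)\<close>. Smoothness is assumed because a vector field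
  is \<open>0\<close> by convention on nonsmooth functions.\<close>

lemma xi_star_ricci:
  assumes i: "1 \<le> i" "i \<le> s" and X: "vector_field A X" and Y: "vector_field A Y"
    and sm: "smooth_fun A (star_ricci A f nabla X Y)"
  shows "\<xi> i (star_ricci A f nabla X Y) p = star_ricci A f nabla (bracket (\<xi> i) X) Y p
    + star_ricci A f nabla X (bracket (\<xi> i) Y) p - 2 * real s * \<beta> ^ 3 * g (f X) (f Y) p"
proof -
  let ?b = "bracket (\<xi> i)"
  define F where "F = (\<lambda>Z. R X (f Y) (f Z))"
  have tF: "tensor11 A F" unfolding F_def using X Y by (rule tensor11_R_f)
  have tr: "trace_at A F = (\<lambda>p. 2 * star_ricci A f nabla X Y p)"
    by (simp add: star_ricci_def F_def fun_eq_iff)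
  then have "smooth_fun A (trace_at A F)" using sm by simp
  then have "\<xi> i (trace_at A F) p = trace_at A (\<lambda>Z. ?b (F Z) - F (?b Z)) p"
    using i by (intro vf_trace_at tF) auto
  moreover have "\<xi> i (trace_at A F) p = 2 * \<xi> i (star_ricci A f nabla X Y) p"
    unfolding tr using i sm by (simp add: vf_cmult[of "\<xi> i"])
  moreover have "trace_at A (\<lambda>Z. ?b (F Z) - F (?b Z)) p
    = 2 * (star_ricci A f nabla (?b X) Y p + star_ricci A f nabla X (?b Y) p - 2 * real s * \<beta> ^ 3 * g (f X) (f Y) p)"
  proof -
    obtain E where E: "orthonormal_frame_at A g p E" by (rule orthonormal_frame_exists)
    have v: "vector_field A (E k)" if "k < DIM('e)" for k using orthonormal_frame_field[OF E that] .
    have LF: "?b (F Z) - F (?b Z) = R (?b X) (f Y) (f Z) + R X (f (?b Y)) (f Z)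
      + (\<lambda>_. 2 * \<beta> ^ 3) \<odot> ((- (g X xb * g (f Y) (f Z))) \<odot> xb
        - (\<lambda>_. real s) \<odot> (g (f Y) (f Z) \<odot> P X - g (P X) (f Z) \<odot> f Y))" if "vector_field A Z" for Z
      unfolding F_def using i X Y that
      by (simp add: bracket_xi_R bracket_xi_f P_f g_f_xb fun_eq_iff algebra_simps)
    have t: "tensor11 A (\<lambda>Z. ?b (F Z) - F (?b Z))"
      unfolding tensor11_def
      using tF i by (auto simp: bracket_add_right bracket_fmult_right tensor11_add[OF tF] tensor11_fmult[OF tF]
          fun_eq_iff algebra_simps)
    have e1: "(\<Sum>k<DIM('e). g xb (E k) p * g (f (E k)) (f Y) p) = 0"
      using frame_contract[OF E f_tensor, of xb "f Y"] Y by (simp add: f_xb g_0_left)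
    \<comment> \<open>The two contractions \<open>e2\<close> and \<open>e3\<close> have opposite
      values and enter with opposite signs, hence they double; the factor 1/2 in
      \<open>star_ricci\<close> undoes this.\<close>
    have e2: "(\<Sum>k<DIM('e). g (P X) (E k) p * g (f (E k)) (f Y) p) = g (f X) (f Y) p"
      using frame_contract[OF E f_tensor, of "P X" "f Y"] X Y by (simp add: f_P)
    have e3: "(\<Sum>k<DIM('e). g (f Y) (E k) p * g (f (E k)) (P X) p) = - g (f X) (f Y) p"
      using frame_contract[OF E f_tensor, of "f Y" "P X"] X Y f_skew[of "f Y" "P X"] g_sym[of "f X" "f Y"]
      by (simp add: f_P)
    have "trace_at A (\<lambda>Z. ?b (F Z) - F (?b Z)) p
      = (\<Sum>k<DIM('e). g (R (?b X) (f Y) (f (E k))) (E k) p + g (R X (f (?b Y)) (f (E k))) (E k) p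
        - 2 * \<beta> ^ 3 * (g X xb p * (g xb (E k) p * g (f (E k)) (f Y) p)
          + real s * (g (P X) (E k) p * g (f (E k)) (f Y) p - g (f Y) (E k) p * g (f (E k)) (P X) p)))"
      unfolding trace_at_orthonormal[OF E t]
    proof (rule sum.cong)
      fix k assume "k \<in> {..<DIM('e)}"
      then have k: "vector_field A (E k)" using v by simp
      show "g (?b (F (E k)) - F (?b (E k))) (E k) p = g (R (?b X) (f Y) (f (E k))) (E k) p + g (R X (f (?b Y)) (f (E k))) (E k) p
        - 2 * \<beta> ^ 3 * (g X xb p * (g xb (E k) p * g (f (E k)) (f Y) p)
          + real s * (g (P X) (E k) p * g (f (E k)) (f Y) p - g (f Y) (E k) p * g (f (E k)) (P X) p))"
        unfolding LF[OF k] using i X Y k g_sym[of "f Y" "f (E k)"] g_sym[of "P X" "f (E k)"]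
        by (simp add: g_linear algebra_simps)
    qed simp
    also have "\<dots> = (\<Sum>k<DIM('e). g (R (?b X) (f Y) (f (E k))) (E k) p) + (\<Sum>k<DIM('e). g (R X (f (?b Y)) (f (E k))) (E k) p)
        - 2 * \<beta> ^ 3 * (g X xb p * (\<Sum>k<DIM('e). g xb (E k) p * g (f (E k)) (f Y) p)
          + real s * ((\<Sum>k<DIM('e). g (P X) (E k) p * g (f (E k)) (f Y) p) - (\<Sum>k<DIM('e). g (f Y) (E k) p * g (f (E k)) (P X) p)))"
      by (simp only: sum.distrib sum_subtractf flip: sum_distrib_left)
    finally show ?thesis
      unfolding e1 e2 e3 using i X Y by (simp add: star_ricci_orthonormal[OF E])
  qed
  ultimately show ?thesis by simp
qed

text \<open>In the second argument \<open>f\<close> absorbs \<open>P\<close>. In the first, the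
  \<xi> components contribute curvature operators that map \<open>f (E k)\<close> to multiples of
  \<open>xb\<close>, and their trace is a frame sum with \<open>f xb = 0\<close>.\<close>

lemma star_ricci_P:
  assumes X: "vector_field A X" and Y: "vector_field A Y"
  shows "star_ricci A f nabla (P X) (P Y) p = star_ricci A f nabla X Y p"
proof -
  obtain E where E: "orthonormal_frame_at A g p E" by (rule orthonormal_frame_exists)
  have v: "vector_field A (E k)" if "k < DIM('e)" for k using orthonormal_frame_field[OF E that] .
  have "(\<Sum>k<DIM('e). g (R (P X) (f Y) (f (E k))) (E k) p)
    = (\<Sum>k<DIM('e). g (R X (f Y) (f (E k))) (E k) p
        + (\<Sum>j=1..s. g X (\<xi> j) p * \<beta>\<^sup>2) * (g xb (E k) p * g (f (E k)) (f Y) p))"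
  proof (rule sum.cong)
    fix k assume "k \<in> {..<DIM('e)}"
    then have k: "vector_field A (E k)" using v by simp
    have t: "tensor11 A (\<lambda>Z. R Z (f Y) (f (E k)))" using Y k by (intro tensor11_R_1) auto
    have "R (P X) (f Y) (f (E k)) = R X (f Y) (f (E k)) - R (\<Sum>j=1..s. g X (\<xi> j) \<odot> \<xi> j) (f Y) (f (E k))"
      using X Y k by (simp add: P_def tensor11_diff[OF t])
    also have "R (\<Sum>j=1..s. g X (\<xi> j) \<odot> \<xi> j) (f Y) (f (E k)) = (\<Sum>j=1..s. R (g X (\<xi> j) \<odot> \<xi> j) (f Y) (f (E k)))"
      using X by (intro tensor11_sum[OF t]) auto
    also have "(\<Sum>j=1..s. R (g X (\<xi> j) \<odot> \<xi> j) (f Y) (f (E k)))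
      = (\<Sum>j=1..s. (\<lambda>p. - (g X (\<xi> j) p * \<beta>\<^sup>2) * g (f Y) (f (E k)) p) \<odot> xb)"
      using X Y k by (intro sum.cong) (auto simp: R_fmult_1 R_xi_1 g_f_xb P_f fun_eq_iff)
    finally have eq: "R (P X) (f Y) (f (E k)) = R X (f Y) (f (E k))
        - (\<Sum>j=1..s. (\<lambda>p. - (g X (\<xi> j) p * \<beta>\<^sup>2) * g (f Y) (f (E k)) p) \<odot> xb)" .
    have "g (\<Sum>j=1..s. (\<lambda>p. - (g X (\<xi> j) p * \<beta>\<^sup>2) * g (f Y) (f (E k)) p) \<odot> xb) (E k) p
        = (\<Sum>j=1..s. - (g X (\<xi> j) p * \<beta>\<^sup>2) * g (f Y) (f (E k)) p * g xb (E k) p)"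
      using X Y k by (subst g_sum_left) (auto simp: g_fmult_left sum_fun_apply)
    then show "g (R (P X) (f Y) (f (E k))) (E k) p = g (R X (f Y) (f (E k))) (E k) p
        + (\<Sum>j=1..s. g X (\<xi> j) p * \<beta>\<^sup>2) * (g xb (E k) p * g (f (E k)) (f Y) p)"
      unfolding eq using X Y k g_sym[of "f Y" "f (E k)"]
      by (subst g_diff_left) (auto simp: sum_distrib_left sum_distrib_right sum_negf mult_ac)
  qed simp
  also have "\<dots> = (\<Sum>k<DIM('e). g (R X (f Y) (f (E k))) (E k) p)
      + (\<Sum>j=1..s. g X (\<xi> j) p * \<beta>\<^sup>2) * (\<Sum>k<DIM('e). g xb (E k) p * g (f (E k)) (f Y) p)"
    by (simp only: sum.distrib sum_distrib_left)
  also have "(\<Sum>k<DIM('e). g xb (E k) p * g (f (E k)) (f Y) p) = 0"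
    using frame_contract[OF E f_tensor, of xb "f Y"] Y by (simp add: f_xb g_0_left)
  finally show ?thesis using X Y by (simp add: star_ricci_orthonormal[OF E] f_P)
qed

lemma star_ricci_xi:
  assumes i: "1 \<le> i" "i \<le> s" and X: "vector_field A X"
  shows "star_ricci A f nabla X (\<xi> i) p = 0"
proof -
  obtain E where E: "orthonormal_frame_at A g p E" by (rule orthonormal_frame_exists)
  have "g (R X 0 (f (E k))) (E k) p = 0" if "k < DIM('e)" for k
  proof -
    have k: "vector_field A (E k)" using orthonormal_frame_field[OF E that] .
    have "R 0 X (f (E k)) = 0" using tensor11_0[OF tensor11_R_1[of X "f (E k)"]] X k by simp
    then have "R X 0 (f (E k)) = 0" using R_antisym[of X 0 "f (E k)"] X k by simp
    then show ?thesis using k by (simp add: g_0_left)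
  qed
  then show ?thesis using i X by (simp add: star_ricci_orthonormal[OF E] f_xi)
qed

text \<open>The Ricci identity for \<open>f\<close>: the commutator of the curvature with
  \<open>f\<close> is found by differentiating the formula for the derivative of \<open>f\<close>
  once more, using the derivative of \<open>xb\<close> and the formula itself.\<close>

lemma R_f:
  assumes X: "vector_field A X" and Y: "vector_field A Y" and Z: "vector_field A Z"
  shows "R X Y (f Z) = f (R X Y Z) + (\<lambda>_. \<beta>\<^sup>2) \<odot> ((g X xb * g (f Y) Z - g Y xb * g (f X) Z) \<odot> xb
    + (\<lambda>_. real s) \<odot> (g (f Y) Z \<odot> P X - g (f X) Z \<odot> P Y - g (P X) Z \<odot> f Y + g (P Y) Z \<odot> f X)
    + g Z xb \<odot> (g Y xb \<odot> f X - g X xb \<odot> f Y))"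
proof -
  have second: "nabla X (nabla Y (f Z)) = f (nabla X (nabla Y Z))
      + (\<lambda>_. \<beta>) \<odot> (g (f X) (nabla Y Z) \<odot> xb - g (nabla Y Z) xb \<odot> f X
        + (g (nabla X (f Y)) Z + g (f Y) (nabla X Z)) \<odot> xb + g (f Y) Z \<odot> nabla X xb
        - ((g (nabla X Z) xb + g Z (nabla X xb)) \<odot> f Y + g Z xb \<odot> nabla X (f Y)))"
    if "vector_field A X" "vector_field A Y" for X Y
  proof -
    have "nabla X (nabla Y (f Z)) = nabla X (f (nabla Y Z)) + nabla X ((\<lambda>_. \<beta>) \<odot> (g (f Y) Z \<odot> xb - g Z xb \<odot> f Y))"
      using that Z by (simp add: nabla_f'[of Y Z] nabla_add_right)
    also have "nabla X (f (nabla Y Z)) = f (nabla X (nabla Y Z)) + (\<lambda>_. \<beta>) \<odot> (g (f X) (nabla Y Z) \<odot> xb - g (nabla Y Z) xb \<odot> f X)"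
      using that Z by (simp add: nabla_f')
    also have "nabla X ((\<lambda>_. \<beta>) \<odot> (g (f Y) Z \<odot> xb - g Z xb \<odot> f Y))
      = (\<lambda>_. \<beta>) \<odot> ((g (nabla X (f Y)) Z + g (f Y) (nabla X Z)) \<odot> xb + g (f Y) Z \<odot> nabla X xb
        - ((g (nabla X Z) xb + g Z (nabla X xb)) \<odot> f Y + g Z xb \<odot> nabla X (f Y)))"
      using that Z by (simp add: nabla_diff_right nabla_fmult_right vf_g fun_eq_iff vf_const)
    finally show ?thesis by (simp add: fun_eq_iff algebra_simps)
  qed
  have third: "nabla (bracket X Y) (f Z) = f (nabla (bracket X Y) Z)
      + (\<lambda>_. \<beta>) \<odot> ((g (f (nabla X Y)) Z - g (f (nabla Y X)) Z) \<odot> xb - g Z xb \<odot> (f (nabla X Y) - f (nabla Y X)))"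
  proof -
    have "f (bracket X Y) = f (nabla X Y) - f (nabla Y X)" using X Y by (simp add: bracket_nabla f_diff)
    then show ?thesis using X Y Z by (simp add: nabla_f'[of "bracket X Y" Z] g_diff_left)
  qed
  have fR: "f (R X Y Z) = f (nabla X (nabla Y Z)) - f (nabla Y (nabla X Z)) - f (nabla (bracket X Y) Z)"
    using X Y Z by (simp add: curvature_def f_diff)
  have sym: "g (f Y) X = - g (f X) Y" using X Y by (simp add: f_skew[of Y X] g_sym[of Y "f X"])
  show ?thesis
    unfolding fR unfolding curvature_def[of nabla X Y "f Z"] second[OF X Y] second[OF Y X] third
    using X Y Z sym
    by (simp add: nabla_f'[of X Y] nabla_f'[of Y X] nabla_xb g_linear g_sym[of xb Z] g_sym[of Z "P X"] g_sym[of Z "P Y"]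
       fun_eq_iff power2_eq_square algebra_simps)
qed


text \<open>By cyclicity, the trace of the transpose of \<open>f\<close> after \<open>F\<close>
  after \<open>f\<close> is that of \<open>F\<close> after \<open>- f f\<close>. The hypothesis
  \<open>K\<close> says that \<open>- f f\<close> equals \<kappa> \<open>P\<close> at
  \<open>p\<close>, which leaves \<kappa> times the trace of \<open>F\<close> without its \<xi>
  directions.\<close>

lemma trace_f_conjugate:
  assumes E: "orthonormal_frame_at A g p E" and F: "tensor11 A F"
    and K: "\<And>X Y. vector_field A X \<Longrightarrow> vector_field A Y \<Longrightarrow> g (f X) (f Y) p = \<kappa> * g (P X) Y p"
  shows "(\<Sum>i<DIM('e). g (F (f (E i))) (f (E i)) p)
    = \<kappa> * ((\<Sum>i<DIM('e). g (F (E i)) (E i) p) - (\<Sum>j=1..s. g (F (\<xi> j)) (\<xi> j) p))"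
proof -
  let ?N = "{..<DIM('e)}"
  have v: "vector_field A (E k)" if "k \<in> ?N" for k using orthonormal_frame_field[OF E] that by simp
  \<comment> \<open>Cyclicity by hand: expand \<open>f (E i)\<close> in the frame, exchange the
    sums, and move both copies of \<open>f\<close> by skewness, so that the two signs
    cancel.\<close>
  have "(\<Sum>i\<in>?N. g (F (f (E i))) (f (E i)) p)
      = (\<Sum>i\<in>?N. \<Sum>k\<in>?N. g (f (E i)) (E k) p * g (F (E k)) (f (E i)) p)"
    using v by (intro sum.cong) (auto simp: frame_contract[OF E F])
  also have "\<dots> = (\<Sum>k\<in>?N. \<Sum>i\<in>?N. g (f (E k)) (E i) p * g (E i) (f (F (E k))) p)"
  proof (subst sum.swap, intro sum.cong refl)
    fix k i assume "k \<in> ?N" "i \<in> ?N"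
    then have ki: "vector_field A (E k)" "vector_field A (E i)" using v by auto
    have "g (f (E i)) (E k) = - g (f (E k)) (E i)"
      using ki f_skew[of "E i" "E k"] by (simp add: g_sym[of "E i" "f (E k)"])
    moreover have "g (F (E k)) (f (E i)) = - g (E i) (f (F (E k)))"
      using ki F f_skew[of "F (E k)" "E i"] g_sym[of "f (F (E k))" "E i"] by simp
    ultimately show "g (f (E i)) (E k) p * g (F (E k)) (f (E i)) p = g (f (E k)) (E i) p * g (E i) (f (F (E k))) p"
      by simp
  qed
  also have "\<dots> = (\<Sum>k\<in>?N. \<kappa> * (g (F (E k)) (E k) p - (\<Sum>j=1..s. g (\<xi> j) (E k) p * g (F (E k)) (\<xi> j) p)))"
  proof (intro sum.cong refl)
    fix k assume "k \<in> ?N"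
    then have k: "vector_field A (E k)" using v by auto
    have "(\<Sum>i\<in>?N. g (f (E k)) (E i) p * g (E i) (f (F (E k))) p) = g (f (E k)) (f (F (E k))) p"
      using k F by (intro frame_parseval[OF E]) auto
    also have "\<dots> = \<kappa> * g (P (E k)) (F (E k)) p" using k F by (intro K) auto
    also have "g (P (E k)) (F (E k)) p = g (E k) (F (E k)) p - (\<Sum>j=1..s. g (E k) (\<xi> j) p * g (F (E k)) (\<xi> j) p)"
      using k F by (simp add: g_P_left)
    also have "(\<Sum>j=1..s. g (E k) (\<xi> j) p * g (F (E k)) (\<xi> j) p) = (\<Sum>j=1..s. g (\<xi> j) (E k) p * g (F (E k)) (\<xi> j) p)"
      using k by (intro sum.cong) (auto simp: g_sym[of "E k"])
    finally show "(\<Sum>i\<in>?N. g (f (E k)) (E i) p * g (E i) (f (F (E k))) p)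
      = \<kappa> * (g (F (E k)) (E k) p - (\<Sum>j=1..s. g (\<xi> j) (E k) p * g (F (E k)) (\<xi> j) p))"
      using k F by (simp add: g_sym[of "E k" "F (E k)"])
  qed
  also have "\<dots> = \<kappa> * ((\<Sum>k\<in>?N. g (F (E k)) (E k) p) - (\<Sum>j=1..s. \<Sum>k\<in>?N. g (\<xi> j) (E k) p * g (F (E k)) (\<xi> j) p))"
    by (subst sum.swap) (simp add: sum_distrib_left[symmetric] sum_subtractf)
  also have "(\<Sum>j=1..s. \<Sum>k\<in>?N. g (\<xi> j) (E k) p * g (F (E k)) (\<xi> j) p) = (\<Sum>j=1..s. g (F (\<xi> j)) (\<xi> j) p)"
    by (intro sum.cong) (auto simp: frame_contract[OF E F])
  finally show ?thesis .
qed

section \<open>The Ricci tensor and its comparison with the star-Ricci tensor\<close>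

lemma ricci_xi:
  assumes j: "1 \<le> j" "j \<le> s" and X: "vector_field A X"
  shows "ricci A nabla X (\<xi> j) p = - 2 * real n * \<beta>\<^sup>2 * g X xb p"
proof -
  obtain E where E: "orthonormal_frame_at A g p E" by (rule orthonormal_frame_exists)
  have v: "vector_field A (E k)" if "k < DIM('e)" for k using orthonormal_frame_field[OF E that] .
  have "ricci A nabla X (\<xi> j) p
    = (\<Sum>k<DIM('e). \<beta>\<^sup>2 * (g (P X) (E k) p * g (E k) xb p - g X xb p * g (P (E k)) (E k) p))"
    unfolding ricci_orthonormal[OF E X xi_vf[OF j]]
    using v X j by (intro sum.cong) (auto simp: R_xi g_linear)
  also have "\<dots> = \<beta>\<^sup>2 * ((\<Sum>k<DIM('e). g (P X) (E k) p * g (E k) xb p) - g X xb p * (\<Sum>k<DIM('e). g (P (E k)) (E k) p))"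
    by (simp add: sum_distrib_left[symmetric] sum_subtractf)
  also have "\<dots> = - 2 * real n * \<beta>\<^sup>2 * g X xb p"
    using X by (simp add: frame_parseval[OF E] trace_P[OF E] g_P_xb)
  finally show ?thesis .
qed

lemma ricci_P_right:
  assumes X: "vector_field A X" and Y: "vector_field A Y"
  shows "ricci A nabla X (P Y) p = ricci A nabla X Y p + 2 * real n * \<beta>\<^sup>2 * g X xb p * g Y xb p"
proof -
  obtain E where E: "orthonormal_frame_at A g p E" by (rule orthonormal_frame_exists)
  have v: "vector_field A (E k)" if "k < DIM('e)" for k using orthonormal_frame_field[OF E that] .
  have "ricci A nabla X (P Y) p = (\<Sum>k<DIM('e). g (R (E k) X Y) (E k) p
      - (\<Sum>j=1..s. g Y (\<xi> j) p * g (R (E k) X (\<xi> j)) (E k) p))"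
    unfolding ricci_orthonormal[OF E X P_vf[OF Y]]
  proof (intro sum.cong refl)
    fix k assume "k \<in> {..<DIM('e)}"
    then have k: "vector_field A (E k)" using v by simp
    have t: "tensor11 A (R (E k) X)" using k X by (rule tensor11_R_3)
    have "R (E k) X (P Y) = R (E k) X Y - (\<Sum>j=1..s. g Y (\<xi> j) \<odot> R (E k) X (\<xi> j))"
      unfolding P_def using Y by (subst tensor11_diff[OF t]; simp; subst tensor11_sum[OF t]) (auto simp: R_fmult_3 k X)
    then show "g (R (E k) X (P Y)) (E k) p = g (R (E k) X Y) (E k) p
      - (\<Sum>j=1..s. g Y (\<xi> j) p * g (R (E k) X (\<xi> j)) (E k) p)"
      using X Y k by (simp add: g_diff_left g_sum_left g_fmult_left sum_fun_apply)
  qed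
  also have "\<dots> = (\<Sum>k<DIM('e). g (R (E k) X Y) (E k) p)
      - (\<Sum>j=1..s. g Y (\<xi> j) p * (\<Sum>k<DIM('e). g (R (E k) X (\<xi> j)) (E k) p))"
    unfolding sum_subtractf sum_distrib_left by (subst (2) sum.swap) simp
  also have "\<dots> = ricci A nabla X Y p - (\<Sum>j=1..s. g Y (\<xi> j) p * ricci A nabla X (\<xi> j) p)"
    using X Y by (simp add: ricci_orthonormal[OF E])
  also have "(\<Sum>j=1..s. g Y (\<xi> j) p * ricci A nabla X (\<xi> j) p) = (\<Sum>j=1..s. g Y (\<xi> j) p) * (- 2 * real n * \<beta>\<^sup>2 * g X xb p)"
    using X by (simp add: ricci_xi sum_distrib_right sum_negf)
  also have "(\<Sum>j=1..s. g Y (\<xi> j) p) = g Y xb p"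
    using Y by (simp add: xi_bar_def g_sum_right sum_fun_apply)
  finally show ?thesis by simp
qed

text \<open>Symmetry of Ric allows \<open>P\<close> to be inserted into one argument at a time. The
  correction occurs only once, since in the other step the factor \<open>g (P X) xb\<close> is
  zero.\<close>

lemma ricci_P_P:
  assumes X: "vector_field A X" and Y: "vector_field A Y"
  shows "ricci A nabla X Y p = ricci A nabla (P X) (P Y) p - 2 * real n * \<beta>\<^sup>2 * g X xb p * g Y xb p"
proof -
  have "ricci A nabla (P X) (P Y) p = ricci A nabla (P X) Y p"
    using X Y by (simp add: ricci_P_right g_P_xb)
  also have "\<dots> = ricci A nabla Y X p + 2 * real n * \<beta>\<^sup>2 * g Y xb p * g X xb p"
    using X Y by (simp add: ricci_sym[of "P X" Y] ricci_P_right)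
  finally show ?thesis using X Y by (simp add: ricci_sym[of Y X])
qed

text \<open>The first Bianchi identity splits the trace defining the \<open>*\<close>-Ricci tensor into two traces,
  each of which the Ricci identity \<open>R_f\<close> reduces to \<open>\<kappa> Ric\<close>.\<close>

lemma star_ricci_eq_ricci:
  assumes K: "\<And>X Y. vector_field A X \<Longrightarrow> vector_field A Y \<Longrightarrow> g (f X) (f Y) p = \<kappa> * g (P X) Y p"
    and X: "vector_field A X" and Y: "vector_field A Y" and PX: "P X = X" and PY: "P Y = Y"
  shows "star_ricci A f nabla X Y p = \<kappa> * (ricci A nabla X Y p + (2 * real n - 1) * real s * \<beta>\<^sup>2 * g X Y p)"
proof -
  obtain E where E: "orthonormal_frame_at A g p E" by (rule orthonormal_frame_exists)
  let ?N = "{..<DIM('e)}"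
  have v: "vector_field A (E k)" if "k \<in> ?N" for k using orthonormal_frame_field[OF E] that by simp
  have X0: "g X xb = 0" using X PX g_P_xb[of X] by simp
  have Y0: "g Y xb = 0" using Y PY g_P_xb[of Y] by simp
  have ff: "g (f (f Z)) W p = - \<kappa> * g (P Z) W p" if "vector_field A Z" "vector_field A W" for Z W
    using that K[of Z W] f_skew[of "f Z" W] by simp
  have fXY: "g (f X) (f Y) p = \<kappa> * g X Y p" using K[OF X Y] PX by simp
  have skew0: "g (f Z) Z p = 0" if "vector_field A Z" for Z
    using that f_skew[of Z Z] g_sym[of Z "f Z"] by (simp add: fun_eq_iff)
  have split: "g (R X (f Y) (f e)) e p = - g (R (f e) X (f Y)) e p + g (R (f e) (f Y) X) e p"
    if e: "vector_field A e" for e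
  proof -
    have "R X (f Y) (f e) + R (f Y) (f e) X + R (f e) X (f Y) = 0"
      using e X Y by (intro first_Bianchi) auto
    then have "g (R X (f Y) (f e) + R (f Y) (f e) X + R (f e) X (f Y)) e p = 0"
      using e by (simp add: g_0_left)
    moreover have "g (R (f Y) (f e) X) e p = - g (R (f e) (f Y) X) e p"
      using e X Y R_antisym[of "f Y" "f e" X] by (simp add: g_uminus_left)
    ultimately show ?thesis using e X Y by (simp add: g_linear)
  qed
  \<comment> \<open>\<open>R_f\<close> takes \<open>f\<close> off \<open>Y\<close>, and skewness
    puts it on the second \<open>E k\<close>; both frame fields then carry \<open>f\<close>, as
    \<open>trace_f_conjugate\<close> requires.\<close>
  have T1: "(\<Sum>k\<in>?N. g (R (f (E k)) X (f Y)) (E k) p)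
    = - \<kappa> * (ricci A nabla X Y p + real s * \<beta>\<^sup>2 * g X Y p) + real s * \<beta>\<^sup>2 * \<kappa> * (2 - 2 * real n) * g X Y p"
  proof -
    have "(\<Sum>k\<in>?N. g (R (f (E k)) X (f Y)) (E k) p)
      = (\<Sum>k\<in>?N. - g (R (f (E k)) X Y) (f (E k)) p
          + real s * \<beta>\<^sup>2 * (g X (E k) p * (\<kappa> * g (E k) Y p) - g (f X) (E k) p * g (f (E k)) Y p
             - \<kappa> * g X Y p * g (P (E k)) (E k) p))"
    proof (intro sum.cong refl)
      fix k assume "k \<in> ?N"
      then have k: "vector_field A (E k)" using v by simp
      have "g (f (R (f (E k)) X Y)) (E k) p = - g (R (f (E k)) X Y) (f (E k)) p"
        using k X Y by (simp add: f_skew)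
      moreover have "g (f (f (E k))) Y p = - \<kappa> * g (E k) Y p"
        using ff[OF k Y] k Y PY by (simp add: g_P_sym)
      ultimately show "g (R (f (E k)) X (f Y)) (E k) p = - g (R (f (E k)) X Y) (f (E k)) p
          + real s * \<beta>\<^sup>2 * (g X (E k) p * (\<kappa> * g (E k) Y p) - g (f X) (E k) p * g (f (E k)) Y p
             - \<kappa> * g X Y p * g (P (E k)) (E k) p)"
        using k X Y skew0[OF k] ff[OF k k]
        by (simp add: R_f g_linear g_f_xb X0 Y0 PX PY P_f algebra_simps)
    qed
    also have "\<dots> = - (\<Sum>k\<in>?N. g (R (f (E k)) X Y) (f (E k)) p)
          + real s * \<beta>\<^sup>2 * (\<kappa> * (\<Sum>k\<in>?N. g X (E k) p * g (E k) Y p)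
             - (\<Sum>k\<in>?N. g (f X) (E k) p * g (f (E k)) Y p)
             - \<kappa> * g X Y p * (\<Sum>k\<in>?N. g (P (E k)) (E k) p))"
      by (simp add: sum.distrib sum_subtractf sum_distrib_left sum_negf algebra_simps)
    also have "(\<Sum>k\<in>?N. g (f X) (E k) p * g (f (E k)) Y p) = - \<kappa> * g X Y p"
      using X Y ff[OF X Y] PX by (simp add: frame_contract[OF E f_tensor])
    also have "(\<Sum>k\<in>?N. g (R (f (E k)) X Y) (f (E k)) p)
        = \<kappa> * (ricci A nabla X Y p + real s * \<beta>\<^sup>2 * g X Y p)"
    proof -
      \<comment> \<open>These are the \<xi> directions left out of the trace; omitting them adds s
        \<beta>^2 \<open>g X Y\<close>.\<close>
      have "(\<Sum>j=1..s. g (R (\<xi> j) X Y) (\<xi> j) p) = (\<Sum>j=1..s. - \<beta>\<^sup>2 * g X Y p)"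
      proof (intro sum.cong refl)
        fix j assume "j \<in> {1..s}"
        then have j: "1 \<le> j" "j \<le> s" by auto
        then have "g xb (\<xi> j) p = 1" using g_sym[of xb "\<xi> j"] g_xi_xb[OF j] by simp
        then show "g (R (\<xi> j) X Y) (\<xi> j) p = - \<beta>\<^sup>2 * g X Y p"
          using j X Y by (simp add: R_xi_1 g_linear Y0 PX)
      qed
      then show ?thesis
        using trace_f_conjugate[OF E tensor11_R_1[OF X Y] K] X Y by (simp add: ricci_orthonormal[OF E])
    qed
    finally show ?thesis
      using X Y by (simp add: frame_parseval[OF E] trace_P[OF E] algebra_simps)
  qed
  have T2: "(\<Sum>k\<in>?N. g (R (f (E k)) (f Y) X) (E k) p)
    = \<kappa> * ricci A nabla X Y p + real s * \<beta>\<^sup>2 * \<kappa> * (2 * real n - 1) * g X Y p"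
  proof -
    have "(\<Sum>k\<in>?N. g (R (f (E k)) (f Y) X) (E k) p)
      = (\<Sum>k\<in>?N. \<kappa> * g (R (E k) Y X) (E k) p
         + \<beta>\<^sup>2 * (real s * (- (g (f X) (E k) p * g (E k) (f Y) p) - g X (E k) p * g (f (E k)) (f Y) p
             + g (P (E k)) (E k) p * g (f X) (f Y) p) + g xb (E k) p * g (E k) xb p * g (f X) (f Y) p))"
    proof (intro sum.cong refl)
      fix k assume "k \<in> ?N"
      then have k: "vector_field A (E k)" using v by simp
      \<comment> \<open>Pair symmetry brings \<open>f (E k)\<close> into the third slot, where
        \<open>R_f\<close> can pull \<open>f\<close> out; it then meets \<open>f Y\<close>, and
        \<open>K\<close> removes both.\<close>
      have "g (R (f (E k)) (f Y) X) (E k) p = g (R X (E k) (f (E k))) (f Y) p"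
        using k X Y by (simp add: R_pair_sym)
      also have "g (f (R X (E k) (E k))) (f Y) p = \<kappa> * g (R (E k) Y X) (E k) p"
      proof -
        have "g (f (R X (E k) (E k))) (f Y) p = \<kappa> * g (R X (E k) (E k)) Y p"
          using k X Y PY by (simp add: K g_P_sym)
        then show ?thesis using k X Y by (simp add: R_pair_sym[of X "E k" "E k" Y])
      qed
      moreover have "g xb (f Y) = 0" using Y g_sym[of xb "f Y"] by (simp add: g_f_xb)
      moreover have "g (P (E k)) (f Y) = g (E k) (f Y)" using k Y by (simp add: g_P_sym P_f)
      ultimately show "g (R (f (E k)) (f Y) X) (E k) p = \<kappa> * g (R (E k) Y X) (E k) p
         + \<beta>\<^sup>2 * (real s * (- (g (f X) (E k) p * g (E k) (f Y) p) - g X (E k) p * g (f (E k)) (f Y) p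
             + g (P (E k)) (E k) p * g (f X) (f Y) p) + g xb (E k) p * g (E k) xb p * g (f X) (f Y) p)"
        using k X Y skew0[OF k] g_sym[of xb "E k"]
        by (simp add: R_f g_linear X0 PX algebra_simps)
    qed
    also have "\<dots> = \<kappa> * (\<Sum>k\<in>?N. g (R (E k) Y X) (E k) p)
         + \<beta>\<^sup>2 * (real s * (- (\<Sum>k\<in>?N. g (f X) (E k) p * g (E k) (f Y) p)
             - (\<Sum>k\<in>?N. g X (E k) p * g (f (E k)) (f Y) p)
             + (\<Sum>k\<in>?N. g (P (E k)) (E k) p) * g (f X) (f Y) p)
             + (\<Sum>k\<in>?N. g xb (E k) p * g (E k) xb p) * g (f X) (f Y) p)"
      by (simp add: sum.distrib sum_subtractf sum_distrib_left sum_distrib_right sum_negf algebra_simps)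
    also have "(\<Sum>k\<in>?N. g (R (E k) Y X) (E k) p) = ricci A nabla X Y p"
      using X Y by (simp add: ricci_orthonormal[OF E, symmetric] ricci_sym[of Y X])
    also have "(\<Sum>k\<in>?N. g (f X) (E k) p * g (E k) (f Y) p) = g (f X) (f Y) p"
      using X Y by (intro frame_parseval[OF E]) auto
    also have "(\<Sum>k\<in>?N. g X (E k) p * g (f (E k)) (f Y) p) = g (f X) (f Y) p"
      using X Y by (intro frame_contract[OF E f_tensor]) auto
    also have "(\<Sum>k\<in>?N. g xb (E k) p * g (E k) xb p) = real s"
      using frame_parseval[OF E xb_vf xb_vf] by (simp add: g_xb_xb)
    finally show ?thesis by (simp add: trace_P[OF E] fXY algebra_simps)
  qed
  \<comment> \<open>In half of \<open>T2\<close> minus \<open>T1\<close> the Ricci terms add up to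
    \<kappa> Ric, and the coefficients of \<kappa> s \<beta>^2 \<open>g X Y\<close> to (2n - 1 + 1 -
    2 + 2n) / 2 = 2n - 1.\<close>
  have "star_ricci A f nabla X Y p
    = (- (\<Sum>k\<in>?N. g (R (f (E k)) X (f Y)) (E k) p) + (\<Sum>k\<in>?N. g (R (f (E k)) (f Y) X) (E k) p)) / 2"
    using X Y v split by (simp add: star_ricci_orthonormal[OF E] sum_subtractf)
  then show ?thesis unfolding T1 T2 by (simp add: field_simps)
qed

end

section \<open>The soliton equation\<close>

locale weak_f_kenmotsu_soliton = weak_f_kenmotsu_const A n s f Q \<xi> \<eta> g nabla \<beta>
  for A :: "('a::{t2_space, second_countable_topology}, 'e::euclidean_space) atlas"
    and n s f Q \<xi> \<eta> g nabla \<beta> +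
  fixes lam mu :: real and V :: "'a vfield" and \<delta> :: "nat \<Rightarrow> 'a \<Rightarrow> real"
  assumes beta_nonzero: "\<beta> \<noteq> 0"
    and soliton: "star_eta_ricci_soliton A s f \<eta> g nabla V lam mu"
    and delta_smooth: "\<forall>i\<in>{1..s}. smooth_fun A (\<delta> i)"
    and V_eq: "V = (\<Sum>i=1..s. \<delta> i \<odot> \<xi> i)"
begin

lemma delta_smooth' [simp]: "1 \<le> i \<Longrightarrow> i \<le> s \<Longrightarrow> smooth_fun A (\<delta> i)"
  using delta_smooth by simp

definition d :: "'a \<Rightarrow> real" where "d = (\<lambda>p. \<Sum>i=1..s. \<delta> i p)"

lemma d_smooth [simp]: "smooth_fun A d"
  unfolding d_def by (intro smooth_fun_sum') auto

lemma V_vf [simp]: "vector_field A V"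
  unfolding V_eq by simp

lemma nabla_V: "vector_field A X \<Longrightarrow> nabla X V = (\<Sum>i=1..s. X (\<delta> i) \<odot> \<xi> i) + (\<lambda>p. \<beta> * d p) \<odot> P X"
  unfolding V_eq d_def
  by (simp add: nabla_sum_right nabla_fmult_right nabla_xi fun_eq_iff sum_fun_apply sum.distrib
      sum_distrib_left sum_distrib_right mult_ac)

lemma lie_deriv_V:
  assumes X: "vector_field A X" and Y: "vector_field A Y"
  shows "lie_deriv V g X Y p = (\<Sum>i=1..s. X (\<delta> i) p * g Y (\<xi> i) p + Y (\<delta> i) p * g X (\<xi> i) p)
    + 2 * \<beta> * d p * g (P X) Y p"
proof -
  have nV: "g (nabla X V) Y p = (\<Sum>i=1..s. X (\<delta> i) p * g Y (\<xi> i) p) + \<beta> * d p * g (P X) Y p"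
    if X: "vector_field A X" and Y: "vector_field A Y" for X Y
  proof -
    have "(\<Sum>i=1..s. X (\<delta> i) p * g (\<xi> i) Y p) = (\<Sum>i=1..s. X (\<delta> i) p * g Y (\<xi> i) p)"
      using Y by (intro sum.cong) (auto simp: g_sym[of Y])
    then show ?thesis using X Y by (simp add: nabla_V g_add_left g_sum_left g_fmult_left sum_fun_apply)
  qed
  have "lie_deriv V g X Y p = g (nabla X V) Y p + g X (nabla Y V) p"
    using X Y by (simp add: lie_deriv_def vf_g bracket_nabla g_linear)
  also have "g X (nabla Y V) p = g (nabla Y V) X p" using X Y by (simp add: g_sym[of X "nabla Y V"])
  finally have "lie_deriv V g X Y p = g (nabla X V) Y p + g (nabla Y V) X p" .
  moreover have "g (P Y) X = g (P X) Y" using X Y by (simp add: g_P_sym g_sym[of Y "P X"])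
  ultimately show ?thesis unfolding nV[OF X Y] nV[OF Y X] by (simp add: sum.distrib)
qed

lemma soliton_eq:
  assumes X: "vector_field A X" and Y: "vector_field A Y"
  shows "(\<Sum>i=1..s. X (\<delta> i) p * g Y (\<xi> i) p + Y (\<delta> i) p * g X (\<xi> i) p) / 2
      + \<beta> * d p * g (P X) Y p + star_ricci A f nabla X Y p
    = lam * g (P X) Y p + (lam + mu) * (g X xb p * g Y xb p)"
proof -
  have "lie_deriv V g X Y p / 2 + star_ricci A f nabla X Y p =
          lam * (g X Y p - (\<Sum>i=1..s. \<eta> i X p * \<eta> i Y p)) + (lam + mu) * (eta_bar s \<eta> X p * eta_bar s \<eta> Y p)"
    using soliton X Y by (simp add: star_eta_ricci_soliton_def)
  moreover have "(\<Sum>i=1..s. \<eta> i X p * \<eta> i Y p) = (\<Sum>i=1..s. g X (\<xi> i) p * g Y (\<xi> i) p)"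
    using X Y by (intro sum.cong) (auto simp: eta_eq)
  ultimately show ?thesis
    using X Y by (simp add: lie_deriv_V eta_bar_eq g_P_left add_divide_distrib)
qed

text \<open>Evaluated on \<open>P X\<close> and \<open>P Y\<close>, the equation loses every
  derivative of \<delta> and the \<eta> terms, while the star-Ricci tensor is unchanged by
  \<open>star_ricci_P\<close>; hence the formula holds for all fields, not only on \<D>.\<close>

lemma star_ricci_soliton:
  assumes X: "vector_field A X" and Y: "vector_field A Y"
  shows "star_ricci A f nabla X Y p = (lam - \<beta> * d p) * g (P X) Y p"
proof -
  have "(\<Sum>i=1..s. P X (\<delta> i) p * g (P Y) (\<xi> i) p + P Y (\<delta> i) p * g (P X) (\<xi> i) p) = 0"
    using X Y by (intro sum.neutral) (auto simp: g_P_xi)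
  moreover have "g (P X) (P Y) = g (P X) Y" using X Y by (simp add: g_P_sym[symmetric] P_P)
  ultimately show ?thesis
    using soliton_eq[of "P X" "P Y" p] X Y by (simp add: star_ricci_P P_P g_P_xb algebra_simps)
qed

lemma sum_delta_xi: "1 \<le> j \<Longrightarrow> j \<le> s \<Longrightarrow> (\<Sum>i=1..s. c i * g (\<xi> j) (\<xi> i) p) = c j"
proof -
  assume j: "1 \<le> j" "j \<le> s"
  have "(\<Sum>i=1..s. c i * g (\<xi> j) (\<xi> i) p) = (\<Sum>i=1..s. c i * (if i = j then 1 else 0))"
    using j by (intro sum.cong) (auto simp: g_xi_xi)
  then show ?thesis using j by (simp only: sum_delta_left)
qed

text \<open>The mixed component on (X, \<xi> j): the star-Ricci tensor and the right-hand side both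
  vanish there, so the derivative of \<delta> j is all that is left.\<close>

lemma delta_horizontal:
  assumes j: "1 \<le> j" "j \<le> s" and X: "vector_field A X" and "\<And>i. 1 \<le> i \<Longrightarrow> i \<le> s \<Longrightarrow> g X (\<xi> i) = 0"
  shows "X (\<delta> j) p = 0"
proof -
  have PX: "P X = X" using assms(4) by (rule P_id)
  have "(\<Sum>i=1..s. X (\<delta> i) p * g (\<xi> j) (\<xi> i) p + \<xi> j (\<delta> i) p * g X (\<xi> i) p)
     = (\<Sum>i=1..s. X (\<delta> i) p * g (\<xi> j) (\<xi> i) p)"
    using assms(4) by (intro sum.cong) auto
  then show ?thesis
    using soliton_eq[of X "\<xi> j" p] j X g_P_xb[OF X] PX assms(4)[OF j]
    by (simp add: star_ricci_xi sum_delta_xi)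
qed

text \<open>The components along the \<xi> fields prescribe only the symmetric part of the array of
  derivatives \<xi> i (\<delta> j).\<close>

lemma delta_xi_xi:
  assumes i: "1 \<le> i" "i \<le> s" and j: "1 \<le> j" "j \<le> s"
  shows "\<xi> i (\<delta> j) p + \<xi> j (\<delta> i) p = 2 * (lam + mu)"
  using soliton_eq[of "\<xi> i" "\<xi> j" p] i j
  by (simp add: star_ricci_xi P_xi g_0_left g_xi_xb sum.distrib sum_delta_xi)

text \<open>Take the Lie derivative of \<open>star_ricci_soliton\<close> along \<open>\<xi> i\<close> and compare with \<open>xi_star_ricci\<close>.\<close>

lemma g_f_f_xi:
  assumes i: "1 \<le> i" "i \<le> s" and X: "vector_field A X" and Y: "vector_field A Y"
  shows "g (f X) (f Y) p = (\<xi> i d p + 2 * \<beta> * d p - 2 * lam) / (2 * real s * \<beta>\<^sup>2) * g (P X) Y p"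
proof -
  have S: "star_ricci A f nabla X Y = (\<lambda>p. (lam - \<beta> * d p) * g (P X) Y p)"
    using X Y by (simp add: star_ricci_soliton fun_eq_iff)
  \<comment> \<open>The soliton equation itself supplies the smoothness that
    \<open>xi_star_ricci\<close> asks for.\<close>
  then have sm: "smooth_fun A (star_ricci A f nabla X Y)" using X Y by simp
  have "\<xi> i (star_ricci A f nabla X Y) p = - \<beta> * \<xi> i d p * g (P X) Y p + (lam - \<beta> * d p) * \<xi> i (g (P X) Y) p"
    unfolding S using i X Y
    by (simp add: vf_mult'[of "\<xi> i"] vf_diff'[of "\<xi> i"] vf_cmult[of "\<xi> i"] vf_const)
  also have "\<xi> i (g (P X) Y) p = g (P (bracket (\<xi> i) X)) Y p + g (P X) (bracket (\<xi> i) Y) p + 2 * \<beta> * g (P X) Y p"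
    using i X Y by (simp add: vf_xi_g bracket_xi_P P_P)
  finally have "2 * real s * \<beta> ^ 3 * g (f X) (f Y) p = \<beta> * (\<xi> i d p + 2 * \<beta> * d p - 2 * lam) * g (P X) Y p"
    using xi_star_ricci[OF i X Y sm, of p]
      star_ricci_soliton[of "bracket (\<xi> i) X" Y p] star_ricci_soliton[of X "bracket (\<xi> i) Y" p] i X Y
    by (simp add: algebra_simps)
  then have "\<beta> * (2 * real s * \<beta>\<^sup>2 * g (f X) (f Y) p) = \<beta> * ((\<xi> i d p + 2 * \<beta> * d p - 2 * lam) * g (P X) Y p)"
    by (simp add: power3_eq_cube power2_eq_square mult_ac)
  then have "2 * real s * \<beta>\<^sup>2 * g (f X) (f Y) p = (\<xi> i d p + 2 * \<beta> * d p - 2 * lam) * g (P X) Y p"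
    by (simp only: mult_left_cancel[OF beta_nonzero])
  moreover have "2 * real s * \<beta>\<^sup>2 \<noteq> 0" using beta_nonzero s_gt_1 by simp
  ultimately show ?thesis by (simp add: nonzero_eq_divide_eq mult_ac)
qed

text \<open>The factor \<kappa> relating \<open>g (f X) (f Y)\<close> to \<open>g (P X) Y\<close> is
  constant along \<xi> j: \<open>f\<close> and \<open>P\<close> are invariant, so both tensors grow
  at the same rate 2 \<beta>. Written out with the formula for \<kappa>, this is the
  equation.\<close>

lemma xi_xi_d:
  assumes i: "1 \<le> i" "i \<le> s" and j: "1 \<le> j" "j \<le> s"
  shows "\<xi> j (\<xi> i d) p + 2 * \<beta> * \<xi> j d p = 0"
proof -
  define \<kappa> where "\<kappa> = (\<lambda>p. 1 / (2 * real s * \<beta>\<^sup>2) * (\<xi> i d p + 2 * \<beta> * d p - 2 * lam))"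
  have sm: "smooth_fun A \<kappa>" unfolding \<kappa>_def by (rule smooth_fun_mult') (use i in simp_all)
  have K: "g (f X) (f Y) = (\<lambda>p. \<kappa> p * g (P X) Y p)" if "vector_field A X" "vector_field A Y" for X Y
    using g_f_f_xi[OF i that] by (simp add: \<kappa>_def fun_eq_iff)
  obtain Z where Z: "vector_field A Z" "g (P Z) Z p \<noteq> 0" by (rule horizontal_exists)
  have "\<xi> j (g (f Z) (f Z)) p = \<kappa> p * (2 * g (P (bracket (\<xi> j) Z)) Z p) + 2 * \<beta> * (\<kappa> p * g (P Z) Z p)"
  proof -
    have "\<xi> j (g (f Z) (f Z)) p = g (f (bracket (\<xi> j) Z)) (f Z) p + g (f Z) (f (bracket (\<xi> j) Z)) p
        + 2 * \<beta> * g (f Z) (f Z) p"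
      using j Z by (simp add: vf_xi_g bracket_xi_f P_f)
    also have "g (f Z) (f (bracket (\<xi> j) Z)) = g (f (bracket (\<xi> j) Z)) (f Z)" using j Z by (intro g_sym) auto
    finally show ?thesis using j Z by (simp add: K)
  qed
  moreover have "\<xi> j (g (f Z) (f Z)) p = \<xi> j \<kappa> p * g (P Z) Z p
      + \<kappa> p * (2 * g (P (bracket (\<xi> j) Z)) Z p + 2 * \<beta> * g (P Z) Z p)"
  proof -
    have "\<xi> j (g (f Z) (f Z)) p = \<xi> j \<kappa> p * g (P Z) Z p + \<kappa> p * \<xi> j (g (P Z) Z) p"
      using j Z sm by (simp add: K vf_mult'[of "\<xi> j"])
    also have "\<xi> j (g (P Z) Z) p = g (P (bracket (\<xi> j) Z)) Z p + g (P Z) (bracket (\<xi> j) Z) p + 2 * \<beta> * g (P Z) Z p"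
      using j Z by (simp add: vf_xi_g bracket_xi_P P_P)
    also have "g (P Z) (bracket (\<xi> j) Z) = g (P (bracket (\<xi> j) Z)) Z"
      using j Z g_sym[of Z "P (bracket (\<xi> j) Z)"] by (simp add: g_P_sym)
    finally show ?thesis by simp
  qed
  ultimately have "\<xi> j \<kappa> p * g (P Z) Z p = 0" by (simp add: algebra_simps)
  then have "\<xi> j \<kappa> p = 0" using Z by simp
  moreover have "\<xi> j \<kappa> p = 1 / (2 * real s * \<beta>\<^sup>2) * (\<xi> j (\<xi> i d) p + 2 * \<beta> * \<xi> j d p)"
    unfolding \<kappa>_def using i j
    by (simp add: vf_cmult[of "\<xi> j"] vf_add'[of "\<xi> j"] vf_diff'[of "\<xi> j"] vf_const del: times_divide_eq_left)
  ultimately show ?thesis using beta_nonzero s_gt_1 by simp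
qed

text \<open>Sum \<open>xi_xi_d\<close> over i. The sum of the \<xi> i (d) is constant by
  \<open>delta_xi_xi\<close>, so the second-order terms disappear and 2 s \<beta> times \<xi> j (d)
  remains.\<close>

lemma xi_d:
  assumes j: "1 \<le> j" "j \<le> s" shows "\<xi> j d p = 0"
proof -
  have xd: "\<xi> i d p = (\<Sum>k=1..s. \<xi> i (\<delta> k) p)" if "1 \<le> i" "i \<le> s" for i p
    unfolding d_def using that by (subst vf_sum'[of "\<xi> i"]) auto
  have "(\<Sum>i=1..s. \<xi> i d p) = (real s)\<^sup>2 * (lam + mu)" for p
  proof -
    have "(\<Sum>i=1..s. \<xi> i d p) = (\<Sum>i=1..s. \<Sum>k=1..s. \<xi> i (\<delta> k) p)" by (simp add: xd)
    \<comment> \<open>Exchanging the sums symmetrises the array, and only its symmetric part is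
      known.\<close>
    moreover have "(\<Sum>i=1..s. \<Sum>k=1..s. \<xi> i (\<delta> k) p) = (\<Sum>i=1..s. \<Sum>k=1..s. \<xi> k (\<delta> i) p)"
      by (rule sum.swap)
    moreover have "(\<Sum>i=1..s. \<Sum>k=1..s. \<xi> i (\<delta> k) p) + (\<Sum>i=1..s. \<Sum>k=1..s. \<xi> k (\<delta> i) p)
        = (\<Sum>i=1..s. \<Sum>k=1..s. 2 * (lam + mu))"
      unfolding sum.distrib[symmetric] by (intro sum.cong) (auto simp: delta_xi_xi)
    ultimately show ?thesis by (simp add: power2_eq_square algebra_simps)
  qed
  then have const: "(\<lambda>p. \<Sum>i=1..s. \<xi> i d p) = (\<lambda>_. (real s)\<^sup>2 * (lam + mu))" by auto
  have "(\<Sum>i=1..s. \<xi> j (\<xi> i d) p) = \<xi> j (\<lambda>p. \<Sum>i=1..s. \<xi> i d p) p"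
    using j by (subst vf_sum'[of "\<xi> j"]) auto
  also have "\<dots> = 0" unfolding const using j by (simp add: vf_const)
  finally have "(\<Sum>i=1..s. \<xi> j (\<xi> i d) p + 2 * \<beta> * \<xi> j d p) = real s * (2 * \<beta> * \<xi> j d p)"
    by (simp add: sum.distrib)
  moreover have "(\<Sum>i=1..s. \<xi> j (\<xi> i d) p + 2 * \<beta> * \<xi> j d p) = 0"
    using j by (intro sum.neutral) (auto simp: xi_xi_d)
  ultimately show ?thesis using beta_nonzero s_gt_1 by simp
qed

lemma ricci_soliton:
  assumes X: "vector_field A X" and Y: "vector_field A Y"
  shows "ricci A nabla X Y p = - 2 * real s * real n * \<beta>\<^sup>2 * g (P X) Y p - 2 * real n * \<beta>\<^sup>2 * (g X xb p * g Y xb p)"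
proof -
  \<comment> \<open>The coefficient in \<open>g_f_f_xi\<close> once the derivative of
    \<open>d\<close> has dropped out, at the fixed point \<open>p\<close>; any one of the \<xi>
    fields yields it.\<close>
  define \<kappa> where "\<kappa> = (\<beta> * d p - lam) / (real s * \<beta>\<^sup>2)"
  have s1: "1 \<le> (1::nat)" "1 \<le> s" using s_gt_1 by auto
  have K: "g (f X) (f Y) p = \<kappa> * g (P X) Y p" if "vector_field A X" "vector_field A Y" for X Y
  proof -
    have "\<kappa> = (2 * \<beta> * d p - 2 * lam) / (2 * real s * \<beta>\<^sup>2)"
      using beta_nonzero s_gt_1 by (simp add: \<kappa>_def field_simps)
    then show ?thesis using g_f_f_xi[OF s1 that, of p] xi_d[OF s1, of p] by simp
  qed
  \<comment> \<open>Otherwise \<open>f Z\<close> vanishes at \<open>p\<close> for every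
    \<open>Z\<close>; then so does \<open>f (f (P Z))\<close>, which is \<open>- Q (P Z)\<close>,
    and nonsingularity of \<open>Q\<close> forces \<open>P Z\<close> to vanish at \<open>p\<close>,
    against the choice of \<open>Z\<close>.\<close>
  have "\<kappa> \<noteq> 0"
  proof
    assume 0: "\<kappa> = 0"
    obtain Z where Z: "vector_field A Z" "g (P Z) Z p \<noteq> 0" by (rule horizontal_exists)
    have "g (f Z) (f Z) p = 0" using K[OF Z(1) Z(1)] 0 by simp
    then have "f Z h p = 0" for h using Z by (intro g_eq_0D[of "f Z"]) auto
    then have "g (f Z) (f W) p = 0" if "vector_field A W" for W
      using Z that by (intro one_form_local[OF g_one_form]) auto
    then have "g (f (f (P Z))) W p = 0" if "vector_field A W" for W
      using that Z by (simp add: f_skew[of "f Z"] f_P)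
    moreover have "f (f (P Z)) = - Q (P Z)"
    proof -
      have "(\<Sum>i=1..s. \<eta> i (P Z) \<odot> \<xi> i) = 0"
        using Z by (simp add: eta_eq g_P_xi fun_eq_iff sum_fun_apply)
      then show ?thesis using f_square[of "P Z"] Z by simp
    qed
    ultimately have "g (Q (P Z)) (Q (P Z)) p = 0" using Z by (simp add: g_uminus_left)
    then have "value_at (Q (P Z)) p = 0"
      using Z g_eq_0D[of "Q (P Z)" p] by (simp add: value_at_def fun_eq_iff)
    then have "value_at (P Z) p = 0" using Z by (intro Q_nonsingular[of "P Z" p]) auto
    then have "g (P Z) Z p = 0"
      using Z by (intro one_form_local[OF g_one_form]) (auto simp: value_at_def fun_eq_iff)
    with Z show False by simp
  qed
  have "lam - \<beta> * d p = - real s * \<beta>\<^sup>2 * \<kappa>" using beta_nonzero s_gt_1 by (simp add: \<kappa>_def)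
  then have "star_ricci A f nabla (P X) (P Y) p = - real s * \<beta>\<^sup>2 * \<kappa> * g (P X) (P Y) p"
    using star_ricci_soliton[of "P X" "P Y" p] X Y by (simp add: P_P)
  moreover have "star_ricci A f nabla (P X) (P Y) p
     = \<kappa> * (ricci A nabla (P X) (P Y) p + (2 * real n - 1) * real s * \<beta>\<^sup>2 * g (P X) (P Y) p)"
    using X Y by (intro star_ricci_eq_ricci K) (auto simp: P_P)
  ultimately have "\<kappa> * ricci A nabla (P X) (P Y) p = \<kappa> * (- 2 * real s * real n * \<beta>\<^sup>2 * g (P X) (P Y) p)"
    by (simp add: algebra_simps)
  then have "ricci A nabla (P X) (P Y) p = - 2 * real s * real n * \<beta>\<^sup>2 * g (P X) (P Y) p"
    by (simp only: mult_left_cancel[OF \<open>\<kappa> \<noteq> 0\<close>])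
  moreover have "g (P X) (P Y) = g (P X) Y" using X Y by (simp add: g_P_sym[symmetric] P_P)
  ultimately show ?thesis using X Y by (simp add: ricci_P_P[of X Y])
qed

text \<open>The first term of \<open>ricci_soliton\<close> is traced with trace 2n of
  \<open>P\<close>, the second with squared length s of \<open>xb\<close>; together they give the
  factor 2n + 1.\<close>

lemma scalar_curvature_soliton:
  "scalar_curvature A g nabla p = - 2 * real s * real n * (2 * real n + 1) * \<beta>\<^sup>2"
  unfolding scalar_curvature_def
proof (rule metric_trace_at_orthonormal)
  fix E assume E: "orthonormal_frame_at A g p E"
  have v: "vector_field A (E k)" if "k < DIM('e)" for k using orthonormal_frame_field[OF E that] .
  have "(\<Sum>i<DIM('e). ricci A nabla (E i) (E i) p)
    = (\<Sum>i<DIM('e). - 2 * real s * real n * \<beta>\<^sup>2 * g (P (E i)) (E i) p - 2 * real n * \<beta>\<^sup>2 * (g xb (E i) p * g (E i) xb p))"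
    using v by (intro sum.cong) (auto simp: ricci_soliton g_sym[of xb "E _"])
  also have "\<dots> = - 2 * real s * real n * \<beta>\<^sup>2 * (\<Sum>i<DIM('e). g (P (E i)) (E i) p)
      - 2 * real n * \<beta>\<^sup>2 * (\<Sum>i<DIM('e). g xb (E i) p * g (E i) xb p)"
    by (simp only: sum_subtractf sum_distrib_left)
  also have "\<dots> = - 2 * real s * real n * (2 * real n + 1) * \<beta>\<^sup>2"
    unfolding trace_P[OF E] frame_parseval[OF E xb_vf xb_vf] by (simp add: g_xb_xb algebra_simps)
  finally show "(\<Sum>i<DIM('e). ricci A nabla (E i) (E i) p) = - 2 * real s * real n * (2 * real n + 1) * \<beta>\<^sup>2" .
qed

end

theorem theorem7:
  fixes A :: "('a::{t2_space, second_countable_topology}, 'e::euclidean_space) atlas"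
    and n s :: nat
    and f Q :: "'a vfield \<Rightarrow> 'a vfield"
    and \<xi> :: "nat \<Rightarrow> 'a vfield"
    and \<eta> :: "nat \<Rightarrow> 'a vfield \<Rightarrow> 'a \<Rightarrow> real"
    and g :: "'a form2"
    and nabla :: "'a conn"
    and \<beta> lam mu :: real
    and V :: "'a vfield"
    and \<delta> :: "nat \<Rightarrow> 'a \<Rightarrow> real"
  assumes "weak_beta_f_kenmotsu A n s f Q \<xi> \<eta> g nabla (\<lambda>_. \<beta>)"
    and "\<beta> \<noteq> 0"
    and "star_eta_ricci_soliton A s f \<eta> g nabla V lam mu"
    and "\<forall>i\<in>{1..s}. smooth_fun A (\<delta> i)"
    and "V = (\<Sum>i=1..s. \<delta> i \<odot> \<xi> i)"
    and "V \<noteq> 0"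
  shows "(\<forall>i\<in>{1..s}. \<forall>X. vector_field A X \<longrightarrow> (\<forall>j\<in>{1..s}. \<eta> j X = 0) \<longrightarrow> X (\<delta> i) = 0)
    \<and> eta_einstein A s \<eta> g nabla
        (\<lambda>_. - 2 * real s * real n * \<beta>\<^sup>2) (\<lambda>_. 2 * (real s - 1) * real n * \<beta>\<^sup>2)
    \<and> (\<forall>p. scalar_curvature A g nabla p = - 2 * real s * real n * (2 * real n + 1) * \<beta>\<^sup>2)"
proof -
  interpret weak_f_kenmotsu_soliton A n s f Q \<xi> \<eta> g nabla \<beta> lam mu V \<delta>
    using assms by (simp add: weak_f_kenmotsu_soliton_def weak_f_kenmotsu_const_def weak_f_kenmotsu_soliton_axioms_def)
  have "X (\<delta> i) = 0"
    if "i \<in> {1..s}" "vector_field A X" "\<forall>j\<in>{1..s}. \<eta> j X = 0" for i X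
  proof
    fix p
    show "X (\<delta> i) p = 0 p"
      using that delta_horizontal[of i X p] by (simp add: eta_eq)
  qed
  \<comment> \<open>Here a + b = - 2 n \<beta>^2, the coefficient of the \<open>xb\<close> term in
    \<open>ricci_soliton\<close>, and \<open>g_P_left\<close> splits \<open>g (P X) Y\<close> into
    the metric and the \<eta> sum.\<close>
  moreover have "ricci A nabla X Y p = - 2 * real s * real n * \<beta>\<^sup>2 * g X Y p
      - - 2 * real s * real n * \<beta>\<^sup>2 * (\<Sum>i=1..s. \<eta> i X p * \<eta> i Y p)
      + (- 2 * real s * real n * \<beta>\<^sup>2 + 2 * (real s - 1) * real n * \<beta>\<^sup>2) * (eta_bar s \<eta> X p * eta_bar s \<eta> Y p)"
    if X: "vector_field A X" and Y: "vector_field A Y" for X Y p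
  proof -
    have "(\<Sum>i=1..s. \<eta> i X p * \<eta> i Y p) = (\<Sum>i=1..s. g X (\<xi> i) p * g Y (\<xi> i) p)"
      using X Y by (intro sum.cong) (auto simp: eta_eq)
    then show ?thesis
      using X Y by (simp add: ricci_soliton g_P_left eta_bar_eq algebra_simps)
  qed
  ultimately show ?thesis
    using scalar_curvature_soliton by (auto simp: eta_einstein_def)
qed

end
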